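(* Let $n\in\mathbb N$. The isomorphism classes of Lie algebras $\mathfrak g_A$ with $A\in M(2n-1,\mathbb R)$ non-nilpotent which admit a complex structure are the isomorphism classes of $\mathfrak g_M$ for $M\in M(2n-1,\mathbb R)$ of one of the following forms: (1) $M=M(1)$ with $\Lambda(M(1))\in\bigwedge^c_{2n-1}$; (2) $M=M(1)\oplus Q$ where $\Lambda(M(1))\in\bigwedge^c_{m_1}$ with $m_1$ odd, and $Q\in M_{J_r}(2r,\mathbb R)$ with $2r=2n-1-m_1$ ($r\ge1$) and $1\notin\mathrm{spec}(Q)$; (3) $M=M(0)\oplus Q$ where $\Lambda(M(0))\in\bigwedge^c_{m_0}$ with $m_0$ odd, and $Q\in M_{J_r}(2r,\mathbb R)$ with $2r=2n-1-m_0$ ($r\ge1$), $0\notin\mathrm{spec}(Q)=\{\mu_1,\ldots,\mu_s\}$ and $1=|\mu_1|\ge\cdots\ge|\mu_s|>0$. The isomorphism classes of $\mathfrak g_M$ for $M$ as in (1), (2), (3) are parametrized (via $M\mapsto\Lambda(M(1))$, $M\mapsto(\Lambda(M(1)),[Q])$, $M\mapsto(\Lambda(M(0)),[Q])$), respectively, by $$(1)\ \bigwedge{}^c_{2n-1},\qquad (2)\ \bigcup_{k=1}^{n-1}\Big(\bigwedge{}^c_{2k-1}\times\mathcal C^1_{n-k}\Big),\qquad (3)\ \bigcup_{k=1}^{n-1}\Big(\bigwedge{}^c_{2k-1}\times\mathcal C^0_{n-k}\Big).$$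
   Context: For $A\in M(d,\mathbb R)$, $\mathfrak g_A=\mathbb R e_0\ltimes_A\mathbb R^d$ denotes the $(d+1)$-dimensional real Lie algebra $\mathbb R e_0\oplus\mathbb R^d$ with $[e_0,v]=Av$ and $[v,w]=0$ for $v,w\in\mathbb R^d$. A complex structure on a real Lie algebra $\mathfrak g$ is a linear automorphism $j$ of the vector space $\mathfrak g$ with $j^2=-\mathrm{id}$ and $[x,y]+j([jx,y]+[x,jy])-[jx,jy]=0$ for all $x,y\in\mathfrak g$. $\mathrm{spec}(C)$ is the set of distinct complex eigenvalues of $C$; $\oplus$ is block-diagonal sum, $N^{\oplus p}$ the block-diagonal sum of $p$ copies of $N$. For a real eigenvalue $\lambda$ of $M$, $M(\lambda)\in M(m_\lambda,\mathbb R)$ denotes the direct sum of all Jordan blocks of $M$ with eigenvalue $\lambda$ (so $m_\lambda$ is the algebraic multiplicity of $\lambda$). $J_r=\begin{pmatrix}0&-I_r\\ I_r&0\end{pmatrix}$ and $M_{J_r}(2r,\mathbb R)=\{B\in M(2r,\mathbb R): BJ_r=J_rB\}$. $\mathcal J_n(b)$ ($n\ge2$) is the $n\times n$ Jordan block with $b$ on the diagonal, ones on the subdiagonal and zeros elsewhere. $\bigwedge_m$ is the set consisting of the symbol $(m)$ and all tuples of integers $(n_1,\ldots,n_k;p_1,\ldots,p_k;t)$ with $k\ge1$, $n_1>\cdots>n_k\ge2$, all $p_i>0$, $t\ge0$ and $\sum_i n_ip_i+t=m$. For $A\in M(m,\mathbb R)$ whose only eigenvalue is $b\in\mathbb R$: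 $\Lambda(A)=(m)$ if $A=bI_m$, and $\Lambda(A)=(n_1,\ldots,n_k;p_1,\ldots,p_k;t)$ if $A$ is conjugate to $\mathcal J_{n_1}(b)^{\oplus p_1}\oplus\cdots\oplus\mathcal J_{n_k}(b)^{\oplus p_k}\oplus bI_t$. For odd $m$, $\bigwedge^c_m\subset\bigwedge_m$ consists of $(m)$ together with all tuples $(n_1,\ldots,n_k;p_1,\ldots,p_k;t)\in\bigwedge_m$ satisfying one of: (i) $t$ is odd and all $p_i$ are even; (ii) $t$ is odd, $p_i$ is even for all $i\le k-1$, $n_k=2$ and $p_k$ is odd; (iii) $t$ is even, $k\ge2$, and there is $2\le\ell\le k$ with $n_{\ell-1}=n_\ell+1$, $p_{\ell-1}$ and $p_\ell$ odd, and $p_i$ even for all $i\notin\{\ell-1,\ell\}$. $\mathcal C^1_r$ is the set of $GL(2r,\mathbb R)$-conjugacy classes of matrices $Q\in M_{J_r}(2r,\mathbb R)$ with $1\notin\mathrm{spec}(Q)$ (two such matrices are identified if they are conjugate in $GL(2r,\mathbb R)$). $\mathcal C^0_r$ is the quotient of the set of $Q\in M_{J_r}(2r,\mathbb R)$ with $0\notin\mathrm{spec}(Q)=\{\mu_1,\ldots,\mu_s\}$ and $1=|\mu_1|\ge\cdots\ge|\mu_s|>0$ by the relation: $Q_1\sim Q_2$ if and only if $Q_1$ is $GL(2r,\mathbb R)$-conjugate to $Q_2$ or to $-Q_2$. *)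

theory Defs
  imports
    "Jordan_Normal_Form.Jordan_Normal_Form"
    "Jordan_Normal_Form.Spectral_Radius"
    "Jordan_Normal_Form.VS_Connect"
begin

section \<open>Real Lie algebras, isomorphisms, complex structures\<close>

record 'a lie_alg = "(real, 'a) module" +
  lie_bracket :: "'a \<Rightarrow> 'a \<Rightarrow> 'a"

locale real_lie_algebra = vectorspace class_ring L for L :: "'a lie_alg" (structure) +
  assumes bracket_closed:
      "\<lbrakk>x \<in> carrier L; y \<in> carrier L\<rbrakk> \<Longrightarrow> lie_bracket L x y \<in> carrier L"
    and bracket_add_left:
      "\<lbrakk>x \<in> carrier L; y \<in> carrier L; z \<in> carrier L\<rbrakk> \<Longrightarrow>
        lie_bracket L (x \<oplus> y) z = lie_bracket L x z \<oplus> lie_bracket L y z"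
    and bracket_smult_left:
      "\<lbrakk>x \<in> carrier L; y \<in> carrier L\<rbrakk> \<Longrightarrow>
        lie_bracket L (c \<odot> x) y = c \<odot> lie_bracket L x y"
    and bracket_add_right:
      "\<lbrakk>x \<in> carrier L; y \<in> carrier L; z \<in> carrier L\<rbrakk> \<Longrightarrow>
        lie_bracket L x (y \<oplus> z) = lie_bracket L x y \<oplus> lie_bracket L x z"
    and bracket_smult_right:
      "\<lbrakk>x \<in> carrier L; y \<in> carrier L\<rbrakk> \<Longrightarrow>
        lie_bracket L x (c \<odot> y) = c \<odot> lie_bracket L x y"
    and bracket_alternating: "x \<in> carrier L \<Longrightarrow> lie_bracket L x x = \<zero>"
    and jacobi:
      "\<lbrakk>x \<in> carrier L; y \<in> carrier L; z \<in> carrier L\<rbrakk> \<Longrightarrow>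
        lie_bracket L x (lie_bracket L y z) \<oplus> lie_bracket L y (lie_bracket L z x)
          \<oplus> lie_bracket L z (lie_bracket L x y) = \<zero>"

definition lie_isomorphic :: "'a lie_alg \<Rightarrow> 'b lie_alg \<Rightarrow> bool" where
  "lie_isomorphic L L' \<longleftrightarrow>
    (\<exists>f. linear_map class_ring L L' f \<and> bij_betw f (carrier L) (carrier L') \<and>
      (\<forall>x\<in>carrier L. \<forall>y\<in>carrier L. f (lie_bracket L x y) = lie_bracket L' (f x) (f y)))"

definition lie_iso_class :: "'a lie_alg \<Rightarrow> 'a lie_alg set" where
  "lie_iso_class L = {L'. real_lie_algebra L' \<and> lie_isomorphic L L'}"

definition complex_structure :: "'a lie_alg \<Rightarrow> ('a \<Rightarrow> 'a) \<Rightarrow> bool" where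
  "complex_structure L j \<longleftrightarrow>
    linear_map class_ring L L j \<and> bij_betw j (carrier L) (carrier L) \<and>
    (\<forall>x\<in>carrier L. j (j x) = \<ominus>\<^bsub>L\<^esub> x) \<and>
    (\<forall>x\<in>carrier L. \<forall>y\<in>carrier L.
      lie_bracket L x y
        \<oplus>\<^bsub>L\<^esub> j (lie_bracket L (j x) y \<oplus>\<^bsub>L\<^esub> lie_bracket L x (j y))
        \<ominus>\<^bsub>L\<^esub> lie_bracket L (j x) (j y) = \<zero>\<^bsub>L\<^esub>)"


section \<open>The Lie algebra $\mathbb{R} e_0 \ltimes_A \mathbb{R}^d$\<close>

text \<open>The pair \<open>(s, v)\<close> stands for \<open>s e\<^sub>0 + v\<close>; bilinear and alternating extension of
  \<open>[e\<^sub>0, v] = A v\<close>, \<open>[v, w] = 0\<close> gives the bracket below. The fields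
  \<open>mult\<close> and \<open>one\<close> of the module record carry no meaning.\<close>

definition almost_abelian :: "real mat \<Rightarrow> (real \<times> real vec) lie_alg" where
  "almost_abelian A =
    \<lparr> carrier = UNIV \<times> carrier_vec (dim_row A),
      mult = undefined,
      one = undefined,
      zero = (0, 0\<^sub>v (dim_row A)),
      add = (\<lambda>(s, v) (t, w). (s + t, v + w)),
      smult = (\<lambda>c (s, v). (c * s, c \<cdot>\<^sub>v v)),
      lie_bracket = (\<lambda>(s, v) (t, w). (0, s \<cdot>\<^sub>v (A *\<^sub>v w) - t \<cdot>\<^sub>v (A *\<^sub>v v))) \<rparr>"

lemma almost_abelian_lie_algebra:
  assumes A: "A \<in> carrier_mat d d"
  shows "real_lie_algebra (almost_abelian A)"
proof -
  have [simp]: "dim_row A = d" "dim_col A = d" using A by auto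
  have ab: "abelian_group (almost_abelian A)"
  proof (rule abelian_groupI)
    fix x assume "x \<in> carrier (almost_abelian A)"
    then obtain s v where "x = (s, v)" "v \<in> carrier_vec d"
      by (auto simp: almost_abelian_def)
    then show "\<exists>y\<in>carrier (almost_abelian A). y \<oplus>\<^bsub>almost_abelian A\<^esub> x = \<zero>\<^bsub>almost_abelian A\<^esub>"
      by (intro bexI[of _ "(- s, - v)"]) (auto simp: almost_abelian_def)
  qed (auto simp: almost_abelian_def)
  have field: "field (class_ring :: real ring)" by (rule class_field.field_axioms)
  have mod: "module class_ring (almost_abelian A)"
  proof (rule module.intro)
    show "cring (class_ring :: real ring)" using field by (simp add: field_def domain_def)
    show "abelian_group (almost_abelian A)" by fact
    show "module_axioms class_ring (almost_abelian A)"
      by unfold_locales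
         (auto simp: almost_abelian_def algebra_simps add_smult_distrib_vec
            smult_add_distrib_vec smult_smult_assoc)
  qed
  have mv: "A *\<^sub>v v \<in> carrier_vec d" if "v \<in> carrier_vec d" for v
    using A that by simp
  have md: "A *\<^sub>v (v + w) = A *\<^sub>v v + A *\<^sub>v w"
    if "v \<in> carrier_vec d" "w \<in> carrier_vec d" for v w
    using A that by (simp add: mult_add_distrib_mat_vec)
  have ms: "A *\<^sub>v (c \<cdot>\<^sub>v v) = c \<cdot>\<^sub>v (A *\<^sub>v v)" if "v \<in> carrier_vec d" for c v
    using A that by (simp add: mult_mat_vec)
  have mm: "A *\<^sub>v (v - w) = A *\<^sub>v v - A *\<^sub>v w"
    if "v \<in> carrier_vec d" "w \<in> carrier_vec d" for v w
    using A that by (simp add: mult_minus_distrib_mat_vec)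
  have [simp]: "(A *\<^sub>v u) $ i = row A i \<bullet> u" if "i < d" for i u
    using that by simp
  show ?thesis
  proof (intro real_lie_algebra.intro vectorspace.intro real_lie_algebra_axioms.intro mod field)
    fix x y z :: "real \<times> real vec"
    assume x: "x \<in> carrier (almost_abelian A)" and y: "y \<in> carrier (almost_abelian A)"
    obtain a u where [simp]: "x = (a, u)" by (cases x)
    obtain b v where [simp]: "y = (b, v)" by (cases y)
    obtain c w where [simp]: "z = (c, w)" by (cases z)
    have [simp]: "u \<in> carrier_vec d" "v \<in> carrier_vec d"
      using x y by (auto simp: almost_abelian_def)
    note [simp del] = index_mult_mat_vec
    have [simp]: "dim_vec (A *\<^sub>v v') = d" for v' by simp
    note cv = carrier_vecD
    have [simp]: "dim_vec u = d" "dim_vec v = d" by (auto simp: cv)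
    show "lie_bracket (almost_abelian A) x y \<in> carrier (almost_abelian A)"
      using A by (auto simp: almost_abelian_def)
    show "lie_bracket (almost_abelian A) (k \<odot>\<^bsub>almost_abelian A\<^esub> x) y =
      k \<odot>\<^bsub>almost_abelian A\<^esub> lie_bracket (almost_abelian A) x y" for k
      by (auto simp: almost_abelian_def ms algebra_simps intro!: eq_vecI)
    show "lie_bracket (almost_abelian A) x (k \<odot>\<^bsub>almost_abelian A\<^esub> y) =
      k \<odot>\<^bsub>almost_abelian A\<^esub> lie_bracket (almost_abelian A) x y" for k
      by (auto simp: almost_abelian_def ms algebra_simps intro!: eq_vecI)
    show "lie_bracket (almost_abelian A) x x = \<zero>\<^bsub>almost_abelian A\<^esub>"
      by (auto simp: almost_abelian_def intro!: eq_vecI)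
    assume z: "z \<in> carrier (almost_abelian A)"
    have [simp]: "w \<in> carrier_vec d" using z by (auto simp: almost_abelian_def)
    have [simp]: "dim_vec w = d" by (auto simp: cv)
    show "lie_bracket (almost_abelian A) (x \<oplus>\<^bsub>almost_abelian A\<^esub> y) z =
      lie_bracket (almost_abelian A) x z \<oplus>\<^bsub>almost_abelian A\<^esub> lie_bracket (almost_abelian A) y z"
      by (auto simp: almost_abelian_def md algebra_simps intro!: eq_vecI)
    show "lie_bracket (almost_abelian A) x (y \<oplus>\<^bsub>almost_abelian A\<^esub> z) =
      lie_bracket (almost_abelian A) x y \<oplus>\<^bsub>almost_abelian A\<^esub> lie_bracket (almost_abelian A) x z"
      by (auto simp: almost_abelian_def md algebra_simps intro!: eq_vecI)
    show "lie_bracket (almost_abelian A) x (lie_bracket (almost_abelian A) y z)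
        \<oplus>\<^bsub>almost_abelian A\<^esub> lie_bracket (almost_abelian A) y (lie_bracket (almost_abelian A) z x)
        \<oplus>\<^bsub>almost_abelian A\<^esub> lie_bracket (almost_abelian A) z (lie_bracket (almost_abelian A) x y)
        = \<zero>\<^bsub>almost_abelian A\<^esub>"
      using A by (auto simp: almost_abelian_def mm ms mv algebra_simps intro!: eq_vecI)
  qed
qed


section \<open>Matrices\<close>

definition nilpotent_mat :: "real mat \<Rightarrow> bool" where
  "nilpotent_mat A \<longleftrightarrow> (\<exists>k. A ^\<^sub>m k = 0\<^sub>m (dim_row A) (dim_row A))"

definition spec :: "real mat \<Rightarrow> complex set" where
  "spec C = spectrum (map_mat complex_of_real C)"

definition J_std :: "nat \<Rightarrow> real mat" where
  "J_std r = four_block_mat (0\<^sub>m r r) (- 1\<^sub>m r) (1\<^sub>m r) (0\<^sub>m r r)"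

definition M_J :: "nat \<Rightarrow> real mat set" where
  "M_J r = {B \<in> carrier_mat (2 * r) (2 * r). B * J_std r = J_std r * B}"

text \<open>The library's \<^const>\<open>jordan_block\<close> has its ones on the superdiagonal.\<close>

definition sub_jordan_block :: "nat \<Rightarrow> real \<Rightarrow> real mat" where
  "sub_jordan_block n b = transpose_mat (jordan_block n b)"

text \<open>\<open>jordan_part M a N\<close>: \<open>N\<close> is the direct sum \<open>M(a)\<close> of all Jordan blocks (size one included)
  of \<open>M\<close> with eigenvalue \<open>a\<close>. It is determined by \<open>M\<close> up to the order of the blocks,
  whence a relation; the remaining summand \<open>R\<close> may be of size zero.\<close>

definition jordan_part :: "real mat \<Rightarrow> real \<Rightarrow> real mat \<Rightarrow> bool" where
  "jordan_part M a N \<longleftrightarrow>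
    (\<exists>ns r R. (\<forall>k\<in>set ns. k \<ge> 1) \<and> N = diag_block_mat (map (\<lambda>k. sub_jordan_block k a) ns) \<and>
      R \<in> carrier_mat r r \<and> complex_of_real a \<notin> spec R \<and>
      similar_mat M (diag_block_mat [N, R]))"


section \<open>The invariant $\Lambda$\<close>

text \<open>\<open>Scalar_type m\<close> is the symbol \<open>(m)\<close>, and \<open>Block_type ns ps t\<close> is the tuple
  \<open>(n\<^sub>1,\<dots>,n\<^sub>k; p\<^sub>1,\<dots>,p\<^sub>k; t)\<close>.\<close>

datatype block_type = Scalar_type nat | Block_type "nat list" "nat list" nat

definition block_types :: "nat \<Rightarrow> block_type set" where
  "block_types m = insert (Scalar_type m)
    {Block_type ns ps t | ns ps t.
      length ps = length ns \<and> length ns \<ge> 1 \<and> sorted_wrt (>) ns \<and>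
      (\<forall>n\<in>set ns. n \<ge> 2) \<and> (\<forall>p\<in>set ps. p > 0) \<and>
      (\<Sum>i<length ns. ns ! i * ps ! i) + t = m}"

definition block_type_mat :: "real \<Rightarrow> nat list \<Rightarrow> nat list \<Rightarrow> nat \<Rightarrow> real mat" where
  "block_type_mat b ns ps t = diag_block_mat
    (concat (map2 (\<lambda>n p. replicate p (sub_jordan_block n b)) ns ps) @ [b \<cdot>\<^sub>m 1\<^sub>m t])"

definition has_block_type :: "real mat \<Rightarrow> block_type \<Rightarrow> bool" where
  "has_block_type A \<tau> \<longleftrightarrow>
    (\<exists>m b. A \<in> carrier_mat m m \<and> spec A = {complex_of_real b} \<and> \<tau> \<in> block_types m \<and>
      (case \<tau> of
        Scalar_type _ \<Rightarrow> A = b \<cdot>\<^sub>m 1\<^sub>m m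
      | Block_type ns ps t \<Rightarrow> similar_mat A (block_type_mat b ns ps t)))"

text \<open>Meaningful for matrices with a single, real eigenvalue.\<close>

definition block_type_of :: "real mat \<Rightarrow> block_type" ("\<Lambda>") where
  "\<Lambda> A = (THE \<tau>. has_block_type A \<tau>)"

text \<open>The set \<open>\<And>\<^sup>c\<^sub>m\<close>, used for odd \<open>m\<close> only. List positions start at 0,
  so \<open>l\<close> and \<open>Suc l\<close> below are \<open>\<ell> - 1\<close> and \<open>\<ell>\<close> in 1-based numbering.\<close>

definition c_block_types :: "nat \<Rightarrow> block_type set" where
  "c_block_types m = insert (Scalar_type m)
    {Block_type ns ps t | ns ps t. Block_type ns ps t \<in> block_types m \<and>
      ((odd t \<and> (\<forall>i<length ps. even (ps ! i)))
     \<or> (odd t \<and> (\<forall>i<length ps - 1. even (ps ! i)) \<and> last ns = 2 \<and> odd (last ps))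
     \<or> (even t \<and> length ns \<ge> 2 \<and>
         (\<exists>l. Suc l < length ns \<and> ns ! l = ns ! Suc l + 1 \<and>
           odd (ps ! l) \<and> odd (ps ! Suc l) \<and>
           (\<forall>i<length ps. i \<notin> {l, Suc l} \<longrightarrow> even (ps ! i)))))}"


section \<open>The moduli sets $\mathcal{C}^1_r$ and $\mathcal{C}^0_r$\<close>

definition Q1_set :: "nat \<Rightarrow> real mat set" where
  "Q1_set r = {Q \<in> M_J r. 1 \<notin> spec Q}"

definition Q1_rel :: "nat \<Rightarrow> (real mat \<times> real mat) set" where
  "Q1_rel r = {(Q, Q'). Q \<in> Q1_set r \<and> Q' \<in> Q1_set r \<and> similar_mat Q Q'}"

definition C1 :: "nat \<Rightarrow> real mat set set" where
  "C1 r = Q1_set r // Q1_rel r"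

definition Q0_set :: "nat \<Rightarrow> real mat set" where
  "Q0_set r = {Q \<in> M_J r. 0 \<notin> spec Q \<and>
    (\<exists>\<mu>s. spec Q = set \<mu>s \<and> distinct \<mu>s \<and> \<mu>s \<noteq> [] \<and> cmod (hd \<mu>s) = 1 \<and>
      sorted_wrt (\<lambda>\<mu> \<nu>. cmod \<mu> \<ge> cmod \<nu>) \<mu>s \<and> cmod (last \<mu>s) > 0)}"

definition Q0_rel :: "nat \<Rightarrow> (real mat \<times> real mat) set" where
  "Q0_rel r = {(Q, Q'). Q \<in> Q0_set r \<and> Q' \<in> Q0_set r \<and>
    (similar_mat Q Q' \<or> similar_mat Q (- Q'))}"

definition C0 :: "nat \<Rightarrow> real mat set set" where
  "C0 r = Q0_set r // Q0_rel r"


section \<open>The three normal forms\<close>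

text \<open>In \<open>form2\<close> and \<open>form3\<close> the equation \<open>m + 2 * r = 2 * n - 1\<close> is
  \<open>2r = 2n - 1 - m\<close> without truncated subtraction of \<open>m\<close>.\<close>

definition form1 :: "nat \<Rightarrow> real mat \<Rightarrow> bool" where
  "form1 n M \<longleftrightarrow> M \<in> carrier_mat (2 * n - 1) (2 * n - 1) \<and> jordan_part M 1 M \<and>
    \<Lambda> M \<in> c_block_types (2 * n - 1)"

definition form2 :: "nat \<Rightarrow> nat \<Rightarrow> real mat \<Rightarrow> real mat \<Rightarrow> real mat \<Rightarrow> bool" where
  "form2 n r M N Q \<longleftrightarrow>
    (\<exists>m. odd m \<and> r \<ge> 1 \<and> m + 2 * r = 2 * n - 1 \<and>
      M = diag_block_mat [N, Q] \<and>
      N \<in> carrier_mat m m \<and> jordan_part M 1 N \<and> \<Lambda> N \<in> c_block_types m \<and>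
      Q \<in> M_J r \<and> 1 \<notin> spec Q)"

definition form3 :: "nat \<Rightarrow> nat \<Rightarrow> real mat \<Rightarrow> real mat \<Rightarrow> real mat \<Rightarrow> bool" where
  "form3 n r M N Q \<longleftrightarrow>
    (\<exists>m. odd m \<and> r \<ge> 1 \<and> m + 2 * r = 2 * n - 1 \<and>
      M = diag_block_mat [N, Q] \<and>
      N \<in> carrier_mat m m \<and> jordan_part M 0 N \<and> \<Lambda> N \<in> c_block_types m \<and>
      Q \<in> Q0_set r)"

end

theory Submission
  imports
    Defs
    "HOL-Library.Multiset"
    "Jordan_Normal_Form.Jordan_Normal_Form_Uniqueness"
begin

text \<open>A complex structure on \<open>\<gg>\<^sub>A\<close> is the same as an \<open>A\<close>-invariant hyperplane on which \<open>A\<close>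
  commutes with a complex structure \<open>J\<close>; that is, \<open>A\<close> is similar to a matrix with blocks
  \<open>B, v, 0, a\<close> where \<open>B J = J B\<close>. A real matrix commutes with some \<open>J\<close> iff for every real eigenvalue
  and every size the number of its Jordan blocks is even, and bordering \<open>B\<close> by \<open>v\<close> and \<open>a\<close>
  enlarges exactly one Jordan block (possibly of size 0) with eigenvalue \<open>a\<close> by one. Hence \<open>\<gg>\<^sub>A\<close>
  has a complex structure iff for some real \<open>a\<close> and some \<open>q \<ge> 1\<close> the numbers of Jordan blocks
  with real eigenvalue are odd precisely for eigenvalue \<open>a\<close> and block_sizes \<open>q\<close> and \<open>q - 1\<close>.
  Since \<open>\<gg>\<^sub>A\<close> determines a non-nilpotent \<open>A\<close> up to similarity and a nonzero factor, all that
  remains is to normalise \<open>a\<close> to 1, or, if \<open>a = 0\<close>, the spectral radius to 1. Real matrices are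
  compared through their complex Jordan blocks.\<close>

section \<open>Jordan blocks of complex matrices\<close>

text \<open>The hyperplane comes from the parity of \<open>d = 2 * n - 1\<close>: on the
  odd-dimensional ideal \<open>R^d\<close> no endomorphism squares to -1, so \<open>j\<close> cannot
  preserve it, and the vectors that \<open>j\<close> keeps in it form a hyperplane. Integrability,
  tested on one vector off the hyperplane and one in it, says that \<open>A\<close> preserves the
  hyperplane and commutes there with \<open>j\<close>. Bordering is controlled by kernels. Put
  \<open>N\<close> for \<open>B\<close> minus the scalar \<open>a\<close>. Bordering makes the
  kernel of the k-th power exceed that of \<open>N^k\<close> by one exactly when
  \<open>N^(k-1) v\<close> lies in the range of \<open>N^k\<close>. This persists once it holds, so
  the excess is a step function, and block counts are second differences of these dimensions: one
  block of size q - 1 turns into one of size q. Non-nilpotency keeps an isomorphism from moving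
  \<open>R^d\<close>: a vector of \<open>R^d\<close> sent outside it would force the square of the
  target matrix to vanish. No real canonical form is needed, because real matrices similar over the
  complex numbers are similar over the reals.\<close>

lemma similar_dsum:
  assumes "similar_mat A A'" "similar_mat B B'"
  shows "similar_mat (diag_block_mat [A, B]) (diag_block_mat [A', B'])"
  using similar_diag_mat_block_mat[of "[(A, A'), (B, B')]"] assms by auto

lemma diag_block_mat_two:
  assumes "A \<in> carrier_mat n n" "B \<in> carrier_mat m m"
  shows "diag_block_mat [A, B] = four_block_mat A (0\<^sub>m n m) (0\<^sub>m m n) B"
  unfolding diag_block_mat.simps(2)[of A] diag_block_mat_singleton Let_def using assms by auto

lemma dsum_carrier:
  assumes "A \<in> carrier_mat n n" "B \<in> carrier_mat m m"
  shows "diag_block_mat [A, B] \<in> carrier_mat (n + m) (n + m)"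
  unfolding diag_block_mat_two[OF assms] using assms by auto

lemma similar_dsum_commute:
  fixes A B :: "'a :: comm_ring_1 mat"
  assumes A: "A \<in> carrier_mat n n" and B: "B \<in> carrier_mat m m"
  shows "similar_mat (diag_block_mat [A, B]) (diag_block_mat [B, A])"
proof -
  let ?P = "four_block_mat (0\<^sub>m n m) (1\<^sub>m n) (1\<^sub>m m) (0\<^sub>m m n) :: 'a mat"
  let ?Q = "four_block_mat (0\<^sub>m m n) (1\<^sub>m m) (1\<^sub>m n) (0\<^sub>m n m) :: 'a mat"
  have PB: "?P * diag_block_mat [B, A] = four_block_mat (0\<^sub>m n m) A B (0\<^sub>m m n)"
    unfolding diag_block_mat_two[OF B A]
    by (subst mult_four_block_mat[of _ n m _ n _ m]) (use A B in auto)
  have "?P * diag_block_mat [B, A] * ?Q = diag_block_mat [A, B]"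
    unfolding PB diag_block_mat_two[OF A B]
    by (subst mult_four_block_mat[of _ n m _ n _ m]) (use A B in auto)
  moreover have "?P * ?Q = 1\<^sub>m (n + m)"
    by (subst mult_four_block_mat[of _ n m _ n _ m]) auto
  moreover have "?Q * ?P = 1\<^sub>m (n + m)"
    by (subst mult_four_block_mat[of _ m n _ m _ n]) (auto simp: add.commute)
  moreover have "?P \<in> carrier_mat (n + m) (n + m)" "?Q \<in> carrier_mat (n + m) (n + m)"
    by auto
  moreover have "diag_block_mat [B, A] \<in> carrier_mat (n + m) (n + m)"
    using dsum_carrier[OF B A] by (simp add: add.commute)
  ultimately have "similar_mat_wit (diag_block_mat [A, B]) (diag_block_mat [B, A]) ?P ?Q"
    using dsum_carrier[OF A B] by (intro similar_mat_witI[of _ _ "n + m"]) auto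
  then show ?thesis unfolding similar_mat_def by blast
qed

lemma diag_block_mat_append_two:
  "diag_block_mat (As @ Bs) = diag_block_mat [diag_block_mat As, diag_block_mat Bs]"
proof -
  have "diag_block_mat [diag_block_mat Bs] = diag_block_mat Bs" by (rule diag_block_mat_singleton)
  then show ?thesis unfolding diag_block_mat_append by (simp only: diag_block_mat.simps(2) Let_def)
qed

lemma jordan_matrix_append:
  "jordan_matrix (xs @ ys) = diag_block_mat [jordan_matrix xs, jordan_matrix ys]"
  unfolding jordan_matrix_def map_append diag_block_mat_append_two ..

lemma similar_refl_jordan_matrix: "similar_mat (jordan_matrix xs) (jordan_matrix xs)"
  using similar_mat_refl jordan_matrix_carrier by blast

lemma similar_jordan_matrix_append_commute:
  "similar_mat (jordan_matrix (xs @ ys)) (jordan_matrix (ys @ xs) :: 'a :: comm_ring_1 mat)"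
  unfolding jordan_matrix_append
  by (rule similar_dsum_commute[OF jordan_matrix_carrier jordan_matrix_carrier])

text \<open>Every reordering is built from swaps of neighbouring sublists: the head of
  \<open>xs\<close> is carried past \<open>us\<close> to the place it has in \<open>ys\<close>, and
  the rest is reordered by induction.\<close>

lemma similar_jordan_matrix_mset:
  assumes "mset xs = mset ys"
  shows "similar_mat (jordan_matrix xs) (jordan_matrix ys :: 'a :: comm_ring_1 mat)"
  using assms
proof (induction xs arbitrary: ys)
  case Nil
  then show ?case by (simp add: similar_refl_jordan_matrix)
next
  case (Cons x xs)
  from Cons.prems have "x \<in> set ys" by (metis list.set_intros(1) set_mset_mset)
  then obtain us vs where ys: "ys = us @ x # vs" by (meson split_list)
  with Cons.prems have "mset xs = mset (us @ vs)" by simp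
  from Cons.IH[OF this]
  have "similar_mat (jordan_matrix ([x] @ xs)) (jordan_matrix ([x] @ (us @ vs)))"
    unfolding jordan_matrix_append[of "[x]"] by (intro similar_dsum similar_refl_jordan_matrix)
  moreover have "similar_mat (jordan_matrix (([x] @ us) @ vs)) (jordan_matrix ((us @ [x]) @ vs))"
    unfolding jordan_matrix_append[of _ vs]
    by (intro similar_dsum similar_refl_jordan_matrix similar_jordan_matrix_append_commute)
  ultimately show ?case unfolding ys by (simp add: similar_mat_trans)
qed

text \<open>The number of blocks of given positive size and eigenvalue is computed from dimensions
  of generalized eigenspaces, which depend on \<open>A\<close> alone. Size 0 is treated apart:
  \<open>jordan_nf\<close> admits no empty blocks.\<close>

lemma jordan_nf_mset_unique:
  fixes A :: "'a :: field mat"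
  assumes "jordan_nf A xs" "jordan_nf A ys"
  shows "mset xs = mset ys"
proof (rule multiset_eqI)
  fix x :: "nat \<times> 'a"
  obtain k a where x: "x = (k, a)" by (cases x)
  show "count (mset xs) x = count (mset ys) x"
  proof (cases "k = 0")
    case True
    then have "x \<notin># mset xs" "x \<notin># mset ys"
      using assms x unfolding jordan_nf_def by force+
    then show ?thesis by (metis not_in_iff)
  next
    case False
    with compute_nr_of_jordan_blocks[OF assms(1) False, of a]
      compute_nr_of_jordan_blocks[OF assms(2) False, of a]
    have "length (filter ((=) x) xs) = length (filter ((=) x) ys)" by (simp add: x)
    moreover have "count (mset zs) x = length (filter ((=) x) zs)" for zs
      by (induction zs) auto
    ultimately show ?thesis by simp
  qed
qed

text \<open>The chosen list does not matter by \<open>jordan_nf_mset_unique\<close>. Over the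
  complex numbers the characteristic polynomial splits, so a list exists for every square
  matrix.\<close>

definition jordan_blocks :: "complex mat \<Rightarrow> (nat \<times> complex) multiset" where
  "jordan_blocks A = mset (SOME xs. jordan_nf A xs)"

lemma jordan_blocks_eqI:
  assumes "jordan_nf A xs" shows "jordan_blocks A = mset xs"
  unfolding jordan_blocks_def using assms jordan_nf_mset_unique someI[of "jordan_nf A"] by blast

lemma jordan_blocks_exE:
  assumes "A \<in> carrier_mat n n"
  obtains xs where "jordan_nf A xs" "jordan_blocks A = mset xs"
  using assms char_poly_factorized jordan_nf_exists jordan_blocks_eqI by metis

lemma similar_iff_jordan_blocks:
  assumes A: "A \<in> carrier_mat n n" and B: "B \<in> carrier_mat n n"
  shows "similar_mat A B \<longleftrightarrow> jordan_blocks A = jordan_blocks B"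
proof
  assume "similar_mat A B"
  then show "jordan_blocks A = jordan_blocks B"
    using similar_iff_same_jordan_nf[OF A B] by (simp add: jordan_blocks_def)
next
  assume eq: "jordan_blocks A = jordan_blocks B"
  obtain xs where xs: "jordan_nf A xs" "jordan_blocks A = mset xs" using jordan_blocks_exE[OF A] .
  obtain ys where ys: "jordan_nf B ys" "jordan_blocks B = mset ys" using jordan_blocks_exE[OF B] .
  have "similar_mat (jordan_matrix xs) (jordan_matrix ys)"
    using similar_jordan_matrix_mset eq xs ys by metis
  then show "similar_mat A B"
    using xs ys unfolding jordan_nf_def by (meson similar_mat_sym similar_mat_trans)
qed

lemma jordan_blocks_similar: "similar_mat A B \<Longrightarrow> jordan_blocks A = jordan_blocks B"
  using similar_iff_jordan_blocks
  by (metis carrier_matI similar_mat_def similar_mat_witD(4) similar_mat_witD(5))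

lemma jordan_blocks_jordan_matrix:
  "0 \<notin> fst ` set xs \<Longrightarrow> jordan_blocks (jordan_matrix xs) = mset xs"
  by (rule jordan_blocks_eqI) (simp add: jordan_nf_def similar_refl_jordan_matrix)

lemma jordan_blocks_dsum:
  assumes "A \<in> carrier_mat n n" "B \<in> carrier_mat m m"
  shows "jordan_blocks (diag_block_mat [A, B]) = jordan_blocks A + jordan_blocks B"
proof -
  obtain xs where xs: "jordan_nf A xs" "jordan_blocks A = mset xs"
    using jordan_blocks_exE[OF assms(1)] .
  obtain ys where ys: "jordan_nf B ys" "jordan_blocks B = mset ys"
    using jordan_blocks_exE[OF assms(2)] .
  have "jordan_nf (diag_block_mat [A, B]) (xs @ ys)"
    using jordan_nf_diag_block_mat[of "[(A, xs), (B, ys)]"] xs ys by auto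
  then show ?thesis using jordan_blocks_eqI xs ys by simp
qed

lemma jordan_blocks_smult:
  assumes "A \<in> carrier_mat n n" "c \<noteq> 0"
  shows "jordan_blocks (c \<cdot>\<^sub>m A) = image_mset (\<lambda>(k, a). (k, c * a)) (jordan_blocks A)"
proof -
  obtain xs where xs: "jordan_nf A xs" "jordan_blocks A = mset xs"
    using jordan_blocks_exE[OF assms(1)] .
  from jordan_blocks_eqI[OF jordan_nf_smult[OF xs(1) assms(2)]] show ?thesis by (simp add: xs)
qed

lemma jordan_blocks_size:
  assumes "A \<in> carrier_mat n n"
  shows "sum_mset (image_mset fst (jordan_blocks A)) = n"
proof -
  obtain xs where xs: "jordan_nf A xs" "jordan_blocks A = mset xs"
    using jordan_blocks_exE[OF assms(1)] .
  then have "similar_mat A (jordan_matrix xs)" by (simp add: jordan_nf_def)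
  then obtain P Q where "similar_mat_wit A (jordan_matrix xs) P Q" unfolding similar_mat_def by auto
  from carrier_matD(1)[OF similar_mat_witD2(5)[OF assms this]]
  have "sum_list (map fst xs) = n" by simp
  moreover have "sum_mset (image_mset fst (mset xs)) = sum_list (map fst xs)"
    by (metis mset_map sum_mset_sum_list)
  ultimately show ?thesis by (simp only: xs)
qed

lemma jordan_blocks_pos:
  assumes "A \<in> carrier_mat n n" "(k, a) \<in># jordan_blocks A"
  shows "k \<ge> 1"
proof -
  obtain xs where xs: "jordan_nf A xs" "jordan_blocks A = mset xs"
    using jordan_blocks_exE[OF assms(1)] .
  then have "(k, a) \<in> set xs" "0 \<notin> fst ` set xs" using assms(2) by (auto simp: jordan_nf_def)
  then show ?thesis by (cases k) force+
qed

lemma spectrum_jordan_blocks: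
  assumes "A \<in> carrier_mat n n"
  shows "spectrum A = snd ` set_mset (jordan_blocks A)"
proof -
  obtain xs where xs: "jordan_nf A xs" "jordan_blocks A = mset xs"
    using jordan_blocks_exE[OF assms(1)] .
  then have "0 \<notin> fst ` set xs" by (simp add: jordan_nf_def)
  \<comment> \<open>A factor with exponent 0 would contribute no root, so this uses that all block
    sizes are positive.\<close>
  then have "poly (\<Prod>(n, a)\<leftarrow>xs. [:- a, 1:] ^ n) x = 0 \<longleftrightarrow> x \<in> snd ` set xs" for x
    by (induction xs) (auto simp: poly_power)
  then show ?thesis
    unfolding spectrum_root_char_poly[OF assms] jordan_nf_char_poly[OF xs(1)] by (auto simp: xs)
qed

section \<open>Entrywise ring homomorphisms and complex conjugation\<close>

lemma similar_mat_map:
  assumes "semiring_hom h" "similar_mat A B"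
  shows "similar_mat (map_mat h A) (map_mat h B)"
proof -
  interpret semiring_hom h by fact
  from assms(2) obtain P Q where w: "similar_mat_wit A B P Q" unfolding similar_mat_def by auto
  define n where "n = dim_row A"
  note d = similar_mat_witD[OF n_def w]
  have "similar_mat_wit (map_mat h A) (map_mat h B) (map_mat h P) (map_mat h Q)"
  proof (rule similar_mat_witI[of _ _ n])
    show "map_mat h P * map_mat h Q = 1\<^sub>m n"
      using d by (simp flip: mat_hom_mult mat_hom_one)
    show "map_mat h Q * map_mat h P = 1\<^sub>m n"
      using d by (simp flip: mat_hom_mult mat_hom_one)
    show "map_mat h A = map_mat h P * map_mat h B * map_mat h Q"
      using d by (metis mat_hom_mult mult_carrier_mat)
  qed (use d in auto)
  then show ?thesis unfolding similar_mat_def by blast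
qed

lemma map_mat_diag_block_mat:
  assumes "h 0 = 0"
  shows "map_mat h (diag_block_mat As) = diag_block_mat (map (map_mat h) As)"
proof (induction As)
  case Nil
  show ?case by auto
next
  case (Cons A As)
  have z: "map_mat h (0\<^sub>m a b) = 0\<^sub>m a b" for a b using assms by auto
  have "map_mat h (diag_block_mat (A # As)) =
      four_block_mat (map_mat h A) (map_mat h (0\<^sub>m (dim_row A) (dim_col (diag_block_mat As))))
        (map_mat h (0\<^sub>m (dim_row (diag_block_mat As)) (dim_col A))) (map_mat h (diag_block_mat As))"
    by (simp add: Let_def) (subst map_four_block_mat[of _ "dim_row A" "dim_col A" _ "dim_col (diag_block_mat As)" _ "dim_row (diag_block_mat As)"], auto)
  also have "\<dots> = diag_block_mat (map (map_mat h) (A # As))"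
    unfolding z list.map diag_block_mat.simps(2) Let_def Cons.IH[symmetric] by simp
  finally show ?case .
qed

lemma map_mat_jordan_block:
  assumes "h 0 = 0" "h 1 = 1"
  shows "map_mat h (jordan_block k a) = jordan_block k (h a)"
  using assms by (intro eq_matI) auto

lemma map_mat_jordan_matrix:
  assumes "h 0 = 0" "h 1 = 1"
  shows "map_mat h (jordan_matrix xs) = jordan_matrix (map (map_prod id h) xs)"
  unfolding jordan_matrix_def map_mat_diag_block_mat[of h, OF assms(1)]
  by (auto simp: o_def map_mat_jordan_block[of h, OF assms] split_beta map_prod_def)

lemma semiring_hom_cnj: "semiring_hom cnj"
  by unfold_locales auto

lemma jordan_blocks_cnj:
  assumes "A \<in> carrier_mat n n"
  shows "jordan_blocks (map_mat cnj A) = image_mset (map_prod id cnj) (jordan_blocks A)"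
proof -
  obtain xs where xs: "jordan_nf A xs" "jordan_blocks A = mset xs"
    using jordan_blocks_exE[OF assms(1)] .
  from xs(1) have "jordan_nf (map_mat cnj A) (map (map_prod id cnj) xs)"
    unfolding jordan_nf_def
    using similar_mat_map[OF semiring_hom_cnj, of A "jordan_matrix xs"]
    by (auto simp: map_mat_jordan_matrix image_image image_iff)
  from jordan_blocks_eqI[OF this] show ?thesis by (simp add: xs)
qed

section \<open>Jordan blocks of real matrices\<close>

abbreviation cmat :: "real mat \<Rightarrow> complex mat" where
  "cmat \<equiv> map_mat complex_of_real"

lemma semiring_hom_of_real: "semiring_hom complex_of_real"
  by unfold_locales auto

lemma similar_mat_intertwine:
  fixes A B R :: "'a :: field mat"
  assumes A: "A \<in> carrier_mat n n" and B: "B \<in> carrier_mat n n" and R: "R \<in> carrier_mat n n"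
    and det: "det R \<noteq> 0" and eq: "A * R = R * B"
  shows "similar_mat A B"
proof -
  from det_non_zero_imp_unit[OF R det, of "()"] obtain S where S: "S \<in> carrier_mat n n"
    and RS: "R * S = 1\<^sub>m n" and SR: "S * R = 1\<^sub>m n"
    by (auto simp: Units_def ring_mat_def)
  have "R * B * S = A * (R * S)" unfolding eq[symmetric] using A R S by simp
  then have "A = R * B * S" using A unfolding RS by simp
  then have "similar_mat_wit A B R S" using A B R S RS SR by (intro similar_mat_witI)
  then show ?thesis unfolding similar_mat_def by blast
qed

lemma Re_cmat_mult:
  assumes "A \<in> carrier_mat n n" "B \<in> carrier_mat n n" "P \<in> carrier_mat n n"
  shows "map_mat Re (cmat A * P) = A * map_mat Re P" "map_mat Re (P * cmat B) = map_mat Re P * B"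
    "map_mat Im (cmat A * P) = A * map_mat Im P" "map_mat Im (P * cmat B) = map_mat Im P * B"
  using assms by (auto intro!: eq_matI sum.cong simp: scalar_prod_def)

text \<open>If \<open>P = X + \<i> Y\<close> intertwines two real matrices, so does \<open>X + t Y\<close> for every real \<open>t\<close>,
  and its determinant is a polynomial in \<open>t\<close> that does not vanish at \<open>\<i>\<close>.\<close>

lemma similar_mat_of_similar_cmat:
  assumes A: "A \<in> carrier_mat n n" and B: "B \<in> carrier_mat n n"
    and sim: "similar_mat (cmat A) (cmat B)"
  shows "similar_mat A B"
proof -
  obtain P Q where w: "similar_mat_wit (cmat A) (cmat B) P Q"
    using sim unfolding similar_mat_def by auto
  have cA: "cmat A \<in> carrier_mat n n" and cB: "cmat B \<in> carrier_mat n n" using A B by auto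
  note d = similar_mat_witD2[OF cA w]
  note [simp] = d(6,7)
  have AP: "cmat A * P = P * cmat B"
  proof -
    have "cmat A * P = P * cmat B * Q * P" using d(3) by simp
    also have "\<dots> = P * cmat B * (Q * P)" by (rule assoc_mult_mat[OF mult_carrier_mat[OF d(6) cB] d(7) d(6)])
    also have "\<dots> = P * cmat B" unfolding d(2) using cB by simp
    finally show ?thesis .
  qed
  define X where "X = map_mat Re P"
  define Y where "Y = map_mat Im P"
  have X: "X \<in> carrier_mat n n" and Y: "Y \<in> carrier_mat n n" unfolding X_def Y_def by auto
  have AX: "A * X = X * B" and AY: "A * Y = Y * B"
    using arg_cong[OF AP, of "map_mat Re"] arg_cong[OF AP, of "map_mat Im"]
    unfolding Re_cmat_mult[OF A B d(6)] X_def Y_def by auto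
  \<comment> \<open>The entries are polynomials over the complex numbers, so that both \<i> and
    every real \<open>t\<close> can be substituted in the same determinant.\<close>
  define Z where "Z = mat n n (\<lambda>(i, j). [:complex_of_real (X $$ (i, j)), complex_of_real (Y $$ (i, j)):])"
  define q where "q = det Z"
  have q: "poly q t = det (map_mat (\<lambda>p. poly p t) Z)" for t
  proof -
    have "comm_ring_hom (\<lambda>p. poly p t)" by unfold_locales
    from comm_ring_hom.hom_det[OF this] show ?thesis unfolding q_def by simp
  qed
  have ZP: "map_mat (\<lambda>p. poly p \<i>) Z = P"
    by (intro eq_matI) (use carrier_matD[OF d(6)] in \<open>auto simp: Z_def X_def Y_def complex_eq_iff\<close>)
  have "det P * det Q = 1" using d by (metis det_mult det_one)
  then have "poly q \<i> \<noteq> 0" unfolding q ZP by auto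
  then have "q \<noteq> 0" by auto
  then have fin: "finite {z. poly q z = 0}" by (rule poly_roots_finite)
  have "infinite (range complex_of_real)"
    by (simp add: finite_image_iff inj_on_def infinite_UNIV_char_0)
  then have "\<not> range complex_of_real \<subseteq> {z. poly q z = 0}" using fin finite_subset by blast
  then obtain z where "z \<in> range complex_of_real" "poly q z \<noteq> 0" by blast
  then obtain t where t: "poly q (complex_of_real t) \<noteq> 0" by auto
  define R where "R = X + t \<cdot>\<^sub>m Y"
  have R: "R \<in> carrier_mat n n" unfolding R_def using X Y by auto
  have "map_mat (\<lambda>p. poly p (complex_of_real t)) Z = cmat R"
    by (intro eq_matI) (use X Y in \<open>auto simp: Z_def R_def\<close>)
  with t q have "det (cmat R) \<noteq> 0" by simp
  then have "det R \<noteq> 0" by simp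
  moreover have "A * R = R * B"
    unfolding R_def using A B X Y
    by (simp add: mult_add_distrib_mat[of _ n n] add_mult_distrib_mat[of _ n n] mult_smult_distrib[of _ n n]
        mult_smult_assoc_mat[of _ n n] AX AY)
  ultimately show ?thesis using similar_mat_intertwine A B R by blast
qed

text \<open>The complex blocks are a complete invariant even for similarity over the reals, by
  \<open>similar_iff_real_blocks\<close>; all later comparisons of real matrices are comparisons of
  these multisets.\<close>

definition real_blocks :: "real mat \<Rightarrow> (nat \<times> complex) multiset" where
  "real_blocks A = jordan_blocks (cmat A)"

lemma similar_iff_real_blocks:
  assumes "A \<in> carrier_mat n n" "B \<in> carrier_mat n n"
  shows "similar_mat A B \<longleftrightarrow> real_blocks A = real_blocks B"
proof -
  have "similar_mat A B \<longleftrightarrow> similar_mat (cmat A) (cmat B)"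
    using similar_mat_of_similar_cmat[OF assms] similar_mat_map[OF semiring_hom_of_real] by blast
  also have "\<dots> \<longleftrightarrow> real_blocks A = real_blocks B"
    unfolding real_blocks_def by (rule similar_iff_jordan_blocks[of _ n]) (use assms in auto)
  finally show ?thesis .
qed

lemma real_blocks_dsum:
  assumes "A \<in> carrier_mat n n" "B \<in> carrier_mat m m"
  shows "real_blocks (diag_block_mat [A, B]) = real_blocks A + real_blocks B"
proof -
  have "cmat (diag_block_mat [A, B]) = diag_block_mat [cmat A, cmat B]"
    using map_mat_diag_block_mat[of complex_of_real "[A, B]"] by simp
  then show ?thesis
    using jordan_blocks_dsum[of "cmat A" n "cmat B" m] assms by (simp only: real_blocks_def map_carrier_mat)
qed

lemma real_blocks_smult:
  assumes "A \<in> carrier_mat n n" "c \<noteq> 0"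
  shows "real_blocks (c \<cdot>\<^sub>m A) = image_mset (\<lambda>(k, a). (k, complex_of_real c * a)) (real_blocks A)"
proof -
  have "cmat (c \<cdot>\<^sub>m A) = complex_of_real c \<cdot>\<^sub>m cmat A" by (intro eq_matI) auto
  then show ?thesis unfolding real_blocks_def using jordan_blocks_smult[of "cmat A" n] assms by auto
qed

lemma real_blocks_size:
  "A \<in> carrier_mat n n \<Longrightarrow> sum_mset (image_mset fst (real_blocks A)) = n"
  unfolding real_blocks_def by (rule jordan_blocks_size) simp

lemma real_blocks_pos:
  "A \<in> carrier_mat n n \<Longrightarrow> (k, a) \<in># real_blocks A \<Longrightarrow> k \<ge> 1"
  unfolding real_blocks_def by (rule jordan_blocks_pos[of "cmat A" n]) auto

lemma spec_real_blocks:
  "A \<in> carrier_mat n n \<Longrightarrow> spec A = snd ` set_mset (real_blocks A)"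
  unfolding real_blocks_def spec_def by (rule spectrum_jordan_blocks) simp

text \<open>A real matrix equals its own entrywise conjugate.\<close>

lemma real_blocks_cnj:
  assumes "A \<in> carrier_mat n n"
  shows "image_mset (map_prod id cnj) (real_blocks A) = real_blocks A"
proof -
  have "map_mat cnj (cmat A) = cmat A" by (intro eq_matI) auto
  then show ?thesis using jordan_blocks_cnj[of "cmat A" n] assms by (simp add: real_blocks_def)
qed

section \<open>Blocks of direct sums of subdiagonal Jordan blocks\<close>

lemma cmat_sub_jordan_block:
  "cmat (sub_jordan_block k a) = transpose_mat (jordan_block k (complex_of_real a))"
  unfolding sub_jordan_block_def by (intro eq_matI) auto

lemma sub_jordan_block_carrier [simp]: "sub_jordan_block k a \<in> carrier_mat k k"
  by (simp add: sub_jordan_block_def)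

text \<open>Reversing the order of the basis exchanges superdiagonal and subdiagonal.
  \<open>P\<close> is this reversal and is its own inverse.\<close>

lemma similar_transpose_jordan_block:
  "similar_mat (transpose_mat (jordan_block k a)) (jordan_block k (a :: 'a :: comm_ring_1))"
proof -
  define P where "P = mat k k (\<lambda>(i, j). if i + j + 1 = k then 1 else 0 :: 'a)"
  have [simp]: "P \<in> carrier_mat k k" "dim_row P = k" "dim_col P = k" by (auto simp: P_def)
  let ?J = "jordan_block k a"
  have row: "row P i = unit_vec k (k - 1 - i)" if "i < k" for i
    using that by (intro eq_vecI) (auto simp: P_def)
  have col: "col P i = unit_vec k (k - 1 - i)" if "i < k" for i
    using that by (intro eq_vecI) (auto simp: P_def)
  have PP: "P * P = 1\<^sub>m k"
    by (intro eq_matI) (auto simp: row col)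
  have "P * ?J = mat k k (\<lambda>(i, j). ?J $$ (k - 1 - i, j))"
    by (intro eq_matI) (auto simp: row scalar_prod_left_unit[of _ k])
  then have "P * ?J * P = transpose_mat ?J"
    by (intro eq_matI) (auto simp: col scalar_prod_right_unit[of _ k])
  then have "similar_mat_wit (transpose_mat ?J) ?J P P"
    by (intro similar_mat_witI[OF PP PP]) auto
  then show ?thesis unfolding similar_mat_def by blast
qed

lemma real_blocks_sub_jordan_block:
  assumes "k \<ge> 1"
  shows "real_blocks (sub_jordan_block k a) = {#(k, complex_of_real a)#}"
proof -
  have "jordan_matrix [(k, complex_of_real a)] = jordan_block k (complex_of_real a)"
    unfolding jordan_matrix_def list.map prod.case by (rule diag_block_mat_singleton)
  with jordan_blocks_jordan_matrix[of "[(k, complex_of_real a)]"] assms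
  have "jordan_blocks (jordan_block k (complex_of_real a)) = {#(k, complex_of_real a)#}" by simp
  then show ?thesis
    unfolding real_blocks_def cmat_sub_jordan_block
    using jordan_blocks_similar[OF similar_transpose_jordan_block] by simp
qed

lemma real_blocks_empty: "real_blocks (0\<^sub>m 0 0) = {#}"
proof -
  have "cmat (0\<^sub>m 0 0) = jordan_matrix []" by (auto simp: jordan_matrix_def)
  with jordan_blocks_jordan_matrix[of "[]"] show ?thesis unfolding real_blocks_def by simp
qed

lemma diag_block_mat_Cons: "diag_block_mat (A # As) = diag_block_mat [A, diag_block_mat As]"
  using diag_block_mat_append_two[of "[A]" As] by (simp only: diag_block_mat_singleton append_Cons append_Nil)

lemma diag_sub_jordan_carrier:
  "diag_block_mat (map (\<lambda>k. sub_jordan_block k a) ns) \<in> carrier_mat (sum_list ns) (sum_list ns)"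
proof (induction ns)
  case (Cons k ns)
  show ?case unfolding list.map sum_list.Cons
    by (subst diag_block_mat_Cons, rule dsum_carrier[OF sub_jordan_block_carrier Cons])
qed simp

lemma real_blocks_diag_sub_jordan:
  assumes "\<forall>k\<in>set ns. k \<ge> 1"
  shows "real_blocks (diag_block_mat (map (\<lambda>k. sub_jordan_block k a) ns)) =
    image_mset (\<lambda>k. (k, complex_of_real a)) (mset ns)"
  using assms
proof (induction ns)
  case Nil
  then show ?case by (simp add: real_blocks_empty)
next
  case (Cons k ns)
  then show ?case
    unfolding list.map
    by (subst diag_block_mat_Cons, subst real_blocks_dsum[OF sub_jordan_block_carrier diag_sub_jordan_carrier])
      (simp add: real_blocks_sub_jordan_block)
qed

section \<open>Matrices commuting with a complex structure\<close>

lemma four_block_mat_eq_iff: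
  assumes "A1 \<in> carrier_mat n1 m1" "A2 \<in> carrier_mat n1 m2" "A3 \<in> carrier_mat n2 m1" "A4 \<in> carrier_mat n2 m2"
    "B1 \<in> carrier_mat n1 m1" "B2 \<in> carrier_mat n1 m2" "B3 \<in> carrier_mat n2 m1" "B4 \<in> carrier_mat n2 m2"
  shows "four_block_mat A1 A2 A3 A4 = four_block_mat B1 B2 B3 B4 \<longleftrightarrow>
    A1 = B1 \<and> A2 = B2 \<and> A3 = B3 \<and> A4 = B4"
proof
  assume eq: "four_block_mat A1 A2 A3 A4 = four_block_mat B1 B2 B3 B4"
  have ent: "four_block_mat A1 A2 A3 A4 $$ (i, j) = four_block_mat B1 B2 B3 B4 $$ (i, j)" for i j
    by (simp add: eq)
  have "A1 = B1"
  proof (rule eq_matI)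
    fix i j assume "i < dim_row B1" "j < dim_col B1"
    then show "A1 $$ (i, j) = B1 $$ (i, j)" using ent[of i j] assms by auto
  qed (use assms in auto)
  moreover have "A2 = B2"
  proof (rule eq_matI)
    fix i j assume "i < dim_row B2" "j < dim_col B2"
    then show "A2 $$ (i, j) = B2 $$ (i, j)" using ent[of i "m1 + j"] assms by auto
  qed (use assms in auto)
  moreover have "A3 = B3"
  proof (rule eq_matI)
    fix i j assume "i < dim_row B3" "j < dim_col B3"
    then show "A3 $$ (i, j) = B3 $$ (i, j)" using ent[of "n1 + i" j] assms by auto
  qed (use assms in auto)
  moreover have "A4 = B4"
  proof (rule eq_matI)
    fix i j assume "i < dim_row B4" "j < dim_col B4"
    then show "A4 $$ (i, j) = B4 $$ (i, j)" using ent[of "n1 + i" "m1 + j"] assms by auto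
  qed (use assms in auto)
  ultimately show "A1 = B1 \<and> A2 = B2 \<and> A3 = B3 \<and> A4 = B4" by blast
qed auto

text \<open>The real matrix of \<open>C\<close> acting on \<open>C^r\<close>, with the real parts of
  the coordinates listed before the imaginary parts. In this order multiplication by \<i> is exactly
  \<open>J_std r\<close>.\<close>

definition realify :: "complex mat \<Rightarrow> real mat" where
  "realify C = four_block_mat (map_mat Re C) (- map_mat Im C) (map_mat Im C) (map_mat Re C)"

lemma realify_carrier: "C \<in> carrier_mat r r \<Longrightarrow> realify C \<in> carrier_mat (2 * r) (2 * r)"
  unfolding realify_def mult_2 by auto

lemma J_std_carrier: "J_std r \<in> carrier_mat (2 * r) (2 * r)"
  unfolding J_std_def mult_2 by auto

lemma J_std_square: "J_std r * J_std r = - 1\<^sub>m (2 * r)"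
proof -
  have "J_std r * J_std r = four_block_mat (- 1\<^sub>m r) (0\<^sub>m r r) (0\<^sub>m r r) (- 1\<^sub>m r)"
    unfolding J_std_def
    by (subst mult_four_block_mat[of _ r r _ r _ r]) auto
  also have "\<dots> = - 1\<^sub>m (2 * r)" by (intro eq_matI) auto
  finally show ?thesis .
qed

lemma four_block_mult_J_std:
  assumes "A \<in> carrier_mat r r" "B \<in> carrier_mat r r" "C \<in> carrier_mat r r" "D \<in> carrier_mat r r"
  shows "four_block_mat A B C D * J_std r = four_block_mat B (- A) D (- C)"
    "J_std r * four_block_mat A B C D = four_block_mat (- C) (- D) A B"
proof -
  have u: "X * (- 1\<^sub>m r) = - X" "(- 1\<^sub>m r) * X = - X" if "X \<in> carrier_mat r r" for X :: "real mat"
    using that uminus_mult_right_mat[of X "1\<^sub>m r"] uminus_mult_left_mat[of "1\<^sub>m r" X] by auto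
  show "four_block_mat A B C D * J_std r = four_block_mat B (- A) D (- C)"
    unfolding J_std_def using assms
    by (subst mult_four_block_mat[of _ r r _ r _ r]) (auto simp: u)
  show "J_std r * four_block_mat A B C D = four_block_mat (- C) (- D) A B"
    unfolding J_std_def using assms
    by (subst mult_four_block_mat[of _ r r _ r _ r]) (auto simp: u)
qed

lemma realify_M_J:
  assumes C: "C \<in> carrier_mat r r" shows "realify C \<in> M_J r"
proof -
  have "realify C * J_std r = J_std r * realify C"
    unfolding realify_def
    using four_block_mult_J_std[of "map_mat Re C" r "- map_mat Im C" "map_mat Im C" "map_mat Re C"] C
    by simp
  then show ?thesis unfolding M_J_def using realify_carrier[OF C] by simp
qed

text \<open>Comparing the four blocks of \<open>B * J_std r\<close> and \<open>J_std r * B\<close>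
  leaves two free blocks, the real and the imaginary part of \<open>C\<close>. With
  \<open>realify_M_J\<close> this identifies \<open>M_J r\<close> with the complex r by r
  matrices.\<close>

lemma M_J_realify:
  assumes B: "B \<in> M_J r"
  obtains C where "C \<in> carrier_mat r r" "B = realify C"
proof -
  obtain B1 B2 B3 B4 where sb: "split_block B r r = (B1, B2, B3, B4)" by (metis prod_cases4)
  from B have Bc: "dim_row B = r + r" "dim_col B = r + r" and com: "B * J_std r = J_std r * B"
    unfolding M_J_def by auto
  note s = split_block[OF sb Bc]
  have "four_block_mat B2 (- B1) B4 (- B3) = four_block_mat (- B3) (- B4) B1 B2"
    using com s(5) four_block_mult_J_std[OF s(1-4)] by simp
  moreover have "four_block_mat B2 (- B1) B4 (- B3) = four_block_mat (- B3) (- B4) B1 B2 \<longleftrightarrow>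
      B2 = - B3 \<and> - B1 = - B4 \<and> B4 = B1 \<and> - B3 = B2"
    by (rule four_block_mat_eq_iff) (use s(1-4) in simp_all)
  ultimately have "B2 = - B3" "B4 = B1" by blast+
  define C where "C = mat r r (\<lambda>(i, j). Complex (B1 $$ (i, j)) (B3 $$ (i, j)))"
  have "map_mat Re C = B1" "map_mat Im C = B3"
    using s by (auto intro!: eq_matI simp: C_def)
  then have "B = realify C" unfolding s(5) realify_def \<open>B2 = - B3\<close> \<open>B4 = B1\<close> by simp
  then show thesis using that[of C] by (simp add: C_def)
qed

text \<open>\<open>(x, -\<i> x)\<close> spans a copy of \<open>C\<close> in the complexified realification and \<open>(x, \<i> x)\<close> a copy of
  its conjugate.\<close>

lemma similar_realify:
  assumes C: "C \<in> carrier_mat r r"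
  shows "similar_mat (cmat (realify C)) (diag_block_mat [C, map_mat cnj C])"
proof -
  let ?I = "1\<^sub>m r :: complex mat"
  let ?P = "four_block_mat ?I ?I (- \<i> \<cdot>\<^sub>m ?I) (\<i> \<cdot>\<^sub>m ?I)"
  let ?Q = "four_block_mat ((1/2) \<cdot>\<^sub>m ?I) (\<i>/2 \<cdot>\<^sub>m ?I) ((1/2) \<cdot>\<^sub>m ?I) (- \<i>/2 \<cdot>\<^sub>m ?I)"
  let ?X = "cmat (map_mat Re C)" let ?Y = "cmat (map_mat Im C)"
  let ?D = "diag_block_mat [C, map_mat cnj C]"
  have sm: "(a \<cdot>\<^sub>m ?I) * M = a \<cdot>\<^sub>m M" "M * (a \<cdot>\<^sub>m ?I) = a \<cdot>\<^sub>m M" if "M \<in> carrier_mat r r" for M a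
    using that by (auto simp: mult_smult_assoc_mat[of _ r r] mult_smult_distrib[of _ r r])
  have PQ: "?P * ?Q = 1\<^sub>m (r + r)"
    by (subst mult_four_block_mat[of _ r r _ r _ r])
      (auto simp: sm intro!: eq_matI)
  have QP: "?Q * ?P = 1\<^sub>m (r + r)"
    by (subst mult_four_block_mat[of _ r r _ r _ r])
      (auto simp: sm intro!: eq_matI)
  have D: "?D = four_block_mat C (0\<^sub>m r r) (0\<^sub>m r r) (map_mat cnj C)"
    using C by (intro diag_block_mat_two) auto
  have PD: "?P * ?D = four_block_mat C (map_mat cnj C) (- \<i> \<cdot>\<^sub>m C) (\<i> \<cdot>\<^sub>m map_mat cnj C)"
    unfolding D using C by (subst mult_four_block_mat[of _ r r _ r _ r]) (auto simp: sm)
  have "?P * ?D * ?Q = four_block_mat ?X (- ?Y) ?Y ?X"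
    unfolding PD using C
    by (subst mult_four_block_mat[of _ r r _ r _ r])
      (auto simp: sm complex_eq_iff intro!: cong_four_block_mat eq_matI)
  also have "\<dots> = cmat (realify C)"
    using C by (auto simp: realify_def intro!: eq_matI)
  finally have "similar_mat_wit (cmat (realify C)) ?D ?P ?Q"
    using C dsum_carrier[of C r "map_mat cnj C" r] realify_carrier[OF C]
    by (intro similar_mat_witI[OF PQ QP]) (auto simp: mult_2)
  then show ?thesis unfolding similar_mat_def by blast
qed

lemma real_blocks_realify:
  assumes C: "C \<in> carrier_mat r r"
  shows "real_blocks (realify C) = jordan_blocks C + image_mset (map_prod id cnj) (jordan_blocks C)"
proof -
  have "real_blocks (realify C) = jordan_blocks (diag_block_mat [C, map_mat cnj C])"
    unfolding real_blocks_def by (rule jordan_blocks_similar[OF similar_realify[OF C]])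
  also have "\<dots> = jordan_blocks C + jordan_blocks (map_mat cnj C)"
    by (rule jordan_blocks_dsum[OF C]) (use C in simp)
  finally show ?thesis unfolding jordan_blocks_cnj[OF C] .
qed

lemma count_image_mset_conj: "count (image_mset (map_prod id cnj) S) (k, a) = count S (k, cnj a)"
  by (induction S) (auto simp: complex_eq_iff)

text \<open>Conjugation fixes a real eigenvalue, so each block of \<open>C\<close> with that
  eigenvalue occurs a second time in the conjugate half.\<close>

lemma even_count_M_J:
  assumes "B \<in> M_J r"
  shows "even (count (real_blocks B) (k, complex_of_real a))"
proof -
  obtain C where C: "C \<in> carrier_mat r r" "B = realify C" using M_J_realify[OF assms] .
  show ?thesis unfolding C(2) real_blocks_realify[OF C(1)] by (simp add: count_image_mset_conj)
qed

section \<open>Real matrices with square -1 up to similarity\<close>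

lemma uminus_four_block: 
  fixes A :: "'a :: comm_ring_1 mat"
  shows "- 1\<^sub>m (n + m) = (four_block_mat (- 1\<^sub>m n) (0\<^sub>m n m) (0\<^sub>m m n) (- 1\<^sub>m m) :: 'a mat)"
  by (intro eq_matI) auto

text \<open>The square of a Jordan block has \<open>a * a\<close> on the diagonal and, from size 2
  on, \<open>2 * a\<close> next to it. The first must be -1 and the second 0, which excludes sizes
  above 1.\<close>

lemma jordan_matrix_square_uminus_one:
  assumes "jordan_matrix xs * jordan_matrix xs = (- 1\<^sub>m (sum_list (map fst xs)) :: complex mat)"
    "(k, a) \<in> set xs" "k \<ge> 1"
  shows "k = 1 \<and> a * a = -1"
  using assms(1,2)
proof (induction xs)
  case (Cons x xs)
  obtain n b where x: "x = (n, b)" by (cases x)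
  let ?m = "sum_list (map fst xs)"
  have "four_block_mat (jordan_block n b * jordan_block n b) (0\<^sub>m n ?m) (0\<^sub>m ?m n) (jordan_matrix xs * jordan_matrix xs)
    = jordan_matrix (x # xs) * jordan_matrix (x # xs)"
    unfolding x jordan_matrix_Cons by (subst mult_four_block_mat[of _ n n _ ?m _ ?m]) auto
  also have "\<dots> = four_block_mat (- 1\<^sub>m n) (0\<^sub>m n ?m) (0\<^sub>m ?m n) (- 1\<^sub>m ?m)"
    using Cons.prems(1) by (simp add: x uminus_four_block)
  finally have eq: "jordan_block n b * jordan_block n b = - 1\<^sub>m n" "jordan_matrix xs * jordan_matrix xs = - 1\<^sub>m ?m"
    using four_block_mat_eq_iff[of "jordan_block n b * jordan_block n b" n n "0\<^sub>m n ?m" ?m "0\<^sub>m ?m n" ?m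
        "jordan_matrix xs * jordan_matrix xs" "- 1\<^sub>m n" "0\<^sub>m n ?m" "0\<^sub>m ?m n" "- 1\<^sub>m ?m"]
      mult_carrier_mat[OF jordan_block_carrier jordan_block_carrier, of n b b]
      mult_carrier_mat[OF jordan_matrix_carrier jordan_matrix_carrier, of xs]
    by simp_all
  show ?case
  proof (cases "(k, a) = x")
    case True
    then have [simp]: "n = k" "b = a" by (auto simp: x)
    have "jordan_block k a ^\<^sub>m 2 = - 1\<^sub>m k" using eq(1) by (simp add: numeral_2_eq_2)
    then have ent: "(jordan_block k a ^\<^sub>m 2) $$ (i, j) = (- 1\<^sub>m k) $$ (i, j)" for i j by simp
    have 1: "a * a = -1" using ent[of 0 0] assms(3) by (simp add: jordan_block_pow power2_eq_square)
    have "k = 1"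
    proof (rule ccontr)
      assume "k \<noteq> 1"
      then have "1 < k" using assms(3) by simp
      then have "2 * a = 0" using ent[of 0 1] by (simp add: jordan_block_pow)
      then show False using 1 by simp
    qed
    with 1 show ?thesis by simp
  next
    case False
    then show ?thesis using Cons eq(2) by (auto simp: x)
  qed
qed simp

text \<open>All blocks have size 1 and eigenvalue \<i> or -\<i>, and conjugation symmetry makes both
  equally frequent. Hence the size is even and determines \<open>J\<close> up to similarity.\<close>

lemma real_blocks_complex_structure:
  assumes J: "J \<in> carrier_mat d d" and JJ: "J * J = - 1\<^sub>m d"
  obtains r where "d = 2 * r" "real_blocks J = replicate_mset r (1, \<i>) + replicate_mset r (1, - \<i>)"
proof -
  have cJ: "cmat J \<in> carrier_mat d d" using J by simp
  obtain xs where xs: "jordan_nf (cmat J) xs" "jordan_blocks (cmat J) = mset xs"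
    using jordan_blocks_exE[OF cJ] .
  then have "similar_mat (cmat J) (jordan_matrix xs)" by (simp add: jordan_nf_def)
  then obtain P Q where w: "similar_mat_wit (jordan_matrix xs) (cmat J) P Q"
    using similar_mat_sym unfolding similar_mat_def by metis
  from similar_mat_witD2(4)[OF cJ similar_mat_wit_sym[OF w]] similar_mat_witD2(5)[OF cJ similar_mat_wit_sym[OF w]]
  have jm: "jordan_matrix xs \<in> carrier_mat d d" by simp
  then have d: "sum_list (map fst xs) = d" by (metis carrier_matD(1) jordan_matrix_dim(1))
  note w' = similar_mat_witD2[OF jm w]
  have cJJ: "cmat J * cmat J = - 1\<^sub>m d"
  proof -
    have "cmat (J * J) = - 1\<^sub>m d" unfolding JJ by (intro eq_matI) auto
    then show ?thesis by (simp only: of_real_hom.mat_hom_mult[OF J J])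
  qed
  have "jordan_matrix xs ^\<^sub>m 2 = P * (cmat J ^\<^sub>m 2) * Q" by (rule similar_mat_wit_pow_id[OF w])
  also have "cmat J ^\<^sub>m 2 = - 1\<^sub>m d" using cJJ cJ by (simp add: numeral_2_eq_2)
  also have "P * (- 1\<^sub>m d) = - P" using w'(6) uminus_mult_right_mat[of P "1\<^sub>m d"] by simp
  also have "- P * Q = - 1\<^sub>m d" using w' uminus_mult_left_mat[of P Q] by simp
  finally have sq: "jordan_matrix xs * jordan_matrix xs = - 1\<^sub>m (sum_list (map fst xs))"
    using jm by (simp add: numeral_2_eq_2 d)
  have mem: "k = 1 \<and> (a = \<i> \<or> a = - \<i>)" if "(k, a) \<in># real_blocks J" for k a
  proof -
    have "(k, a) \<in> set xs" using that xs by (simp add: real_blocks_def)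
    moreover have "k \<ge> 1" using real_blocks_pos[OF J that] .
    ultimately have "k = 1" "a * a = -1" using jordan_matrix_square_uminus_one[OF sq] by auto
    then have "(a - \<i>) * (a + \<i>) = 0" by (simp add: algebra_simps)
    then show ?thesis using \<open>k = 1\<close> by (auto simp: add_eq_0_iff2)
  qed
  define r where "r = count (real_blocks J) (1, \<i>)"
  have r': "r = count (real_blocks J) (1, - \<i>)"
    using count_image_mset_conj[of "real_blocks J" 1 "\<i>"] real_blocks_cnj[OF J] by (simp add: r_def)
  have eq: "real_blocks J = replicate_mset r (1, \<i>) + replicate_mset r (1, - \<i>)"
  proof (rule multiset_eqI)
    fix x :: "nat \<times> complex"
    obtain k a where x: "x = (k, a)" by (cases x)
    show "count (real_blocks J) x = count (replicate_mset r (1, \<i>) + replicate_mset r (1, - \<i>)) x"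
    proof (cases "x \<in># real_blocks J")
      case True
      then show ?thesis using mem[of k a] r_def[symmetric] r'[symmetric] by (auto simp: x)
    next
      case False
      then show ?thesis using r_def[symmetric] r'[symmetric] by (auto simp: not_in_iff)
    qed
  qed
  then have "d = 2 * r" using real_blocks_size[OF J] by simp
  then show thesis using eq that by blast
qed

lemma similar_J_std:
  assumes J: "J \<in> carrier_mat d d" and JJ: "J * J = - 1\<^sub>m d"
  obtains r where "d = 2 * r" "similar_mat J (J_std r)"
proof -
  obtain r where r: "d = 2 * r" "real_blocks J = replicate_mset r (1, \<i>) + replicate_mset r (1, - \<i>)"
    using real_blocks_complex_structure[OF assms] .
  obtain r' where "2 * r = 2 * r'"
      "real_blocks (J_std r) = replicate_mset r' (1, \<i>) + replicate_mset r' (1, - \<i>)"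
    using real_blocks_complex_structure[OF J_std_carrier J_std_square] .
  with r have "similar_mat J (J_std r)"
    using J J_std_carrier by (subst similar_iff_real_blocks[of _ d]) auto
  with r(1) show thesis using that by blast
qed

text \<open>A change of basis taking \<open>J\<close> to \<open>J_std r\<close> takes
  \<open>B\<close> to a matrix \<open>B'\<close> in \<open>M_J r\<close> with the same
  blocks.\<close>

lemma even_count_commuting:
  assumes B: "B \<in> carrier_mat d d" and J: "J \<in> carrier_mat d d" and JJ: "J * J = - 1\<^sub>m d"
    and com: "B * J = J * B"
  shows "even (count (real_blocks B) (k, complex_of_real a))"
proof -
  obtain r where d: "d = 2 * r" and "similar_mat J (J_std r)" using similar_J_std[OF J JJ] .
  then obtain P Q where wit: "similar_mat_wit J (J_std r) P Q" unfolding similar_mat_def by auto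
  note w = similar_mat_witD2[OF J wit]
  define B' where "B' = Q * B * P"
  have B': "B' \<in> carrier_mat d d" using w B by (simp add: B'_def)
  have Js: "J_std r = Q * J * P" by (rule similar_mat_witD(3)[OF refl similar_mat_wit_sym[OF wit]])
  \<comment> \<open>Conjugation by \<open>P\<close> and \<open>Q\<close> is multiplicative, so the
    commutation of \<open>B\<close> and \<open>J\<close> carries over to \<open>B'\<close> and
    \<open>J_std r\<close>.\<close>
  have cancel: "Q * X * P * (Q * Y * P) = Q * (X * Y) * P"
    if "X \<in> carrier_mat d d" "Y \<in> carrier_mat d d" for X Y
  proof -
    have "P * (Q * Z) = Z" if "Z \<in> carrier_mat d d" for Z
      using assoc_mult_mat[OF w(6,7) that] w(1) that by simp
    then show ?thesis
      using w(6,7) that by (simp add: assoc_mult_mat[of _ d d _ d _ d])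
  qed
  have "B' * J_std r = J_std r * B'" unfolding B'_def Js using cancel B J com by simp
  then have "B' \<in> M_J r" unfolding M_J_def using B' d by simp
  moreover have "real_blocks B' = real_blocks B"
  proof -
    have "similar_mat_wit B' B Q P" using w B B' by (intro similar_mat_witI[of _ _ d]) (auto simp: B'_def)
    then have "similar_mat B' B" unfolding similar_mat_def by blast
    then show ?thesis using similar_iff_real_blocks[OF B' B] by simp
  qed
  ultimately show ?thesis using even_count_M_J by metis
qed

lemma half_multiset:
  assumes "\<And>x. even (count S x)"
  obtains H where "S = H + H"
proof -
  define H where "H = (\<Sum>x\<in>set_mset S. replicate_mset (count S x div 2) x)"
  have "count H y = count S y div 2" for y
    by (cases "y \<in># S") (auto simp: H_def count_sum not_in_iff sum.If_cases)
  moreover have "count S y = count S y div 2 + count S y div 2" for y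
    using assms[of y] by presburger
  ultimately have "S = H + H" by (intro multiset_eqI) simp
  then show thesis using that by blast
qed

text \<open>Converse of the parity statement: \<open>S\<close> has to be written as the blocks of
  some complex \<open>C\<close> together with their conjugates, and then \<open>B\<close> is the
  realification of \<open>C\<close>.\<close>

lemma M_J_exists:
  assumes pos: "\<And>k a. (k, a) \<in># S \<Longrightarrow> k \<ge> 1"
    and sym: "image_mset (map_prod id cnj) S = S"
    and even: "\<And>k a. even (count S (k, complex_of_real a))"
  obtains r B where "B \<in> M_J r" "real_blocks B = S"
proof -
  let ?c = "map_prod (id :: nat \<Rightarrow> nat) cnj"
  have "even (count (filter_mset (\<lambda>x. Im (snd x) = 0) S) x)" for x
  proof (cases "Im (snd x) = 0")
    case True
    then have "x = (fst x, complex_of_real (Re (snd x)))" by (simp add: prod_eq_iff complex_eq_iff)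
    then show ?thesis using even[of "fst x" "Re (snd x)"] True by simp
  qed simp
  then obtain H where H: "filter_mset (\<lambda>x. Im (snd x) = 0) S = H + H"
    using half_multiset by metis
  \<comment> \<open>The blocks for \<open>C\<close>: all those with eigenvalue in the upper half
    plane, and half of those with real eigenvalue. The conjugates supply the lower half plane and
    the other half.\<close>
  define T where "T = filter_mset (\<lambda>x. Im (snd x) > 0) S + H"
  have TS: "T + image_mset ?c T = S"
  proof -
    have "image_mset ?c H = H"
    proof -
      have "Im (snd x) = 0" if "x \<in># H" for x
        using that H by (metis (mono_tags, lifting) filter_mset_eq_conv union_iff)
      then have "image_mset ?c H = image_mset id H"
        by (intro image_mset_cong) (auto simp: complex_eq_iff)
      then show ?thesis by simp
    qed
    moreover have "image_mset ?c (filter_mset (\<lambda>x. Im (snd x) > 0) S) = filter_mset (\<lambda>x. Im (snd x) < 0) S"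
    proof -
      have "filter_mset (\<lambda>x. Im (snd x) < 0) (image_mset ?c S) = image_mset ?c (filter_mset (\<lambda>x. Im (snd x) > 0) S)"
        unfolding filter_mset_image_mset by (simp add: o_def)
      then show ?thesis unfolding sym by simp
    qed
    moreover have "S = filter_mset (\<lambda>x. Im (snd x) > 0) S + filter_mset (\<lambda>x. Im (snd x) < 0) S
        + filter_mset (\<lambda>x. Im (snd x) = 0) S"
      by (rule multiset_eqI) auto
    ultimately show ?thesis unfolding T_def H by (simp add: ac_simps)
  qed
  obtain xs where xs: "mset xs = T" by (metis ex_mset)
  define C where "C = jordan_matrix xs"
  have "x \<in># S" if "x \<in> set xs" for x
    using that xs TS by (metis set_mset_mset union_iff)
  then have "0 \<notin> fst ` set xs" using pos by force
  then have "jordan_blocks C = T" unfolding C_def by (simp add: jordan_blocks_jordan_matrix xs)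
  moreover have C: "C \<in> carrier_mat (sum_list (map fst xs)) (sum_list (map fst xs))" by (simp add: C_def)
  ultimately show thesis
    using that[OF realify_M_J[OF C]] real_blocks_realify[OF C] TS by simp
qed

section \<open>Bordering a matrix by one column\<close>

text \<open>The 1 by 1 corner is written as \<open>jordan_block 1 a\<close>, so that the known
  kernel dimensions of powers of Jordan blocks apply to it.\<close>

definition bordered :: "'a :: {zero, one} mat \<Rightarrow> 'a mat \<Rightarrow> 'a \<Rightarrow> 'a mat" where
  "bordered B v a = four_block_mat B v (0\<^sub>m 1 (dim_row B)) (jordan_block 1 a)"

lemma bordered_carrier [simp]:
  "B \<in> carrier_mat n n \<Longrightarrow> bordered B v a \<in> carrier_mat (Suc n) (Suc n)"
  unfolding bordered_def using four_block_carrier_mat[of B n n "jordan_block 1 a" 1 1] by simp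

section \<open>Kernels of bordered matrices\<close>

lemma kernel_dim_dsum_jordan_block:
  fixes M :: "'a :: field mat"
  assumes M: "M \<in> carrier_mat n n"
  shows "kernel_dim (four_block_mat M (0\<^sub>m n 1) (0\<^sub>m 1 n) (jordan_block 1 c)) =
    kernel_dim M + (if c = 0 then 1 else 0)"
proof -
  have "kernel.dim 1 (jordan_block 1 c ^\<^sub>m 1) = (if c = 0 then 1 else 0)"
    using dim_kernel_zero_jordan_block_pow[of 1 1] dim_kernel_non_zero_jordan_block_pow[of c 1 1] by auto
  moreover have "jordan_block 1 c ^\<^sub>m 1 = jordan_block 1 c" by simp
  ultimately have "kernel.dim 1 (jordan_block 1 c) = (if c = 0 then 1 else 0)" by metis
  then show ?thesis
    using kernel_four_block_0_mat[OF refl M jordan_block_carrier[of 1 c]] M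
    unfolding kernel_dim_def by simp
qed

text \<open>With \<open>c\<close> as pivot, row operations clear the column \<open>U\<close>.
  Multiplying by an invertible matrix on the left leaves the kernel itself unchanged.\<close>

lemma kernel_dim_bordered_nonzero:
  fixes M :: "'a :: field mat"
  assumes M: "M \<in> carrier_mat n n" and U: "U \<in> carrier_mat n 1" and c: "c \<noteq> 0"
  shows "kernel_dim (bordered M U c) = kernel_dim M"
proof -
  let ?D = "jordan_block 1 c"
  let ?E = "\<lambda>s. four_block_mat (1\<^sub>m n) (s \<cdot>\<^sub>m U) (0\<^sub>m 1 n) (1\<^sub>m 1)"
  have mult: "?E s * ?E t = ?E (s + t)" for s t
    using U by (subst mult_four_block_mat[of _ n n _ 1 _ 1])
      (auto simp: algebra_simps intro!: cong_four_block_mat eq_matI)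
  have one: "?E 0 = 1\<^sub>m (n + 1)" using U by (intro eq_matI) auto
  have UD: "row U i \<bullet> col (jordan_block (Suc 0) c) 0 = c * U $$ (i, 0)" if "i < n" for i
    using U that by (simp add: scalar_prod_def)
  have "?E (- (1 / c)) * bordered M U c = four_block_mat M (0\<^sub>m n 1) (0\<^sub>m 1 n) ?D"
    unfolding bordered_def using U M c
    by (subst mult_four_block_mat[of _ n n _ 1 _ 1])
      (auto simp: UD intro!: cong_four_block_mat eq_matI)
  moreover have "mat_kernel (?E (- (1 / c)) * bordered M U c) = mat_kernel (bordered M U c)"
    by (rule mat_kernel_mult_eq[of _ "n + 1" "n + 1" _ "?E (1 / c)"])
      (use M U mult[of "1 / c" "- (1 / c)"] one in auto)
  ultimately have k: "mat_kernel (bordered M U c) = mat_kernel (four_block_mat M (0\<^sub>m n 1) (0\<^sub>m 1 n) ?D)"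
    by simp
  have "kernel_dim (bordered M U c) = kernel_dim (four_block_mat M (0\<^sub>m n 1) (0\<^sub>m 1 n) ?D)"
    unfolding kernel_dim_def k using M by (simp add: bordered_def)
  then show ?thesis using kernel_dim_dsum_jordan_block[OF M, of c] c by simp
qed

text \<open>A kernel vector is a pair \<open>a\<close>, \<open>d\<close> with
  \<open>M a + U d = 0\<close>. One with nonzero \<open>d\<close> exists exactly if \<open>U\<close>
  lies in the range of \<open>M\<close>, and it adds one dimension.\<close>

lemma kernel_dim_bordered_zero:
  fixes M :: "'a :: field mat"
  assumes M: "M \<in> carrier_mat n n" and U: "U \<in> carrier_mat n 1"
  shows "kernel_dim (bordered M U 0) =
    kernel_dim M + (if \<exists>X\<in>carrier_mat n 1. U = M * X then 1 else 0)"
proof (cases "\<exists>X\<in>carrier_mat n 1. U = M * X")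
  case True
  then obtain X where X: "X \<in> carrier_mat n 1" and U_eq: "U = M * X" by blast
  let ?E = "\<lambda>s. four_block_mat (1\<^sub>m n) (s \<cdot>\<^sub>m X) (0\<^sub>m 1 n) (1\<^sub>m 1)"
  let ?F = "four_block_mat M (0\<^sub>m n 1) (0\<^sub>m 1 n) (jordan_block 1 0)"
  have mult: "?E s * ?E t = ?E (s + t)" for s t
    using X by (subst mult_four_block_mat[of _ n n _ 1 _ 1])
      (auto simp: algebra_simps intro!: cong_four_block_mat eq_matI)
  have one: "?E 0 = 1\<^sub>m (n + 1)" using X by (intro eq_matI) auto
  have one': "1 \<cdot>\<^sub>m X = X" by (intro eq_matI) auto
  have Fc: "?F \<in> carrier_mat (n + 1) (n + 1)" using M by (intro four_block_carrier_mat) auto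
  \<comment> \<open>Here column operations clear \<open>U\<close>. Multiplication on the right moves
    the kernel, but keeps its dimension.\<close>
  have "?F * ?E 1 = bordered M U 0"
    unfolding bordered_def U_eq one' using M X
    by (subst mult_four_block_mat[of _ n n _ 1 _ 1]) (auto intro!: cong_four_block_mat)
  moreover have "kernel.dim (n + 1) (?F * ?E 1) = kernel.dim (n + 1) ?F"
    by (rule mat_kernel_dim_mult_eq_right[of _ "n + 1" "n + 1" _ "?E (-1)"])
      (use X Fc mult[of 1 "-1"] one in auto)
  ultimately have "kernel_dim (bordered M U 0) = kernel_dim ?F"
    unfolding kernel_dim_def using M U by (simp add: bordered_def)
  then show ?thesis using True kernel_dim_dsum_jordan_block[OF M, of 0] by simp
next
  case False
  \<comment> \<open>A corner 1 forces the last coordinate to vanish, which here is also forced by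
    \<open>M a + U d = 0\<close>; so the two kernels agree as sets.\<close>
  let ?F = "four_block_mat M (0\<^sub>m n 1) (0\<^sub>m 1 n) (jordan_block 1 1)"
  have Z: "0\<^sub>m 1 n \<in> carrier_mat 1 n" "0\<^sub>m n 1 \<in> carrier_mat n 1" by auto
  have v: "bordered M U 0 *\<^sub>v v = 0\<^sub>v (n + 1) \<longleftrightarrow> ?F *\<^sub>v v = 0\<^sub>v (n + 1)" if v: "v \<in> carrier_vec (n + 1)" for v
  proof -
    obtain a d where ad: "v = a @\<^sub>v d" "a \<in> carrier_vec n" "d \<in> carrier_vec 1"
      using v by (metis vec_first_carrier vec_first_last_append vec_last_carrier)
    have zero: "0\<^sub>v (n + 1) = 0\<^sub>v n @\<^sub>v 0\<^sub>v 1" by (intro eq_vecI) auto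
    have d0: "d = 0\<^sub>v 1 \<longleftrightarrow> d $ 0 = 0" using ad(3) by (auto intro!: eq_vecI)
    have 1: "bordered M U 0 *\<^sub>v v = (M *\<^sub>v a + U *\<^sub>v d) @\<^sub>v 0\<^sub>v 1"
    proof -
      have "0\<^sub>m 1 n *\<^sub>v a + jordan_block 1 0 *\<^sub>v d = 0\<^sub>v 1"
        using ad by (intro eq_vecI) (auto simp: scalar_prod_def)
      then show ?thesis unfolding bordered_def ad(1) using M
        four_block_mat_mult_vec[OF M U Z(1) jordan_block_carrier ad(2,3), of 0] by simp
    qed
    have 2: "?F *\<^sub>v v = (M *\<^sub>v a) @\<^sub>v d"
    proof -
      have "0\<^sub>m 1 n *\<^sub>v a + jordan_block 1 1 *\<^sub>v d = d" "M *\<^sub>v a + 0\<^sub>m n 1 *\<^sub>v d = M *\<^sub>v a"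
        using ad M by (auto simp: scalar_prod_def intro!: eq_vecI)
      then show ?thesis unfolding ad(1)
        using four_block_mat_mult_vec[OF M Z(2) Z(1) jordan_block_carrier ad(2,3), of 1] by simp
    qed
    have "d = 0\<^sub>v 1" if z: "M *\<^sub>v a + U *\<^sub>v d = 0\<^sub>v n"
    proof (rule ccontr)
      assume "d \<noteq> 0\<^sub>v 1"
      then have d: "d $ 0 \<noteq> 0" using d0 by simp
      define X where "X = mat n 1 (\<lambda>(i, j). - (a $ i / d $ 0))"
      have "U = M * X"
      proof (rule eq_matI)
        fix i j assume "i < dim_row (M * X)" "j < dim_col (M * X)"
        then have i: "i < n" and j: "j = 0" using M by (auto simp: X_def)
        have "(M *\<^sub>v a + U *\<^sub>v d) $ i = 0" using z i by simp
        then have "row M i \<bullet> a + U $$ (i, 0) * d $ 0 = 0"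
          using i M U ad by (simp add: scalar_prod_def)
        then have "U $$ (i, 0) = - ((row M i \<bullet> a) / d $ 0)" using d by (simp add: field_simps eq_neg_iff_add_eq_0)
        also have "\<dots> = (M * X) $$ (i, 0)"
          using i M ad by (simp add: X_def scalar_prod_def sum_negf sum_divide_distrib)
        finally show "U $$ (i, j) = (M * X) $$ (i, j)" by (simp add: j)
      qed (use M U in \<open>auto simp: X_def\<close>)
      with False show False by (auto simp: X_def)
    qed
    moreover have "U *\<^sub>v 0\<^sub>v 1 = 0\<^sub>v n" "M *\<^sub>v a + 0\<^sub>v n = M *\<^sub>v a" using U M by auto
    ultimately show ?thesis
      unfolding 1 2 zero using M U ad
      by (subst (1 2) append_vec_eq[of _ n]) auto
  qed
  have "mat_kernel (bordered M U 0) = mat_kernel ?F"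
    unfolding mat_kernel_def using v M by (auto simp: bordered_def)
  then have "kernel_dim (bordered M U 0) = kernel_dim ?F"
    unfolding kernel_dim_def using M by (simp add: bordered_def)
  then show ?thesis using False kernel_dim_dsum_jordan_block[OF M, of 1] by simp
qed

section \<open>Powers of bordered matrices and generalized eigenspaces\<close>

lemma pow_mat_Suc_left:
  assumes "A \<in> carrier_mat n n"
  shows "A ^\<^sub>m Suc k = A * A ^\<^sub>m k"
proof (induction k)
  case (Suc k)
  have "A ^\<^sub>m Suc (Suc k) = A * A ^\<^sub>m k * A" using Suc by simp
  also have "\<dots> = A * A ^\<^sub>m Suc k" using assms by (simp add: assoc_mult_mat[of _ n n _ n _ n])
  finally show ?case .
qed (use assms in simp)

lemma bordered_pow:
  fixes B :: "'a :: comm_ring_1 mat"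
  assumes B: "B \<in> carrier_mat n n" and v: "v \<in> carrier_mat n 1"
  shows "\<exists>U\<in>carrier_mat n 1. bordered B v c ^\<^sub>m k = bordered (B ^\<^sub>m k) U (c ^ k)"
proof (induction k)
  case 0
  have "bordered B v c ^\<^sub>m 0 = bordered (B ^\<^sub>m 0) (0\<^sub>m n 1) (c ^ 0)"
    using B by (intro eq_matI) (auto simp: bordered_def)
  then show ?case by (intro bexI[of _ "0\<^sub>m n 1"]) auto
next
  case (Suc k)
  then obtain U where U: "U \<in> carrier_mat n 1" "bordered B v c ^\<^sub>m k = bordered (B ^\<^sub>m k) U (c ^ k)" by blast
  have "jordan_block 1 (c ^ k) * jordan_block 1 c = jordan_block 1 (c ^ Suc k)"
    by (intro eq_matI) (auto simp: scalar_prod_def mult.commute)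
  then have "bordered B v c ^\<^sub>m Suc k = bordered (B ^\<^sub>m Suc k) (B ^\<^sub>m k * v + U * jordan_block 1 c) (c ^ Suc k)"
    unfolding pow_mat.simps(2) U(2) unfolding bordered_def using B v U(1)
    by (subst mult_four_block_mat[of _ n n _ 1 _ 1]) (auto intro!: cong_four_block_mat)
  then show ?case using B v U(1)
    by (intro bexI[of _ "B ^\<^sub>m k * v + U * jordan_block 1 c"]) auto
qed

text \<open>The upper right block of the last product is \<open>B^k v\<close> plus the old border
  times the corner; a corner 0 kills the second term, so the border is known explicitly.\<close>

lemma bordered_zero_pow_Suc:
  fixes B :: "'a :: comm_ring_1 mat"
  assumes B: "B \<in> carrier_mat n n" and v: "v \<in> carrier_mat n 1"
  shows "bordered B v 0 ^\<^sub>m Suc k = bordered (B ^\<^sub>m Suc k) (B ^\<^sub>m k * v) 0"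
proof -
  obtain U where U: "U \<in> carrier_mat n 1" "bordered B v 0 ^\<^sub>m k = bordered (B ^\<^sub>m k) U (0 ^ k)"
    using bordered_pow[OF assms] by blast
  have z: "jordan_block 1 x * jordan_block 1 0 = (jordan_block 1 0 :: 'a mat)" 
      "jordan_block 1 0 = (0\<^sub>m 1 1 :: 'a mat)" for x
    by (intro eq_matI; auto simp: scalar_prod_def)+
  have "U * jordan_block 1 0 = 0\<^sub>m n 1" unfolding z(2) using U by simp
  then show ?thesis
    unfolding pow_mat.simps(2) U(2) unfolding bordered_def using B v U(1) z(1)
    by (subst mult_four_block_mat[of _ n n _ 1 _ 1]) (auto intro!: cong_four_block_mat)
qed

lemma char_matrix_bordered:
  assumes "B \<in> carrier_mat n n" "v \<in> carrier_mat n 1"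
  shows "char_matrix (bordered B v a) l = bordered (char_matrix B l) v (a - l)"
  using assms unfolding char_matrix_def bordered_def by (intro eq_matI) auto

text \<open>After subtracting \<open>l\<close> the corner is nonzero, and so are its powers; then
  the border has no influence on kernel dimensions, whatever it is.\<close>

lemma dim_gen_eigenspace_bordered_other:
  assumes B: "B \<in> carrier_mat n n" and v: "v \<in> carrier_mat n 1" and "a \<noteq> l"
  shows "dim_gen_eigenspace (bordered B v a) l k = dim_gen_eigenspace B l k"
proof -
  obtain U where U: "U \<in> carrier_mat n 1"
    "bordered (char_matrix B l) v (a - l) ^\<^sub>m k = bordered (char_matrix B l ^\<^sub>m k) U ((a - l) ^ k)"
    using bordered_pow[OF char_matrix_closed[OF B] v] by blast
  show ?thesis
    unfolding dim_gen_eigenspace_def char_matrix_bordered[OF B v] U(2)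
    using kernel_dim_bordered_nonzero[OF _ U(1)] assms by simp
qed

lemma dim_gen_eigenspace_bordered:
  fixes B :: "'a :: field mat"
  assumes B: "B \<in> carrier_mat n n" and v: "v \<in> carrier_mat n 1"
  obtains K where "\<And>k. dim_gen_eigenspace (bordered B v a) a k =
      dim_gen_eigenspace B a k + (if k \<ge> 1 \<and> K k then 1 else 0)"
    "\<And>k. K k \<Longrightarrow> K (Suc k)"
proof -
  define N where "N = char_matrix B a"
  have N: "N \<in> carrier_mat n n" unfolding N_def using B by simp
  \<comment> \<open>The range condition of \<open>kernel_dim_bordered_zero\<close> for the k-th
    power. The subtraction is truncated at 0, hence the guard \<open>k \<ge> 1\<close> below.
    Applying \<open>N\<close> to both sides passes from \<open>k\<close> to
    \<open>Suc k\<close>.\<close>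
  define K where "K k = (\<exists>X\<in>carrier_mat n 1. N ^\<^sub>m (k - 1) * v = N ^\<^sub>m k * X)" for k
  have b: "char_matrix (bordered B v a) a = bordered N v 0"
    unfolding char_matrix_bordered[OF B v] N_def by simp
  have "dim_gen_eigenspace (bordered B v a) a k =
      dim_gen_eigenspace B a k + (if k \<ge> 1 \<and> (k \<ge> 1 \<and> K k) then 1 else 0)" for k
  proof (cases k)
    case 0
    have one: "kernel_dim (1\<^sub>m m :: 'a mat) = 0" for m using kernel_one_mat(1)[of m] by (simp add: kernel_dim_def)
    show ?thesis unfolding 0 dim_gen_eigenspace_def by (simp add: one)
  next
    case (Suc j)
    have U: "N ^\<^sub>m j * v \<in> carrier_mat n 1" by (rule mult_carrier_mat[OF pow_carrier_mat[OF N] v])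
    show ?thesis
      unfolding Suc dim_gen_eigenspace_def b bordered_zero_pow_Suc[OF N v]
      unfolding kernel_dim_bordered_zero[OF pow_carrier_mat[OF N] U] K_def N_def[symmetric] by simp
  qed
  moreover have "Suc k \<ge> 1 \<and> K (Suc k)" if "k \<ge> 1 \<and> K k" for k
  proof -
    from that obtain j where k: "k = Suc j" by (cases k) auto
    from that obtain X where X: "X \<in> carrier_mat n 1" and eq: "N ^\<^sub>m j * v = N ^\<^sub>m k * X"
      unfolding K_def k by auto
    have "N ^\<^sub>m k * v = N * (N ^\<^sub>m j * v)"
      unfolding k pow_mat_Suc_left[OF N] by (rule assoc_mult_mat[OF N pow_carrier_mat[OF N] v])
    also have "\<dots> = N ^\<^sub>m Suc k * X"
      unfolding eq pow_mat_Suc_left[OF N, of k] by (rule assoc_mult_mat[OF N pow_carrier_mat[OF N] X, symmetric])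
    finally show ?thesis using X unfolding K_def by auto
  qed
  ultimately show thesis using that[of "\<lambda>k. k \<ge> 1 \<and> K k"] by blast
qed

text \<open>A block of size \<open>m\<close> with eigenvalue \<open>l\<close> contributes
  \<open>min k m\<close> to the dimension for exponent \<open>k\<close>. The second difference of
  this function at \<open>Suc k\<close> is nonzero only for \<open>m = Suc k\<close>. The identity
  is arranged so that no natural numbers are subtracted.\<close>

lemma dim_gen_eigenspace_second_difference:
  assumes A: "A \<in> carrier_mat n n"
  shows "2 * dim_gen_eigenspace A l (Suc k) = dim_gen_eigenspace A l k + dim_gen_eigenspace A l (Suc (Suc k))
    + count (jordan_blocks A) (Suc k, l)"
proof -
  obtain xs where xs: "jordan_nf A xs" "jordan_blocks A = mset xs" using jordan_blocks_exE[OF A] .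
  show ?thesis unfolding dim_gen_eigenspace[OF xs(1)] xs(2)
  proof (induction xs)
    case (Cons x xs)
    obtain m b where x: "x = (m, b)" by (cases x)
    show ?case using Cons unfolding x by (auto simp: min_def)
  qed simp
qed

text \<open>The dimensions for \<open>A\<close> exceed those for \<open>B\<close> by 1 exactly from
  exponent \<open>q\<close> on. The second difference of that step adds a block of size
  \<open>q\<close> and removes one of size \<open>q - 1\<close>; for \<open>q = 1\<close> nothing is
  removed, as only \<open>k \<ge> 1\<close> is compared. The removed block stands on the left to
  avoid subtraction.\<close>

lemma jordan_blocks_bordered:
  assumes B: "B \<in> carrier_mat n n" and v: "v \<in> carrier_mat n 1"
  obtains q where "q \<ge> 1" "\<And>k l. k \<ge> 1 \<Longrightarrow>
    count (jordan_blocks (bordered B v a)) (k, l) + (if l = a \<and> Suc k = q then 1 else 0)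
      = count (jordan_blocks B) (k, l) + (if l = a \<and> k = q then 1 else 0)"
proof -
  define A where "A = bordered B v a"
  have A: "A \<in> carrier_mat (n + 1) (n + 1)" using B by (simp add: A_def)
  obtain K where K: "\<And>k. dim_gen_eigenspace A a k = dim_gen_eigenspace B a k + (if k \<ge> 1 \<and> K k then 1 else 0)"
    "\<And>k. K k \<Longrightarrow> K (Suc k)"
    using dim_gen_eigenspace_bordered[OF B v, of a] unfolding A_def by blast
  note A2 = dim_gen_eigenspace_second_difference[OF A] and B2 = dim_gen_eigenspace_second_difference[OF B]
  have other: "count (jordan_blocks A) (Suc k, l) = count (jordan_blocks B) (Suc k, l)" if "l \<noteq> a" for k l
    using A2[of l k] B2[of l k] dim_gen_eigenspace_bordered_other[OF B v, of a l] that unfolding A_def by simp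
  \<comment> \<open>If the step never occurred, \<open>A\<close> and \<open>B\<close> would have the
    same blocks, but their sizes add up to \<open>n + 1\<close> and to \<open>n\<close>.\<close>
  have "\<exists>k\<ge>1. K k"
  proof (rule ccontr)
    assume "\<not> (\<exists>k\<ge>1. K k)"
    then have same: "count (jordan_blocks A) (Suc k, a) = count (jordan_blocks B) (Suc k, a)" for k
      using A2[of a k] B2[of a k] unfolding K by auto
    have "jordan_blocks A = jordan_blocks B"
    proof (rule multiset_eqI)
      fix x :: "nat \<times> complex"
      obtain k l where x: "x = (k, l)" by (cases x)
      show "count (jordan_blocks A) x = count (jordan_blocks B) x"
      proof (cases k)
        case 0
        then have "x \<notin># jordan_blocks A" "x \<notin># jordan_blocks B"
          using jordan_blocks_pos[OF A, of k l] jordan_blocks_pos[OF B, of k l] x by auto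
        then show ?thesis by (metis not_in_iff)
      next
        case (Suc j)
        then show ?thesis using other[of l j] same[of j] x by (cases "l = a") auto
      qed
    qed
    then show False using jordan_blocks_size[OF A] jordan_blocks_size[OF B] by simp
  qed
  define q where "q = (LEAST k. k \<ge> 1 \<and> K k)"
  have q: "q \<ge> 1" "K q" using LeastI_ex[of "\<lambda>k. k \<ge> 1 \<and> K k"] \<open>\<exists>k\<ge>1. K k\<close> unfolding q_def by blast+
  have Kq: "k \<ge> 1 \<and> K k \<longleftrightarrow> q \<le> k" for k
  proof
    show "q \<le> k" if "k \<ge> 1 \<and> K k" unfolding q_def using that by (rule Least_le)
    show "k \<ge> 1 \<and> K k" if "q \<le> k"
      using that by (induction k rule: dec_induct) (use q K(2) in auto)
  qed
  have "count (jordan_blocks A) (k, l) + (if l = a \<and> Suc k = q then 1 else 0)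
      = count (jordan_blocks B) (k, l) + (if l = a \<and> k = q then 1 else 0)" if "k \<ge> 1" for k l
  proof -
    from that have "k = Suc (k - 1)" by simp
    then obtain j where k: "k = Suc j" ..
    show ?thesis
    proof (cases "l = a")
      case True
      consider "q \<le> j" | "q = Suc j" | "q = Suc (Suc j)" | "Suc (Suc j) < q" by linarith
      then show ?thesis
        unfolding k True using A2[of a j] B2[of a j] unfolding K Kq by cases auto
    next
      case False
      then show ?thesis using other k by simp
    qed
  qed
  with q(1) that show thesis unfolding A_def by blast
qed

lemma real_blocks_bordered:
  assumes B: "B \<in> carrier_mat n n" and v: "v \<in> carrier_mat n 1"
  obtains q where "q \<ge> 1" "\<And>k l. k \<ge> 1 \<Longrightarrow>
    count (real_blocks (bordered B v a)) (k, l) + (if l = complex_of_real a \<and> Suc k = q then 1 else 0)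
      = count (real_blocks B) (k, l) + (if l = complex_of_real a \<and> k = q then 1 else 0)"
proof -
  have "cmat (bordered B v a) = bordered (cmat B) (cmat v) (complex_of_real a)"
    using B v by (intro eq_matI) (auto simp: bordered_def)
  moreover obtain q where "q \<ge> 1" "\<And>k l. k \<ge> 1 \<Longrightarrow>
      count (jordan_blocks (bordered (cmat B) (cmat v) (complex_of_real a))) (k, l)
        + (if l = complex_of_real a \<and> Suc k = q then 1 else 0)
      = count (jordan_blocks (cmat B)) (k, l) + (if l = complex_of_real a \<and> k = q then 1 else 0)"
    by (rule jordan_blocks_bordered[of "cmat B" n "cmat v" "complex_of_real a"]) (use B v in auto)
  ultimately show thesis using that unfolding real_blocks_def by metis
qed

text \<open>The condition \<open>Suc k = q\<close> for \<open>k \<ge> 1\<close> stands for size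
  \<open>q - 1\<close>, which drops out when \<open>q = 1\<close>; then only one multiplicity is
  odd.\<close>

definition odd_at :: "(nat \<times> complex) multiset \<Rightarrow> real \<Rightarrow> nat \<Rightarrow> bool" where
  "odd_at S a q \<longleftrightarrow> q \<ge> 1 \<and>
    (\<forall>k\<ge>1. \<forall>l. odd (count S (k, complex_of_real l)) \<longleftrightarrow> l = a \<and> (k = q \<or> Suc k = q))"

definition complex_bordered :: "real mat \<Rightarrow> bool" where
  "complex_bordered A \<longleftrightarrow> (\<exists>n B J v a. B \<in> carrier_mat n n \<and> J \<in> carrier_mat n n \<and> v \<in> carrier_mat n 1 \<and>
     J * J = - 1\<^sub>m n \<and> B * J = J * B \<and> similar_mat A (bordered B v a))"

lemma real_blocks_similar:
  assumes "similar_mat A B" shows "real_blocks A = real_blocks B"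
  unfolding real_blocks_def
  by (rule jordan_blocks_similar[OF similar_mat_map[OF semiring_hom_of_real assms]])

lemma complex_bordered_odd_at:
  assumes "complex_bordered A"
  shows "\<exists>a q. odd_at (real_blocks A) a q"
proof -
  from assms obtain n B J v a where B: "B \<in> carrier_mat n n" and J: "J \<in> carrier_mat n n"
    and v: "v \<in> carrier_mat n 1" and JJ: "J * J = - 1\<^sub>m n" and com: "B * J = J * B"
    and sim: "similar_mat A (bordered B v a)" unfolding complex_bordered_def by blast
  obtain q where q: "q \<ge> 1" "\<And>k l. k \<ge> 1 \<Longrightarrow>
    count (real_blocks A) (k, l) + (if l = complex_of_real a \<and> Suc k = q then 1 else 0)
      = count (real_blocks B) (k, l) + (if l = complex_of_real a \<and> k = q then 1 else 0)"
    using real_blocks_bordered[OF B v, of a] unfolding real_blocks_similar[OF sim] by blast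
  have "odd (count (real_blocks A) (k, complex_of_real l)) \<longleftrightarrow> l = a \<and> (k = q \<or> Suc k = q)"
    if "k \<ge> 1" for k l
  proof -
    have "even (count (real_blocks B) (k, complex_of_real l))" by (rule even_count_commuting[OF B J JJ com])
    then show ?thesis using q(2)[OF that, of "complex_of_real l"]
      by (cases "l = a"; cases "k = q"; cases "Suc k = q") (auto, presburger+)
  qed
  then show ?thesis using q(1) unfolding odd_at_def by blast
qed

section \<open>From odd multiplicities to a bordered matrix\<close>

lemma real_blocks_jordan_block:
  "real_blocks (jordan_block k a) = (if k = 0 then {#} else {#(k, complex_of_real a)#})"
proof (cases "k = 0")
  case True
  then have "jordan_block k a = 0\<^sub>m 0 0" by auto
  then show ?thesis using True by (simp add: real_blocks_empty)
next
  case False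
  then show ?thesis
    using real_blocks_similar[OF similar_transpose_jordan_block, of k a] real_blocks_sub_jordan_block[of k a]
    by (simp add: sub_jordan_block_def)
qed

lemma dsum_mult:
  assumes "A \<in> carrier_mat n n" "B \<in> carrier_mat m m" "C \<in> carrier_mat n n" "D \<in> carrier_mat m m"
  shows "diag_block_mat [A, B] * diag_block_mat [C, D] = diag_block_mat [A * C, B * D]"
  unfolding diag_block_mat_two[OF assms(1,2)] diag_block_mat_two[OF assms(3,4)]
    diag_block_mat_two[OF mult_carrier_mat[OF assms(1,3)] mult_carrier_mat[OF assms(2,4)]]
  using assms by (subst mult_four_block_mat[of _ n n _ m _ m]) auto

lemma dsum_assoc:
  "diag_block_mat [diag_block_mat [A, B], C] = diag_block_mat [A, diag_block_mat [B, C]]"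
  using diag_block_mat_append_two[of "[A, B]" "[C]"] diag_block_mat_Cons[of A "[B, C]"]
  by (simp only: diag_block_mat_singleton append_Cons append_Nil)

text \<open>The border column has a single 1, in its last place; for \<open>q = 1\<close> it is the
  empty column.\<close>

lemma jordan_block_bordered:
  assumes "q \<ge> 1"
  shows "jordan_block q a = bordered (jordan_block (q - 1) a)
    (mat (q - 1) 1 (\<lambda>(i, j). if Suc i = q - 1 then 1 else 0)) a"
  using assms unfolding bordered_def by (intro eq_matI) auto

lemma dsum_bordered:
  assumes "X \<in> carrier_mat m m" "P \<in> carrier_mat p p" "u \<in> carrier_mat p 1"
  shows "diag_block_mat [X, bordered P u a] =
    bordered (diag_block_mat [X, P]) (mat (m + p) 1 (\<lambda>(i, j). if i < m then 0 else u $$ (i - m, 0))) a"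
  unfolding diag_block_mat_two[OF assms(1,2)] diag_block_mat_two[OF assms(1) bordered_carrier[OF assms(2)]]
  using assms unfolding bordered_def by (intro eq_matI) auto

text \<open>One block of size \<open>q\<close> and one of size \<open>q - 1\<close> are taken out of
  \<open>S\<close>. What is left has even multiplicities at real eigenvalues and is realised by some
  \<open>B\<close> in \<open>M_J r\<close>. With \<open>P\<close> the block of size
  \<open>p = q - 1\<close>, the block of size \<open>q\<close> is itself a bordered
  \<open>P\<close>, so \<open>A\<close> is similar to a bordering of the sum of \<open>B\<close> and
  two copies of \<open>P\<close>, and a pair of equal blocks commutes with a complex
  structure.\<close>

lemma odd_at_complex_bordered:
  assumes A: "A \<in> carrier_mat d d" and odd: "odd_at (real_blocks A) a q"
  shows "complex_bordered A"
proof -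
  define S where "S = real_blocks A"
  let ?c = "complex_of_real a"
  \<comment> \<open>The block of size \<open>q - 1\<close> as a multiset, which is empty for
    \<open>q = 1\<close>.\<close>
  define E where "E = real_blocks (jordan_block (q - 1) a)"
  have q: "q \<ge> 1" and odd_iff: "\<And>k l. k \<ge> 1 \<Longrightarrow>
      odd (count S (k, complex_of_real l)) \<longleftrightarrow> l = a \<and> (k = q \<or> Suc k = q)"
    using odd unfolding odd_at_def S_def by auto
  have E: "E = (if q = 1 then {#} else {#(q - 1, ?c)#})"
    using q unfolding E_def real_blocks_jordan_block by auto
  have zero: "count S (0, l) = 0" for l
    using real_blocks_pos[OF A, of 0 l] unfolding S_def by (metis not_in_iff not_one_le_zero)
  have count_F: "count ({#(q, ?c)#} + E) (k, complex_of_real l) = (if l = a \<and> k \<ge> 1 \<and> (k = q \<or> Suc k = q) then 1 else 0)" for k l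
    using q unfolding E by auto
  have odd_pos: "odd x \<Longrightarrow> 1 \<le> x" for x :: nat by presburger
  have sub: "{#(q, ?c)#} + E \<subseteq># S"
  proof (rule mset_subset_eqI)
    fix x :: "nat \<times> complex"
    obtain k l where x: "x = (k, l)" by (cases x)
    show "count ({#(q, ?c)#} + E) x \<le> count S x"
    proof (cases "l = ?c \<and> k \<ge> 1 \<and> (k = q \<or> Suc k = q)")
      case True
      then show ?thesis using count_F[of k a] odd_iff[of k a] odd_pos[of "count S x"] by (auto simp: x)
    next
      case False
      then have "count ({#(q, ?c)#} + E) x = 0" using q unfolding E x by auto
      then show ?thesis by simp
    qed
  qed
  define T where "T = S - ({#(q, ?c)#} + E)"
  have ST: "S = T + ({#(q, ?c)#} + E)" using sub unfolding T_def by (metis subset_mset.diff_add)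
  have "image_mset (map_prod id cnj) S = S" unfolding S_def by (rule real_blocks_cnj[OF A])
  moreover have "image_mset (map_prod id cnj) ({#(q, ?c)#} + E) = {#(q, ?c)#} + E" unfolding E by simp
  ultimately have symT: "image_mset (map_prod id cnj) T = T" unfolding ST image_mset_union by (metis add_right_cancel)
  have evenT: "even (count T (k, complex_of_real l))" for k l
  proof (cases "k = 0")
    case True
    then show ?thesis using zero[of "complex_of_real l"] q unfolding ST by (simp split: if_splits)
  next
    case False
    have "count S (k, complex_of_real l) = count T (k, complex_of_real l) +
      (if l = a \<and> k \<ge> 1 \<and> (k = q \<or> Suc k = q) then 1 else 0)"
      unfolding count_F[symmetric] by (subst ST) simp
    then show ?thesis using odd_iff[of k l] False by (auto split: if_splits)
  qed
  have posT: "k \<ge> 1" if "(k, l) \<in># T" for k l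
    using real_blocks_pos[OF A, of k l] that ST unfolding S_def by (metis union_iff)
  obtain r B where BM: "B \<in> M_J r" and rB: "real_blocks B = T"
    by (rule M_J_exists[OF _ symT evenT]) (use posT in blast)+
  have B: "B \<in> carrier_mat (2 * r) (2 * r)" and comB: "B * J_std r = J_std r * B"
    using BM unfolding M_J_def by auto
  define p where "p = q - 1"
  let ?P = "jordan_block p a"
  let ?u = "mat p 1 (\<lambda>(i, j). if Suc i = p then 1 else 0) :: real mat"
  have B1: "diag_block_mat [B, ?P] \<in> carrier_mat (2 * r + p) (2 * r + p)" by (rule dsum_carrier[OF B]) simp
  define A' where "A' = diag_block_mat [diag_block_mat [B, ?P], jordan_block q a]"
  have A': "A' \<in> carrier_mat (2 * r + p + q) (2 * r + p + q)"
    unfolding A'_def by (rule dsum_carrier[OF B1]) simp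
  have rA': "real_blocks A' = S"
  proof -
    have "real_blocks A' = T + E + {#(q, ?c)#}"
      unfolding A'_def using q
      by (subst real_blocks_dsum[OF B1 jordan_block_carrier], subst real_blocks_dsum[OF B jordan_block_carrier])
        (simp add: rB E_def p_def, simp add: real_blocks_jordan_block)
    then show ?thesis unfolding ST by (simp add: ac_simps)
  qed
  have "d = 2 * r + p + q" using real_blocks_size[OF A] real_blocks_size[OF A'] rA' unfolding S_def by simp
  then have sim: "similar_mat A A'"
    using similar_iff_real_blocks[OF A, of A'] A' rA' unfolding S_def by simp
  define C where "C = diag_block_mat [diag_block_mat [B, ?P], ?P]"
  define w where "w = mat (2 * r + p + p) 1 (\<lambda>(i, j). if i < 2 * r + p then 0 else ?u $$ (i - (2 * r + p), 0))"
  have A'_eq: "A' = bordered C w a"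
    unfolding A'_def jordan_block_bordered[OF q] C_def w_def p_def[symmetric]
    by (rule dsum_bordered[OF B1]) auto
  let ?J = "diag_block_mat [J_std r, J_std p]"
  have PP: "diag_block_mat [?P, ?P] \<in> carrier_mat (2 * p) (2 * p)"
    unfolding mult_2 by (rule dsum_carrier) auto
  have uminus_zero: "- 0\<^sub>m p p = (0\<^sub>m p p :: real mat)" by (intro eq_matI) auto
  \<comment> \<open>\<open>J_std p\<close> exchanges the two copies of \<open>P\<close> up to
    sign.\<close>
  have comP: "diag_block_mat [?P, ?P] * J_std p = J_std p * diag_block_mat [?P, ?P]"
    unfolding diag_block_mat_two[OF jordan_block_carrier jordan_block_carrier]
    using four_block_mult_J_std[of ?P p "0\<^sub>m p p" "0\<^sub>m p p" ?P] uminus_zero by simp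
  have C_eq: "C = diag_block_mat [B, diag_block_mat [?P, ?P]]" unfolding C_def by (rule dsum_assoc)
  have CJ: "C * ?J = ?J * C"
    unfolding C_eq dsum_mult[OF B PP J_std_carrier J_std_carrier] dsum_mult[OF J_std_carrier J_std_carrier B PP]
      comB comP ..
  have JJ: "?J * ?J = - 1\<^sub>m (2 * r + 2 * p)"
    unfolding dsum_mult[OF J_std_carrier J_std_carrier J_std_carrier J_std_carrier] J_std_square uminus_four_block
    by (rule diag_block_mat_two) auto
  have C: "C \<in> carrier_mat (2 * r + 2 * p) (2 * r + 2 * p)" unfolding C_eq by (rule dsum_carrier[OF B PP])
  have J: "?J \<in> carrier_mat (2 * r + 2 * p) (2 * r + 2 * p)" by (rule dsum_carrier[OF J_std_carrier J_std_carrier])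
  have w: "w \<in> carrier_mat (2 * r + 2 * p) 1" unfolding w_def by (intro carrier_matI) auto
  show ?thesis unfolding complex_bordered_def using C J w JJ CJ sim[unfolded A'_eq] by blast
qed

lemma complex_bordered_iff_odd_at:
  "A \<in> carrier_mat d d \<Longrightarrow> complex_bordered A \<longleftrightarrow> (\<exists>a q. odd_at (real_blocks A) a q)"
  using complex_bordered_odd_at odd_at_complex_bordered by blast

section \<open>Block types\<close>

fun block_size_list :: "block_type \<Rightarrow> nat list" where
  "block_size_list (Scalar_type m) = replicate m 1"
| "block_size_list (Block_type ns ps t) = concat (map2 (\<lambda>n p. replicate p n) ns ps) @ replicate t 1"

definition block_sizes :: "block_type \<Rightarrow> nat multiset" where
  "block_sizes \<tau> = mset (block_size_list \<tau>)"

section \<open>Block types as multisets of sizes\<close>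

lemma count_concat_replicate:
  assumes "length ps = length ns" "distinct ns"
  shows "i < length ns \<Longrightarrow> count (mset (concat (map2 (\<lambda>n p. replicate p n) ns ps))) (ns ! i) = ps ! i"
    "k \<notin> set ns \<Longrightarrow> count (mset (concat (map2 (\<lambda>n p. replicate p n) ns ps))) k = 0"
  using assms
proof (induction ps ns arbitrary: i rule: list_induct2)
  case (Cons p ps n ns)
  { case 1 then show ?case using Cons by (cases i) (auto simp: Cons.IH dest: set_zip_leftD) }
  { case 2 then show ?case using Cons by auto }
qed auto

lemma sum_list_size_list:
  "length ps = length ns \<Longrightarrow>
    sum_list (block_size_list (Block_type ns ps t)) = (\<Sum>i<length ns. ns ! i * ps ! i) + t"
proof -
  assume "length ps = length ns"
  then have "sum_list (concat (map2 (\<lambda>n p. replicate p n) ns ps)) = (\<Sum>i<length ns. ns ! i * ps ! i)"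
    by (induction ps ns rule: list_induct2) (auto simp: sum_list_replicate sum.lessThan_Suc_shift simp del: sum.lessThan_Suc)
  then show ?thesis by (simp add: sum_list_replicate)
qed

lemma sum_size_list:
  assumes "\<tau> \<in> block_types m" shows "sum_list (block_size_list \<tau>) = m"
  using assms sum_list_size_list unfolding block_types_def by (auto simp: sum_list_replicate simp del: block_size_list.simps(2))

lemma size_list_pos:
  assumes "\<tau> \<in> block_types m" "k \<in> set (block_size_list \<tau>)" shows "k \<ge> 1"
proof (cases \<tau>)
  case (Block_type ns ps t)
  then have "\<forall>n\<in>set ns. n \<ge> 2" using assms(1) unfolding block_types_def by auto
  then show ?thesis using assms(2) Block_type by (fastforce dest: set_zip_leftD split: if_splits)
qed (use assms in \<open>auto split: if_splits\<close>)

lemma sorted_wrt_greater_distinct: "sorted_wrt (>) (ns :: nat list) \<Longrightarrow> distinct ns"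
  by (induction ns) auto

lemma Block_type_counts:
  assumes "Block_type ns ps t \<in> block_types m"
  shows "i < length ns \<Longrightarrow> count (block_sizes (Block_type ns ps t)) (ns ! i) = ps ! i"
    "count (block_sizes (Block_type ns ps t)) 1 = t"
    "k \<ge> 2 \<Longrightarrow> k \<notin> set ns \<Longrightarrow> count (block_sizes (Block_type ns ps t)) k = 0"
proof -
  have l: "length ps = length ns" and d: "distinct ns" and n2: "\<forall>n\<in>set ns. n \<ge> 2"
    using assms sorted_wrt_greater_distinct unfolding block_types_def by auto
  have r: "count (mset (replicate t (1 :: nat))) k = (if k = 1 then t else 0)" for k
    by (induction t) auto
  show "count (block_sizes (Block_type ns ps t)) (ns ! i) = ps ! i" if "i < length ns"
  proof -
    have "ns ! i \<ge> 2" using n2 that by simp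
    then show ?thesis using count_concat_replicate(1)[OF l d that] r[of "ns ! i"] by (simp add: block_sizes_def)
  qed
  have "1 \<notin> set ns" using n2 by force
  then show "count (block_sizes (Block_type ns ps t)) 1 = t"
    using count_concat_replicate(2)[OF l d] r[of 1] by (simp add: block_sizes_def)
  show "count (block_sizes (Block_type ns ps t)) k = 0" if "k \<ge> 2" "k \<notin> set ns"
    using count_concat_replicate(2)[OF l d that(2)] r[of k] that by (simp add: block_sizes_def)
qed

text \<open>Positive \<open>ps\<close> make every listed size occur; the trailing ones have size 1
  and are cut off by \<open>k \<ge> 2\<close>.\<close>

lemma Block_type_set:
  assumes "Block_type ns ps t \<in> block_types m"
  shows "set ns = {k. k \<ge> 2 \<and> k \<in># block_sizes (Block_type ns ps t)}"
proof -
  have l: "length ps = length ns" and n2: "\<forall>n\<in>set ns. n \<ge> 2" and p: "\<forall>p\<in>set ps. p > 0"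
    using assms unfolding block_types_def by auto
  have "k \<in># block_sizes (Block_type ns ps t)" if k: "k \<in> set ns" for k
  proof -
    obtain i where i: "i < length ns" "k = ns ! i" using k by (metis in_set_conv_nth)
    then have "ps ! i > 0" using p l by simp
    then show ?thesis using Block_type_counts(1)[OF assms i(1)] i(2) by (metis count_greater_zero_iff)
  qed
  moreover have "k \<in> set ns" if "k \<ge> 2" "k \<in># block_sizes (Block_type ns ps t)" for k
    using Block_type_counts(3)[OF assms that(1)] that(2) by (metis not_in_iff)
  ultimately show ?thesis using n2 by blast
qed

lemma sorted_wrt_greater_unique:
  assumes "sorted_wrt (>) xs" "sorted_wrt (>) ys" "set xs = set (ys :: nat list)"
  shows "xs = ys"
proof -
  have "sorted_wrt (<) (rev xs)" "sorted_wrt (<) (rev ys)" using assms by (simp_all add: sorted_wrt_rev)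
  then have "rev xs = rev ys" using strict_sorted_equal assms(3) by (metis set_rev)
  then show ?thesis by simp
qed

text \<open>The sizes from 2 on that occur recover \<open>ns\<close>, because it is strictly
  decreasing; their multiplicities recover \<open>ps\<close>, and that of 1 recovers
  \<open>t\<close>. A tuple lists at least one size above 1, so it never agrees with the scalar
  symbol.\<close>

lemma block_sizes_inj:
  assumes t: "\<tau> \<in> block_types m" and u: "\<upsilon> \<in> block_types m" and eq: "block_sizes \<tau> = block_sizes \<upsilon>"
  shows "\<tau> = \<upsilon>"
proof -
  have mixed: "block_sizes (Block_type ns ps t) \<noteq> block_sizes (Scalar_type k)"
    if B: "Block_type ns ps t \<in> block_types m" for ns ps t k
  proof
    assume e: "block_sizes (Block_type ns ps t) = block_sizes (Scalar_type k)"
    have "hd ns \<in> set ns" using B unfolding block_types_def by (cases ns) auto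
    then have "hd ns \<ge> 2" "hd ns \<in># block_sizes (Scalar_type k)" using Block_type_set[OF B] e by auto
    then show False by (auto simp: block_sizes_def split: if_splits)
  qed
  show ?thesis
  proof (cases \<tau>)
    case (Scalar_type k)
    then have "k = m" using t by (auto simp: block_types_def)
    moreover obtain k' where "\<upsilon> = Scalar_type k'" using mixed u eq Scalar_type by (metis block_type.exhaust)
    moreover from this have "k' = m" using u by (auto simp: block_types_def)
    ultimately show ?thesis using Scalar_type by simp
  next
    case (Block_type ns ps t')
    then obtain ns' ps' t'' where u': "\<upsilon> = Block_type ns' ps' t''"
      using mixed t eq by (metis block_type.exhaust)
    note B = t[unfolded Block_type] and B' = u[unfolded u'] and e = eq[unfolded Block_type u']
    have "ns = ns'"
      using sorted_wrt_greater_unique[of ns ns'] Block_type_set[OF B] Block_type_set[OF B'] e B B'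
      unfolding block_types_def by auto
    moreover have "ps = ps'"
    proof (rule nth_equalityI)
      show l: "length ps = length ps'" using B B' \<open>ns = ns'\<close> unfolding block_types_def by auto
      fix i assume "i < length ps"
      then have "i < length ns" using B unfolding block_types_def by auto
      then show "ps ! i = ps' ! i"
        using Block_type_counts(1)[OF B, of i] Block_type_counts(1)[OF B', of i] e \<open>ns = ns'\<close> by simp
    qed
    moreover have "t' = t''" using Block_type_counts(2)[OF B] Block_type_counts(2)[OF B'] e by simp
    ultimately show ?thesis using Block_type u' by simp
  qed
qed

text \<open>With \<open>block_sizes_inj\<close>, block types for \<open>m\<close> are the same as
  partitions of \<open>m\<close>. The partition into ones goes to the scalar symbol.\<close>

lemma block_sizes_surj:
  assumes pos: "\<And>k. k \<in># S \<Longrightarrow> k \<ge> 1" and sum: "sum_mset S = m"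
  obtains \<tau> where "\<tau> \<in> block_types m" "block_sizes \<tau> = S"
proof (cases "\<forall>k\<in>#S. k = 1")
  case True
  then have "set_mset S \<subseteq> {1}" by blast
  then have S: "S = replicate_mset (size S) 1" by (rule set_mset_subset_singletonD)
  have "size S = m" using sum by (subst (asm) S) simp
  then have "block_sizes (Scalar_type m) = S" using S by (simp add: block_sizes_def)
  moreover have "Scalar_type m \<in> block_types m" by (simp add: block_types_def)
  ultimately show thesis using that by blast
next
  case False
  define K where "K = {k \<in> set_mset S. k \<ge> 2}"
  have fin: "finite K" unfolding K_def by simp
  from False obtain k where "k \<in># S" "k \<noteq> 1" by blast
  with pos[of k] have ne: "K \<noteq> {}" unfolding K_def by force
  define ns where "ns = rev (sorted_list_of_set K)"
  define ps where "ps = map (count S) ns"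
  define \<tau> where "\<tau> = Block_type ns ps (count S 1)"
  have setns: "set ns = K" unfolding ns_def using fin by simp
  have sorted: "sorted_wrt (>) ns" unfolding ns_def by (simp add: sorted_wrt_rev)
  \<comment> \<open>The total is first left as the sum of the size list. That it equals
    \<open>m\<close> follows only from \<open>block_sizes \<tau> = S\<close>, whose proof already
    uses this membership.\<close>
  have B: "\<tau> \<in> block_types (sum_list (block_size_list \<tau>))"
    unfolding block_types_def \<tau>_def
  proof -
    have "length ps = length ns" unfolding ps_def by simp
    moreover have "length ns \<ge> 1" using ne setns by (cases ns) auto
    moreover have "\<forall>n\<in>set ns. n \<ge> 2" "\<forall>p\<in>set ps. p > 0" using setns by (auto simp: K_def ps_def)
    ultimately show "Block_type ns ps (count S 1) \<in>
        insert (Scalar_type (sum_list (block_size_list (Block_type ns ps (count S 1)))))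
        {Block_type ns' ps' t | ns' ps' t.
          length ps' = length ns' \<and> length ns' \<ge> 1 \<and> sorted_wrt (>) ns' \<and>
          (\<forall>n\<in>set ns'. n \<ge> 2) \<and> (\<forall>p\<in>set ps'. p > 0) \<and>
          (\<Sum>i<length ns'. ns' ! i * ps' ! i) + t = sum_list (block_size_list (Block_type ns ps (count S 1)))}"
      using sum_list_size_list[of ps ns "count S 1"] sorted by auto
  qed
  have "block_sizes \<tau> = S"
  proof (rule multiset_eqI)
    fix k
    consider "k = 0" | "k = 1" | "k \<ge> 2" "k \<in> K" | "k \<ge> 2" "k \<notin> K" by linarith
    then show "count (block_sizes \<tau>) k = count S k"
    proof cases
      case 1
      then have "k \<notin># S" "k \<notin># block_sizes \<tau>" using pos size_list_pos[OF B, of k] by (auto simp: block_sizes_def)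
      then show ?thesis by (metis not_in_iff)
    next
      case 2
      then show ?thesis using Block_type_counts(2)[OF B[unfolded \<tau>_def]] unfolding \<tau>_def by simp
    next
      case 3
      then obtain i where "i < length ns" "k = ns ! i" using setns by (metis in_set_conv_nth)
      then show ?thesis using Block_type_counts(1)[OF B[unfolded \<tau>_def]] unfolding \<tau>_def by (simp add: ps_def)
    next
      case 4
      then have "k \<notin># S" "k \<notin> set ns" using setns unfolding K_def by auto
      then show ?thesis using Block_type_counts(3)[OF B[unfolded \<tau>_def] 4(1)] unfolding \<tau>_def by (metis not_in_iff)
    qed
  qed
  moreover have "sum_list (block_size_list \<tau>) = m"
    using sum \<open>block_sizes \<tau> = S\<close> unfolding block_sizes_def by (metis sum_mset_sum_list)
  ultimately show thesis using that B by simp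
qed

definition odd_sizes_at :: "nat multiset \<Rightarrow> nat \<Rightarrow> bool" where
  "odd_sizes_at S q \<longleftrightarrow> q \<ge> 1 \<and> (\<forall>k\<ge>1. odd (count S k) \<longleftrightarrow> k = q \<or> Suc k = q)"

text \<open>The three cases of the definition correspond to \<open>q = 1\<close>, \<open>q = 2\<close> and \<open>q \<ge> 3\<close>.\<close>

lemma c_block_types_iff:
  assumes "odd m"
  shows "\<tau> \<in> c_block_types m \<longleftrightarrow> \<tau> \<in> block_types m \<and> (\<exists>q. odd_sizes_at (block_sizes \<tau>) q)"
proof (cases \<tau>)
  case (Scalar_type k)
  \<comment> \<open>An odd number \<open>m\<close> of blocks of size 1 is the case
    \<open>q = 1\<close>.\<close>
  have "odd_sizes_at (block_sizes (Scalar_type m)) 1"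
    using assms unfolding odd_sizes_at_def block_sizes_def by (auto simp flip: replicate_mset_def simp: count_replicate_mset)
  then show ?thesis unfolding Scalar_type c_block_types_def block_types_def by auto
next
  case (Block_type ns ps t)
  show ?thesis
  proof (cases "\<tau> \<in> block_types m")
    case False
    then show ?thesis unfolding Block_type c_block_types_def by auto
  next
    case True
    note B = True[unfolded Block_type]
    let ?S = "block_sizes (Block_type ns ps t)"
    have l: "length ps = length ns" and len: "length ns \<ge> 1" and srt: "sorted_wrt (>) ns"
      and n2: "\<forall>n\<in>set ns. n \<ge> 2" and d: "distinct ns"
      using B sorted_wrt_greater_distinct unfolding block_types_def by auto
    note cnt = Block_type_counts[OF B]
    have less: "ns ! j < ns ! i" if "i < j" "j < length ns" for i j
      using srt that by (auto simp: sorted_wrt_iff_nth_less)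
    have n2': "ns ! i \<ge> 2" if "i < length ns" for i using n2 that by simp
    \<comment> \<open>The condition on all sizes is split into size 1, the listed sizes, and the
      demand that \<open>q\<close> and \<open>q - 1\<close> be listed whenever they are at least 2,
      since unlisted sizes have multiplicity 0.\<close>
    have odd_iff: "odd_sizes_at ?S q \<longleftrightarrow> q \<ge> 1 \<and> (odd t \<longleftrightarrow> q = 1 \<or> q = 2) \<and>
        (\<forall>i<length ns. odd (ps ! i) \<longleftrightarrow> ns ! i = q \<or> Suc (ns ! i) = q) \<and>
        (\<forall>k\<ge>2. (k = q \<or> Suc k = q) \<longrightarrow> k \<in> set ns)" (is "_ \<longleftrightarrow> ?R") for q
    proof
      assume o: "odd_sizes_at ?S q"
      then have q: "q \<ge> 1" and o': "\<And>k. k \<ge> 1 \<Longrightarrow> odd (count ?S k) \<longleftrightarrow> k = q \<or> Suc k = q"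
        unfolding odd_sizes_at_def by auto
      have "odd t \<longleftrightarrow> q = 1 \<or> q = 2" using o'[of 1] cnt(2) by auto
      moreover have "odd (ps ! i) \<longleftrightarrow> ns ! i = q \<or> Suc (ns ! i) = q" if "i < length ns" for i
        using o'[of "ns ! i"] cnt(1)[OF that] n2'[OF that] by simp
      moreover have "k \<in> set ns" if "k \<ge> 2" "k = q \<or> Suc k = q" for k
        using o'[of k] cnt(3)[of k] that by fastforce
      ultimately show ?R using q by blast
    next
      assume r: ?R
      have "odd (count ?S k) \<longleftrightarrow> k = q \<or> Suc k = q" if "k \<ge> 1" for k
      proof (cases "k = 1")
        case True
        then show ?thesis using r cnt(2) by auto
      next
        case False
        then have k: "k \<ge> 2" using that by simp
        show ?thesis
        proof (cases "k \<in> set ns")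
          case True
          then obtain i where "i < length ns" "k = ns ! i" by (metis in_set_conv_nth)
          then show ?thesis using cnt(1) r by metis
        next
          case False
          then show ?thesis using cnt(3)[OF k] r k by force
        qed
      qed
      then show "odd_sizes_at ?S q" using r unfolding odd_sizes_at_def by blast
    qed
    have last_ns: "last ns = ns ! (length ns - 1)" and last_ps: "last ps = ps ! (length ns - 1)"
      using len l by (auto simp: last_conv_nth simp flip: length_greater_0_conv)
    have "(\<exists>q. odd_sizes_at ?S q) \<longleftrightarrow>
      ((odd t \<and> (\<forall>i<length ps. even (ps ! i)))
     \<or> (odd t \<and> (\<forall>i<length ps - 1. even (ps ! i)) \<and> last ns = 2 \<and> odd (last ps))
     \<or> (even t \<and> length ns \<ge> 2 \<and>
         (\<exists>l. Suc l < length ns \<and> ns ! l = ns ! Suc l + 1 \<and>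
           odd (ps ! l) \<and> odd (ps ! Suc l) \<and>
           (\<forall>i<length ps. i \<notin> {l, Suc l} \<longrightarrow> even (ps ! i)))))" (is "_ \<longleftrightarrow> ?I \<or> ?II \<or> ?III")
    proof
      assume "\<exists>q. odd_sizes_at ?S q"
      then obtain q where "odd_sizes_at ?S q" by blast
      note R = iffD1[OF odd_iff this]
      have q1: "q \<ge> 1" and t: "odd t \<longleftrightarrow> q = 1 \<or> q = 2"
        and p: "\<And>i. i < length ns \<Longrightarrow> odd (ps ! i) \<longleftrightarrow> ns ! i = q \<or> Suc (ns ! i) = q"
        and mem: "\<And>k. k \<ge> 2 \<Longrightarrow> k = q \<or> Suc k = q \<Longrightarrow> k \<in> set ns"
        using R by blast+
      consider "q = 1" | "q = 2" | "q \<ge> 3" using q1 by linarith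
      then show "?I \<or> ?II \<or> ?III"
      proof cases
        case 1
        then have "even (ps ! i)" if "i < length ns" for i using p[OF that] n2'[OF that] by auto
        then show ?thesis using t 1 l by simp
      next
        case 2
        then obtain i where i: "i < length ns" "ns ! i = 2" using mem[of 2] by (metis in_set_conv_nth order_refl)
        \<comment> \<open>2 is the least size allowed, so in a strictly decreasing list it stands
          last.\<close>
        have "i = length ns - 1"
        proof (rule ccontr)
          assume "i \<noteq> length ns - 1"
          then have "i < length ns - 1" using i by simp
          then show False using less[of i "length ns - 1"] n2'[of "length ns - 1"] i by linarith
        qed
        moreover have "even (ps ! j)" if "j < length ps - 1" for j
          using p[of j] n2'[of j] less[of j i] i that l \<open>i = length ns - 1\<close> 2 by auto
        ultimately have ?II using i p[OF i(1)] t 2 last_ns last_ps by simp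
        then show ?thesis by blast
      next
        case 3
        then obtain i j where i: "i < length ns" "ns ! i = q" and j: "j < length ns" "Suc (ns ! j) = q"
        proof -
          have "q \<in> set ns" "q - 1 \<in> set ns" using mem[of q] mem[of "q - 1"] 3 by auto
          moreover have "Suc (q - 1) = q" using 3 by simp
          ultimately show thesis using that by (metis in_set_conv_nth)
        qed
        have "i < j" using less[of j i] i j by (cases i j rule: linorder_cases) auto
        \<comment> \<open>An entry between the two positions would lie strictly between
          \<open>q - 1\<close> and \<open>q\<close>.\<close>
        have "j = Suc i"
        proof (rule ccontr)
          assume "j \<noteq> Suc i"
          then have "Suc i < j" using \<open>i < j\<close> by simp
          then show False using less[of i "Suc i"] less[of "Suc i" j] i j by auto
        qed
        moreover have "even (ps ! k)" if "k < length ps" "k \<notin> {i, Suc i}" for k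
        proof -
          have "ns ! k \<noteq> ns ! i" "ns ! k \<noteq> ns ! j"
            using that l i j d \<open>j = Suc i\<close> by (auto simp: nth_eq_iff_index_eq)
          then show ?thesis using p[of k] that l i j by auto
        qed
        ultimately have ?III using i j p[OF i(1)] p[OF j(1)] t 3 by (auto intro!: exI[of _ i])
        then show ?thesis by blast
      qed
    next
      assume "?I \<or> ?II \<or> ?III"
      then consider ?I | ?II | ?III by blast
      then show "\<exists>q. odd_sizes_at ?S q"
      proof cases
        case 1
        then show ?thesis unfolding odd_iff using n2' l by (intro exI[of _ 1]) fastforce
      next
        case 2
        have "odd (ps ! i) \<longleftrightarrow> ns ! i = 2 \<or> Suc (ns ! i) = 2" if i: "i < length ns" for i
        proof (cases "i = length ns - 1")
          case True
          then show ?thesis using 2 last_ns last_ps by simp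
        next
          case False
          then have "i < length ns - 1" using i by simp
          then have "ns ! i > 2" using less[of i "length ns - 1"] last_ns 2 i by simp
          then show ?thesis using 2 l \<open>i < length ns - 1\<close> by auto
        qed
        moreover have "2 \<in> set ns" using 2 len by (metis last_in_set list.size(3) not_one_le_zero)
        ultimately show ?thesis unfolding odd_iff using 2 by (intro exI[of _ 2]) auto
      next
        case 3
        then obtain i where i: "Suc i < length ns" "ns ! i = ns ! Suc i + 1" "odd (ps ! i)" "odd (ps ! Suc i)"
          "\<And>k. k < length ps \<Longrightarrow> k \<notin> {i, Suc i} \<Longrightarrow> even (ps ! k)" and t: "even t" by blast
        have "odd (ps ! k) \<longleftrightarrow> ns ! k = ns ! i \<or> Suc (ns ! k) = ns ! i" if k: "k < length ns" for k
        proof -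
          have "ns ! k = ns ! i \<longleftrightarrow> k = i" "ns ! k = ns ! Suc i \<longleftrightarrow> k = Suc i"
            using i(1) k d by (simp_all only: nth_eq_iff_index_eq Suc_lessD)
          moreover have "Suc (ns ! k) = ns ! i \<longleftrightarrow> ns ! k = ns ! Suc i" using i(2) by simp
          ultimately have "ns ! k = ns ! i \<longleftrightarrow> k = i" "Suc (ns ! k) = ns ! i \<longleftrightarrow> k = Suc i" by auto
          then show ?thesis using i k l by auto
        qed
        moreover have "ns ! i \<ge> 3" using n2'[OF i(1)] i(2) by simp
        moreover have "k \<in> set ns" if "k = ns ! i \<or> Suc k = ns ! i" for k
        proof -
          have "ns ! i \<in> set ns" "ns ! Suc i \<in> set ns" using i(1) by simp_all
          then show ?thesis using that i(2) by (metis Suc_eq_plus1 nat.inject)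
        qed
        ultimately show ?thesis unfolding odd_iff using t by (intro exI[of _ "ns ! i"]) auto
      qed
    qed
    then show ?thesis using B unfolding Block_type c_block_types_def by auto
  qed
qed

section \<open>Lie isomorphisms and complex structures\<close>

lemma linear_map_iff:
  assumes "real_lie_algebra L" "real_lie_algebra L'"
  shows "linear_map class_ring L L' f \<longleftrightarrow>
    f \<in> carrier L \<rightarrow> carrier L' \<and>
    (\<forall>x\<in>carrier L. \<forall>y\<in>carrier L. f (x \<oplus>\<^bsub>L\<^esub> y) = f x \<oplus>\<^bsub>L'\<^esub> f y) \<and>
    (\<forall>c. \<forall>x\<in>carrier L. f (c \<odot>\<^bsub>L\<^esub> x) = c \<odot>\<^bsub>L'\<^esub> f x)"
proof -
  have vs: "vectorspace class_ring L" "vectorspace class_ring L'"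
    using assms unfolding real_lie_algebra_def by auto
  then have "module class_ring L" "module class_ring L'" unfolding vectorspace_def by auto
  with vs show ?thesis
    unfolding linear_map_def mod_hom_def mod_hom_axioms_def module_hom_def by auto
qed

lemma lie_isomorphic_sym:
  assumes L: "real_lie_algebra L" and L': "real_lie_algebra L'" and iso: "lie_isomorphic L L'"
  shows "lie_isomorphic L' L"
proof -
  obtain f where f: "linear_map class_ring L L' f" "bij_betw f (carrier L) (carrier L')"
    "\<And>x y. x \<in> carrier L \<Longrightarrow> y \<in> carrier L \<Longrightarrow> f (lie_bracket L x y) = lie_bracket L' (f x) (f y)"
    using iso unfolding lie_isomorphic_def by blast
  define g where "g = inv_into (carrier L) f"
  have g: "bij_betw g (carrier L') (carrier L)" unfolding g_def by (rule bij_betw_inv_into[OF f(2)])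
  have gc: "g x \<in> carrier L" if "x \<in> carrier L'" for x using g that by (rule bij_betwE[rule_format])
  have fg: "f (g x) = x" if "x \<in> carrier L'" for x
    unfolding g_def by (rule bij_betw_inv_into_right[OF f(2) that])
  have gf: "g (f x) = x" if "x \<in> carrier L" for x
    unfolding g_def by (rule bij_betw_inv_into_left[OF f(2) that])
  interpret L: real_lie_algebra L by fact
  interpret L': real_lie_algebra L' by fact
  have lin: "\<And>x y. x \<in> carrier L \<Longrightarrow> y \<in> carrier L \<Longrightarrow> f (x \<oplus>\<^bsub>L\<^esub> y) = f x \<oplus>\<^bsub>L'\<^esub> f y"
    "\<And>c x. x \<in> carrier L \<Longrightarrow> f (c \<odot>\<^bsub>L\<^esub> x) = c \<odot>\<^bsub>L'\<^esub> f x"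
    using f(1) unfolding linear_map_iff[OF L L'] by auto
  have "linear_map class_ring L' L g"
    unfolding linear_map_iff[OF L' L]
  proof (intro conjI ballI allI)
    show "g \<in> carrier L' \<rightarrow> carrier L" using gc by auto
    fix x y assume x: "x \<in> carrier L'" and y: "y \<in> carrier L'"
    have "g (x \<oplus>\<^bsub>L'\<^esub> y) = g (f (g x \<oplus>\<^bsub>L\<^esub> g y))" using lin(1) gc x y fg by simp
    also have "\<dots> = g x \<oplus>\<^bsub>L\<^esub> g y" using gc x y by (intro gf) simp
    finally show "g (x \<oplus>\<^bsub>L'\<^esub> y) = g x \<oplus>\<^bsub>L\<^esub> g y" .
  next
    fix c x assume x: "x \<in> carrier L'"
    have "g (c \<odot>\<^bsub>L'\<^esub> x) = g (f (c \<odot>\<^bsub>L\<^esub> g x))" using lin(2) gc x fg by simp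
    also have "\<dots> = c \<odot>\<^bsub>L\<^esub> g x" using gc x by (intro gf) simp
    finally show "g (c \<odot>\<^bsub>L'\<^esub> x) = c \<odot>\<^bsub>L\<^esub> g x" .
  qed
  moreover have "g (lie_bracket L' x y) = lie_bracket L (g x) (g y)"
    if x: "x \<in> carrier L'" and y: "y \<in> carrier L'" for x y
  proof -
    have "g (lie_bracket L' x y) = g (f (lie_bracket L (g x) (g y)))" using f(3) gc x y fg by simp
    also have "\<dots> = lie_bracket L (g x) (g y)" using gc x y by (intro gf L.bracket_closed)
    finally show ?thesis .
  qed
  ultimately show ?thesis using g unfolding lie_isomorphic_def by blast
qed

lemma lie_isomorphic_trans:
  assumes "real_lie_algebra L" "real_lie_algebra L'" "real_lie_algebra L''"
    and "lie_isomorphic L L'" "lie_isomorphic L' L''"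
  shows "lie_isomorphic L L''"
proof -
  obtain f where f: "linear_map class_ring L L' f" "bij_betw f (carrier L) (carrier L')"
    "\<And>x y. x \<in> carrier L \<Longrightarrow> y \<in> carrier L \<Longrightarrow> f (lie_bracket L x y) = lie_bracket L' (f x) (f y)"
    using assms(4) unfolding lie_isomorphic_def by blast
  obtain g where g: "linear_map class_ring L' L'' g" "bij_betw g (carrier L') (carrier L'')"
    "\<And>x y. x \<in> carrier L' \<Longrightarrow> y \<in> carrier L' \<Longrightarrow> g (lie_bracket L' x y) = lie_bracket L'' (g x) (g y)"
    using assms(5) unfolding lie_isomorphic_def by blast
  have fc: "f x \<in> carrier L'" if "x \<in> carrier L" for x using f(2) that by (rule bij_betwE[rule_format])
  have "linear_map class_ring L L'' (g \<circ> f)"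
    using f(1) g(1) unfolding linear_map_iff[OF assms(1,2)] linear_map_iff[OF assms(2,3)] linear_map_iff[OF assms(1,3)]
    by (auto simp: Pi_iff)
  moreover have "bij_betw (g \<circ> f) (carrier L) (carrier L'')" by (rule bij_betw_trans[OF f(2) g(2)])
  moreover have "(g \<circ> f) (lie_bracket L x y) = lie_bracket L'' ((g \<circ> f) x) ((g \<circ> f) y)"
    if "x \<in> carrier L" "y \<in> carrier L" for x y
    using f(3)[OF that] g(3)[OF fc fc] that by simp
  ultimately show ?thesis unfolding lie_isomorphic_def by blast
qed

lemma lie_isomorphic_refl:
  assumes "real_lie_algebra L" shows "lie_isomorphic L L"
  unfolding lie_isomorphic_def linear_map_iff[OF assms assms]
  by (intro exI[of _ id]) auto

lemma lie_iso_class_eq_iff: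
  assumes "real_lie_algebra L" "real_lie_algebra L'"
  shows "lie_iso_class L = lie_iso_class L' \<longleftrightarrow> lie_isomorphic L L'"
proof
  assume "lie_iso_class L = lie_iso_class L'"
  moreover have "L' \<in> lie_iso_class L'"
    using assms lie_isomorphic_refl unfolding lie_iso_class_def by blast
  ultimately show "lie_isomorphic L L'" unfolding lie_iso_class_def by blast
next
  assume "lie_isomorphic L L'"
  then show "lie_iso_class L = lie_iso_class L'"
    using lie_isomorphic_sym lie_isomorphic_trans assms unfolding lie_iso_class_def by blast
qed

lemma complex_structure_transport:
  assumes L: "real_lie_algebra L" and L': "real_lie_algebra L'" and iso: "lie_isomorphic L L'"
    and j: "complex_structure L j"
  shows "\<exists>j'. complex_structure L' j'"
proof -
  obtain f where f: "linear_map class_ring L L' f" "bij_betw f (carrier L) (carrier L')"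
    "\<And>x y. x \<in> carrier L \<Longrightarrow> y \<in> carrier L \<Longrightarrow> f (lie_bracket L x y) = lie_bracket L' (f x) (f y)"
    using iso unfolding lie_isomorphic_def by blast
  define g where "g = inv_into (carrier L) f"
  have g: "bij_betw g (carrier L') (carrier L)" unfolding g_def by (rule bij_betw_inv_into[OF f(2)])
  have gc: "g x \<in> carrier L" if "x \<in> carrier L'" for x using g that by (rule bij_betwE[rule_format])
  have fc: "f x \<in> carrier L'" if "x \<in> carrier L" for x using f(2) that by (rule bij_betwE[rule_format])
  have fg: "f (g x) = x" if "x \<in> carrier L'" for x
    unfolding g_def by (rule bij_betw_inv_into_right[OF f(2) that])
  have gf: "g (f x) = x" if "x \<in> carrier L" for x
    unfolding g_def by (rule bij_betw_inv_into_left[OF f(2) that])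
  interpret L: real_lie_algebra L by fact
  interpret L': real_lie_algebra L' by fact
  interpret f: linear_map class_ring L L' f by fact
  have jl: "linear_map class_ring L L j" and jb: "bij_betw j (carrier L) (carrier L)"
    and jj: "\<And>x. x \<in> carrier L \<Longrightarrow> j (j x) = \<ominus>\<^bsub>L\<^esub> x"
    and jn: "\<And>x y. x \<in> carrier L \<Longrightarrow> y \<in> carrier L \<Longrightarrow> lie_bracket L x y
        \<oplus>\<^bsub>L\<^esub> j (lie_bracket L (j x) y \<oplus>\<^bsub>L\<^esub> lie_bracket L x (j y))
        \<ominus>\<^bsub>L\<^esub> lie_bracket L (j x) (j y) = \<zero>\<^bsub>L\<^esub>"
    using j unfolding complex_structure_def by auto
  interpret j: linear_map class_ring L L j by fact
  have jc: "j x \<in> carrier L" if "x \<in> carrier L" for x using jb that by (rule bij_betwE[rule_format])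
  have fadd: "f (x \<oplus>\<^bsub>L\<^esub> y) = f x \<oplus>\<^bsub>L'\<^esub> f y" if "x \<in> carrier L" "y \<in> carrier L" for x y
    using f(1) that unfolding linear_map_iff[OF L L'] by auto
  have fsm: "f (c \<odot>\<^bsub>L\<^esub> x) = c \<odot>\<^bsub>L'\<^esub> f x" if "x \<in> carrier L" for c x
    using f(1) that unfolding linear_map_iff[OF L L'] by auto
  have jadd: "j (x \<oplus>\<^bsub>L\<^esub> y) = j x \<oplus>\<^bsub>L\<^esub> j y" if "x \<in> carrier L" "y \<in> carrier L" for x y
    using jl that unfolding linear_map_iff[OF L L] by auto
  have jsm: "j (c \<odot>\<^bsub>L\<^esub> x) = c \<odot>\<^bsub>L\<^esub> j x" if "x \<in> carrier L" for c x
    using jl that unfolding linear_map_iff[OF L L] by auto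
  define j' where "j' = f \<circ> j \<circ> g"
  have j'f: "j' (f x) = f (j x)" if "x \<in> carrier L" for x using that by (simp add: j'_def gf)
  have j'c: "j' x \<in> carrier L'" if "x \<in> carrier L'" for x
    using fc jc gc that by (simp add: j'_def)
  have surj: "\<exists>u\<in>carrier L. x = f u" if "x \<in> carrier L'" for x using fg gc that by metis
  have lin: "linear_map class_ring L' L' j'"
    unfolding linear_map_iff[OF L' L']
  proof (intro conjI ballI allI)
    show "j' \<in> carrier L' \<rightarrow> carrier L'" using j'c by auto
    fix x y assume "x \<in> carrier L'" "y \<in> carrier L'"
    then obtain u v where u: "u \<in> carrier L" "x = f u" and v: "v \<in> carrier L" "y = f v" using surj by metis
    have "j' (f u \<oplus>\<^bsub>L'\<^esub> f v) = f (j (u \<oplus>\<^bsub>L\<^esub> v))" using u v fadd j'f by (metis L.add.m_closed)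
    also have "\<dots> = f (j u) \<oplus>\<^bsub>L'\<^esub> f (j v)" using u v by (simp add: jadd fadd jc)
    finally show "j' (x \<oplus>\<^bsub>L'\<^esub> y) = j' x \<oplus>\<^bsub>L'\<^esub> j' y" using u v by (simp add: j'f)
  next
    fix c x assume "x \<in> carrier L'"
    then obtain u where u: "u \<in> carrier L" "x = f u" using surj by metis
    have cu: "c \<odot>\<^bsub>L\<^esub> u \<in> carrier L" using u by simp
    have "j' (c \<odot>\<^bsub>L'\<^esub> f u) = f (j (c \<odot>\<^bsub>L\<^esub> u))" using u j'f[OF cu] by (simp only: fsm)
    also have "\<dots> = c \<odot>\<^bsub>L'\<^esub> f (j u)" using u by (simp add: jsm fsm jc)
    finally show "j' (c \<odot>\<^bsub>L'\<^esub> x) = c \<odot>\<^bsub>L'\<^esub> j' x" using u by (simp add: j'f)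
  qed
  have bij: "bij_betw j' (carrier L') (carrier L')"
    unfolding j'_def using bij_betw_trans[OF g bij_betw_trans[OF jb f(2)]] by (simp add: comp_assoc)
  have sq: "j' (j' x) = \<ominus>\<^bsub>L'\<^esub> x" if x: "x \<in> carrier L'" for x
  proof -
    obtain u where u: "u \<in> carrier L" "x = f u" using surj[OF x] by blast
    then show ?thesis using j'f jc jj f.T_neg by simp
  qed
  have nij: "lie_bracket L' x y
        \<oplus>\<^bsub>L'\<^esub> j' (lie_bracket L' (j' x) y \<oplus>\<^bsub>L'\<^esub> lie_bracket L' x (j' y))
        \<ominus>\<^bsub>L'\<^esub> lie_bracket L' (j' x) (j' y) = \<zero>\<^bsub>L'\<^esub>"
    if xy: "x \<in> carrier L'" "y \<in> carrier L'" for x y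
  proof -
    obtain u v where u: "u \<in> carrier L" "x = f u" and v: "v \<in> carrier L" "y = f v"
      using surj xy by metis
    note br = L.bracket_closed
    have c: "lie_bracket L (j u) v \<oplus>\<^bsub>L\<^esub> lie_bracket L u (j v) \<in> carrier L"
      using u v by (intro L.add.m_closed br jc)
    have "lie_bracket L' x y
        \<oplus>\<^bsub>L'\<^esub> j' (lie_bracket L' (j' x) y \<oplus>\<^bsub>L'\<^esub> lie_bracket L' x (j' y))
        \<ominus>\<^bsub>L'\<^esub> lie_bracket L' (j' x) (j' y) =
      f (lie_bracket L u v) \<oplus>\<^bsub>L'\<^esub> j' (f (lie_bracket L (j u) v \<oplus>\<^bsub>L\<^esub> lie_bracket L u (j v)))
        \<ominus>\<^bsub>L'\<^esub> f (lie_bracket L (j u) (j v))"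
      using u v by (simp add: f(3) j'f jc fadd br)
    also have "\<dots> = f (lie_bracket L u v \<oplus>\<^bsub>L\<^esub> j (lie_bracket L (j u) v \<oplus>\<^bsub>L\<^esub> lie_bracket L u (j v))
        \<ominus>\<^bsub>L\<^esub> lie_bracket L (j u) (j v))"
      unfolding j'f[OF c] a_minus_def
      using u v c by (simp add: fadd f.T_neg br jc)
    also have "\<dots> = f \<zero>\<^bsub>L\<^esub>" using jn u v by simp
    also have "\<dots> = \<zero>\<^bsub>L'\<^esub>" by simp
    finally show ?thesis .
  qed
  show ?thesis using lin bij sq nij unfolding complex_structure_def by blast
qed

section \<open>Lie isomorphism as similarity up to a scalar\<close>

lemma almost_abelian_simps:
  "carrier (almost_abelian A) = UNIV \<times> carrier_vec (dim_row A)"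
  "\<zero>\<^bsub>almost_abelian A\<^esub> = (0, 0\<^sub>v (dim_row A))"
  "(s, v) \<oplus>\<^bsub>almost_abelian A\<^esub> (t, w) = (s + t, v + w)"
  "c \<odot>\<^bsub>almost_abelian A\<^esub> (s, v) = (c * s, c \<cdot>\<^sub>v v)"
  "lie_bracket (almost_abelian A) (s, v) (t, w) = (0, s \<cdot>\<^sub>v (A *\<^sub>v w) - t \<cdot>\<^sub>v (A *\<^sub>v v))"
  by (simp_all add: almost_abelian_def)

lemma almost_abelian_uminus:
  assumes A: "A \<in> carrier_mat d d" and v: "v \<in> carrier_vec d"
  shows "\<ominus>\<^bsub>almost_abelian A\<^esub> (s, v) = (- s, - v)"
proof -
  interpret real_lie_algebra "almost_abelian A" by (rule almost_abelian_lie_algebra[OF A])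
  show ?thesis
    by (rule minus_equality) (use A v in \<open>auto simp: almost_abelian_simps\<close>)
qed

lemma almost_abelian_linear_map:
  assumes A: "A \<in> carrier_mat d d" and B: "B \<in> carrier_mat e e"
    and f: "linear_map class_ring (almost_abelian A) (almost_abelian B) f"
    and v: "v \<in> carrier_vec d"
  shows "snd (f (s, v)) \<in> carrier_vec e"
    "w \<in> carrier_vec d \<Longrightarrow>
      f (s + t, v + w) = (fst (f (s, v)) + fst (f (t, w)), snd (f (s, v)) + snd (f (t, w)))"
    "f (c * s, c \<cdot>\<^sub>v v) = (c * fst (f (s, v)), c \<cdot>\<^sub>v snd (f (s, v)))"
proof -
  let ?L = "almost_abelian A" and ?L' = "almost_abelian B"
  note lin = f[unfolded linear_map_iff[OF almost_abelian_lie_algebra[OF A] almost_abelian_lie_algebra[OF B]]]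
  have c: "(s, v) \<in> carrier ?L" using A v by (simp add: almost_abelian_simps)
  have "f (s, v) \<in> carrier ?L'" using lin c by blast
  then show "snd (f (s, v)) \<in> carrier_vec e" using B by (auto simp: almost_abelian_simps)
  show "f (s + t, v + w) = (fst (f (s, v)) + fst (f (t, w)), snd (f (s, v)) + snd (f (t, w)))"
    if "w \<in> carrier_vec d"
  proof -
    have "(t, w) \<in> carrier ?L" using A that by (simp add: almost_abelian_simps)
    then have "f ((s, v) \<oplus>\<^bsub>?L\<^esub> (t, w)) = f (s, v) \<oplus>\<^bsub>?L'\<^esub> f (t, w)" using lin c by blast
    then show ?thesis by (cases "f (s, v)"; cases "f (t, w)") (simp add: almost_abelian_simps)
  qed
  have "f (c \<odot>\<^bsub>?L\<^esub> (s, v)) = c \<odot>\<^bsub>?L'\<^esub> f (s, v)" using lin c by blast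
  then show "f (c * s, c \<cdot>\<^sub>v v) = (c * fst (f (s, v)), c \<cdot>\<^sub>v snd (f (s, v)))"
    by (cases "f (s, v)") (simp add: almost_abelian_simps)
qed

lemma linear_functional_vec:
  fixes g :: "real vec \<Rightarrow> real"
  assumes add: "\<And>v w. v \<in> carrier_vec d \<Longrightarrow> w \<in> carrier_vec d \<Longrightarrow> g (v + w) = g v + g w"
    and smult: "\<And>c v. v \<in> carrier_vec d \<Longrightarrow> g (c \<cdot>\<^sub>v v) = c * g v"
    and v: "v \<in> carrier_vec d"
  shows "g v = vec d (\<lambda>i. g (unit_vec d i)) \<bullet> v"
proof -
  \<comment> \<open>Induction on the number \<open>k\<close> of leading coordinates of
    \<open>v\<close> that are kept.\<close>
  have "g (vec d (\<lambda>i. if i < k then v $ i else 0)) = (\<Sum>i<k. v $ i * g (unit_vec d i))" if "k \<le> d" for k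
    using that
  proof (induction k)
    case 0
    have "vec d (\<lambda>i. if i < 0 then v $ i else 0) = 0 \<cdot>\<^sub>v v" using v by (intro eq_vecI) auto
    then show ?case using smult[OF v, of 0] by simp
  next
    case (Suc k)
    have "vec d (\<lambda>i. if i < Suc k then v $ i else 0) =
        vec d (\<lambda>i. if i < k then v $ i else 0) + v $ k \<cdot>\<^sub>v unit_vec d k"
      using Suc.prems by (intro eq_vecI) (auto simp: less_Suc_eq)
    then show ?case using Suc add smult by simp
  qed
  from this[of d] have "g (vec d (\<lambda>i. if i < d then v $ i else 0)) = (\<Sum>i<d. v $ i * g (unit_vec d i))" by simp
  moreover have "vec d (\<lambda>i. if i < d then v $ i else 0) = v" using v by (intro eq_vecI) auto
  ultimately show ?thesis using v by (simp add: scalar_prod_def mult.commute atLeast0LessThan)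
qed

lemma linear_map_vec_matrix:
  fixes F :: "real vec \<Rightarrow> real vec"
  assumes car: "\<And>v. v \<in> carrier_vec d \<Longrightarrow> F v \<in> carrier_vec e"
    and add: "\<And>v w. v \<in> carrier_vec d \<Longrightarrow> w \<in> carrier_vec d \<Longrightarrow> F (v + w) = F v + F w"
    and smult: "\<And>c v. v \<in> carrier_vec d \<Longrightarrow> F (c \<cdot>\<^sub>v v) = c \<cdot>\<^sub>v F v"
  obtains M where "M \<in> carrier_mat e d" "\<And>v. v \<in> carrier_vec d \<Longrightarrow> F v = M *\<^sub>v v"
proof
  let ?M = "mat e d (\<lambda>(i, j). F (unit_vec d j) $ i)"
  show "?M \<in> carrier_mat e d" by simp
  fix v :: "real vec" assume v: "v \<in> carrier_vec d"
  show "F v = ?M *\<^sub>v v"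
  proof (rule eq_vecI)
    fix i assume "i < dim_vec (?M *\<^sub>v v)"
    then have i: "i < e" by simp
    have "F v $ i = vec d (\<lambda>j. F (unit_vec d j) $ i) \<bullet> v"
      by (rule linear_functional_vec[of d "\<lambda>v. F v $ i", OF _ _ v])
        (use add smult carrier_vecD[OF car] i in auto)
    moreover have "row ?M i = vec d (\<lambda>j. F (unit_vec d j) $ i)" using i by (intro eq_vecI) auto
    ultimately show "F v $ i = (?M *\<^sub>v v) $ i" using i by simp
  qed (use car[OF v] in simp)
qed

lemma mat_eq_mult_vecI:
  fixes A B :: "'a :: comm_ring_1 mat"
  assumes A: "A \<in> carrier_mat n m" and B: "B \<in> carrier_mat n m"
    and eq: "\<And>v. v \<in> carrier_vec m \<Longrightarrow> A *\<^sub>v v = B *\<^sub>v v"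
  shows "A = B"
proof (rule eq_matI)
  fix i j assume "i < dim_row B" "j < dim_col B"
  then have ij: "i < n" "j < m" using B by auto
  have "(A *\<^sub>v unit_vec m j) $ i = (B *\<^sub>v unit_vec m j) $ i" using eq by simp
  then show "A $$ (i, j) = B $$ (i, j)" using ij A B by (simp add: scalar_prod_right_unit[of _ m])
qed (use A B in auto)

lemma smult_mat_mult_vec:
  fixes v :: "'a :: comm_ring_1 vec"
  assumes "dim_vec v = dim_col A"
  shows "(c \<cdot>\<^sub>m A) *\<^sub>v v = c \<cdot>\<^sub>v (A *\<^sub>v v)"
  using assms by (intro eq_vecI) (auto simp: scalar_prod_def sum_distrib_left mult.assoc)

lemma lie_isomorphic_of_similar:
  assumes A: "A \<in> carrier_mat d d" and B: "B \<in> carrier_mat d d" and c: "c \<noteq> 0"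
    and sim: "similar_mat A (c \<cdot>\<^sub>m B)"
  shows "lie_isomorphic (almost_abelian A) (almost_abelian B)"
proof -
  obtain P Q where wit: "similar_mat_wit A (c \<cdot>\<^sub>m B) P Q" using sim unfolding similar_mat_def by auto
  note w = similar_mat_witD2[OF A wit]
  have QA: "Q * A = c \<cdot>\<^sub>m (B * Q)"
  proof -
    have cB: "c \<cdot>\<^sub>m B \<in> carrier_mat d d" using B by simp
    have "Q * A = Q * (P * (c \<cdot>\<^sub>m B * Q))" using w(3) assoc_mult_mat[OF w(6) cB w(7)] by simp
    also have "\<dots> = Q * P * (c \<cdot>\<^sub>m B * Q)"
      by (rule assoc_mult_mat[OF w(7,6) mult_carrier_mat[OF cB w(7)], symmetric])
    also have "\<dots> = c \<cdot>\<^sub>m (B * Q)" unfolding w(2) using B w(7) by (simp add: mult_smult_assoc_mat[of _ d d])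
    finally show ?thesis .
  qed
  have QAv: "Q *\<^sub>v (A *\<^sub>v v) = c \<cdot>\<^sub>v (B *\<^sub>v (Q *\<^sub>v v))" if v: "v \<in> carrier_vec d" for v
  proof -
    have "Q *\<^sub>v (A *\<^sub>v v) = c \<cdot>\<^sub>m (B * Q) *\<^sub>v v" using w(7) A v by (simp flip: QA)
    also have "\<dots> = c \<cdot>\<^sub>v (B *\<^sub>v (Q *\<^sub>v v))"
      using B w(7) v by (simp add: smult_mat_mult_vec)
    finally show ?thesis .
  qed
  \<comment> \<open>Sending \<open>e0\<close> to \<open>c\<close> times \<open>e0\<close> absorbs
    the factor \<open>c\<close> of \<open>QA\<close>; on the ideal the map is the change of basis
    \<open>Q\<close>.\<close>
  define f where "f = (\<lambda>(s, v). (c * s, Q *\<^sub>v v))"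
  have [simp]: "dim_row A = d" "dim_row B = d" using A B by auto
  have Qc: "Q *\<^sub>v v \<in> carrier_vec d" if "v \<in> carrier_vec d" for v using w(7) that by simp
  have Pc: "P *\<^sub>v v \<in> carrier_vec d" if "v \<in> carrier_vec d" for v using w(6) that by simp
  have "linear_map class_ring (almost_abelian A) (almost_abelian B) f"
    unfolding linear_map_iff[OF almost_abelian_lie_algebra[OF A] almost_abelian_lie_algebra[OF B]]
    using w(7) by (auto simp: almost_abelian_simps f_def algebra_simps mult_add_distrib_mat_vec[of _ d d] mult_mat_vec[of _ d d])
  moreover have "bij_betw f (carrier (almost_abelian A)) (carrier (almost_abelian B))"
  proof (rule bij_betw_byWitness[where f' = "\<lambda>(s, v). (s / c, P *\<^sub>v v)"])
    have "P *\<^sub>v (Q *\<^sub>v v) = v" "Q *\<^sub>v (P *\<^sub>v v) = v" if "v \<in> carrier_vec d" for v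
      using w that by (simp_all flip: assoc_mult_mat_vec)
    then show "\<forall>x\<in>carrier (almost_abelian A). (case f x of (s, v) \<Rightarrow> (s / c, P *\<^sub>v v)) = x"
      "\<forall>x\<in>carrier (almost_abelian B). f (case x of (s, v) \<Rightarrow> (s / c, P *\<^sub>v v)) = x"
      using c by (auto simp: almost_abelian_simps f_def)
  qed (auto simp: almost_abelian_simps f_def Qc Pc)
  moreover have "f (lie_bracket (almost_abelian A) x y) = lie_bracket (almost_abelian B) (f x) (f y)"
    if "x \<in> carrier (almost_abelian A)" "y \<in> carrier (almost_abelian A)" for x y
  proof -
    obtain s v t u where x: "x = (s, v)" "y = (t, u)" "v \<in> carrier_vec d" "u \<in> carrier_vec d"
      using \<open>x \<in> _\<close> \<open>y \<in> _\<close> by (auto simp: almost_abelian_simps)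
    have Au: "A *\<^sub>v u \<in> carrier_vec d" "A *\<^sub>v v \<in> carrier_vec d" using A x by auto
    have "Q *\<^sub>v (s \<cdot>\<^sub>v (A *\<^sub>v u) - t \<cdot>\<^sub>v (A *\<^sub>v v)) = s \<cdot>\<^sub>v (Q *\<^sub>v (A *\<^sub>v u)) - t \<cdot>\<^sub>v (Q *\<^sub>v (A *\<^sub>v v))"
      using w(7) Au by (simp add: mult_minus_distrib_mat_vec[of _ d d] mult_mat_vec[of _ d d])
    also have "\<dots> = (c * s) \<cdot>\<^sub>v (B *\<^sub>v (Q *\<^sub>v u)) - (c * t) \<cdot>\<^sub>v (B *\<^sub>v (Q *\<^sub>v v))"
      unfolding QAv[OF x(3)] QAv[OF x(4)] by (simp add: smult_smult_assoc mult.commute)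
    finally show ?thesis by (simp add: x f_def almost_abelian_simps)
  qed
  ultimately show ?thesis unfolding lie_isomorphic_def by blast
qed

text \<open>Once an isomorphism is known to map the ideal \<open>R^d\<close> into itself, its
  restriction intertwines \<open>A\<close> with a multiple of \<open>B\<close>. Non-nilpotency of
  \<open>B\<close> serves to get there.\<close>

lemma similar_of_lie_isomorphic:
  assumes A: "A \<in> carrier_mat d d" and B: "B \<in> carrier_mat d d" and nil: "\<not> nilpotent_mat B"
    and iso: "lie_isomorphic (almost_abelian A) (almost_abelian B)"
  obtains c where "c \<noteq> 0" "similar_mat A (c \<cdot>\<^sub>m B)"
proof -
  let ?L = "almost_abelian A" and ?L' = "almost_abelian B"
  have [simp]: "dim_row A = d" "dim_row B = d" using A B by auto
  have cL: "x \<in> carrier ?L \<longleftrightarrow> snd x \<in> carrier_vec d" "x \<in> carrier ?L' \<longleftrightarrow> snd x \<in> carrier_vec d" for x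
    by (auto simp: almost_abelian_simps mem_Times_iff)
  obtain f where f: "linear_map class_ring ?L ?L' f" "bij_betw f (carrier ?L) (carrier ?L')"
    "\<And>x y. x \<in> carrier ?L \<Longrightarrow> y \<in> carrier ?L \<Longrightarrow> f (lie_bracket ?L x y) = lie_bracket ?L' (f x) (f y)"
    using iso unfolding lie_isomorphic_def by blast
  note fc = almost_abelian_linear_map(1)[OF A B f(1)] and fadd = almost_abelian_linear_map(2)[OF A B f(1)]
    and fsm = almost_abelian_linear_map(3)[OF A B f(1)]
  have surj: "\<exists>s v. v \<in> carrier_vec d \<and> f (s, v) = (t, w)" if "w \<in> carrier_vec d" for t w
  proof -
    have "(t, w) \<in> carrier ?L'" using that by (simp add: cL)
    then have "(t, w) \<in> f ` carrier ?L" using f(2) unfolding bij_betw_def by blast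
    then obtain p where "p \<in> carrier ?L" "(t, w) = f p" by blast
    then show ?thesis by (cases p) (auto simp: cL)
  qed
  have f0: "f (0, 0\<^sub>v d) = (0, 0\<^sub>v d)"
  proof -
    have "0 \<cdot>\<^sub>v u = 0\<^sub>v d" if "u \<in> carrier_vec d" for u :: "real vec"
      using that by (intro eq_vecI) auto
    then show ?thesis using fsm[of "0\<^sub>v d" 0 0] fc[of "0\<^sub>v d" 0] by simp
  qed
  have fst0: "fst (f (0, v)) = 0" if v: "v \<in> carrier_vec d" for v
  proof (rule ccontr)
    \<comment> \<open>\<open>ad (0, v)\<close> has square zero, while \<open>ad (s, z)\<close> acts on the abelian ideal as \<open>s B\<close>.\<close>
    obtain s z where fx: "f (0, v) = (s, z)" by (cases "f (0, v)")
    assume "fst (f (0, v)) \<noteq> 0"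
    then have s: "s \<noteq> 0" using fx by simp
    have "B *\<^sub>v (B *\<^sub>v u) = 0\<^sub>v d" if u: "u \<in> carrier_vec d" for u
    proof -
      obtain t w where y: "w \<in> carrier_vec d" "f (t, w) = (0, u)" using surj[OF u] by blast
      have z: "z \<in> carrier_vec d" using fc[OF v, of 0] fx by simp
      have Bc: "B *\<^sub>v u \<in> carrier_vec d" "B *\<^sub>v z \<in> carrier_vec d" "B *\<^sub>v (B *\<^sub>v u) \<in> carrier_vec d"
        "B *\<^sub>v (s \<cdot>\<^sub>v (B *\<^sub>v u)) \<in> carrier_vec d"
        using B u z by auto
      have Ac: "A *\<^sub>v w \<in> carrier_vec d" "A *\<^sub>v v \<in> carrier_vec d" "A *\<^sub>v (t \<cdot>\<^sub>v (A *\<^sub>v v)) \<in> carrier_vec d"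
        using A y v by auto
      let ?x = "(0, v)" and ?y = "(t, w)"
      have br1: "lie_bracket ?L ?x ?y = (0, - (t \<cdot>\<^sub>v (A *\<^sub>v v)))"
        using Ac by (simp add: almost_abelian_simps) (intro eq_vecI, auto)
      have "lie_bracket ?L ?x (lie_bracket ?L ?x ?y) = (0, 0\<^sub>v d)"
        unfolding br1 using A Ac by (simp add: almost_abelian_simps) (intro eq_vecI, auto)
      then have "f (lie_bracket ?L ?x (lie_bracket ?L ?x ?y)) = (0, 0\<^sub>v d)" using f0 by simp
      moreover have "f (lie_bracket ?L ?x (lie_bracket ?L ?x ?y)) =
          lie_bracket ?L' (f ?x) (lie_bracket ?L' (f ?x) (f ?y))"
        using v y Ac f(3)[of ?x ?y] f(3)[of ?x "lie_bracket ?L ?x ?y"] by (simp add: cL br1)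
      moreover have "lie_bracket ?L' (s, z) (0, u) = (0, s \<cdot>\<^sub>v (B *\<^sub>v u))"
        using Bc by (simp add: almost_abelian_simps)  (intro eq_vecI, auto)
      moreover have "lie_bracket ?L' (s, z) (0, s \<cdot>\<^sub>v (B *\<^sub>v u)) = (0, (s * s) \<cdot>\<^sub>v (B *\<^sub>v (B *\<^sub>v u)))"
        using B Bc by (simp add: almost_abelian_simps mult_mat_vec[OF B]) (intro eq_vecI, auto)
      ultimately have zz: "(s * s) \<cdot>\<^sub>v (B *\<^sub>v (B *\<^sub>v u)) = 0\<^sub>v d" unfolding fx y(2) by simp
      show ?thesis
      proof (rule eq_vecI)
        fix i assume "i < dim_vec (0\<^sub>v d :: real vec)"
        then have i: "i < d" by simp
        have "((s * s) \<cdot>\<^sub>v (B *\<^sub>v (B *\<^sub>v u))) $ i = 0" unfolding zz using i by simp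
        then show "(B *\<^sub>v (B *\<^sub>v u)) $ i = 0\<^sub>v d $ i" using i s Bc carrier_vecD[OF Bc(3)] by simp
      qed (use B in simp)
    qed
    note BB = this
    have "B * B = 0\<^sub>m d d"
    proof (rule mat_eq_mult_vecI)
      fix u :: "real vec" assume u: "u \<in> carrier_vec d"
      have "B * B *\<^sub>v u = B *\<^sub>v (B *\<^sub>v u)" by (rule assoc_mult_mat_vec[OF B B u])
      also have "\<dots> = 0\<^sub>v d" by (rule BB[OF u])
      also have "\<dots> = 0\<^sub>m d d *\<^sub>v u" using u by (intro eq_vecI) auto
      finally show "B * B *\<^sub>v u = 0\<^sub>m d d *\<^sub>v u" .
    qed (use mult_carrier_mat[OF B B] in auto)
    then have "B ^\<^sub>m 2 = 0\<^sub>m d d" using B by (simp add: numeral_2_eq_2)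
    then show False using nil unfolding nilpotent_mat_def by auto
  qed
  \<comment> \<open>\<open>F\<close> is the restriction to the ideal; below, \<open>c\<close> is the
    \<open>e0\<close>-component of the image of \<open>e0\<close>.\<close>
  obtain F where F: "F \<in> carrier_mat d d" and Fv: "\<And>v. v \<in> carrier_vec d \<Longrightarrow> snd (f (0, v)) = F *\<^sub>v v"
  proof (rule linear_map_vec_matrix[of d "\<lambda>v. snd (f (0, v))" d])
    fix v w :: "real vec" assume vw: "v \<in> carrier_vec d" "w \<in> carrier_vec d"
    show "snd (f (0, v)) \<in> carrier_vec d" by (rule fc[OF vw(1)])
    show "snd (f (0, v + w)) = snd (f (0, v)) + snd (f (0, w))" using fadd[OF vw, of 0 0] by simp
    show "snd (f (0, c \<cdot>\<^sub>v v)) = c \<cdot>\<^sub>v snd (f (0, v))" for c using fsm[OF vw(1), of c 0] by simp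
  qed blast
  have f0v: "f (0, v) = (0, F *\<^sub>v v)" if "v \<in> carrier_vec d" for v
    using fst0[OF that] Fv[OF that] by (simp add: prod_eq_iff)
  obtain c z where cz: "f (1, 0\<^sub>v d) = (c, z)" by (cases "f (1, 0\<^sub>v d)")
  have z: "z \<in> carrier_vec d" using fc[of "0\<^sub>v d" 1] cz by simp
  \<comment> \<open>Only \<open>e0\<close> contributes to the \<open>e0\<close>-component of images,
    and by surjectivity this component takes the value 1.\<close>
  have "c \<noteq> 0"
  proof -
    obtain s v where sv: "v \<in> carrier_vec d" "f (s, v) = (1, 0\<^sub>v d)" using surj[of "0\<^sub>v d" 1] by auto
    have z0: "s \<cdot>\<^sub>v 0\<^sub>v d = (0\<^sub>v d :: real vec)" by (intro eq_vecI) auto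
    have "f (s, v) = (s * c + 0, s \<cdot>\<^sub>v z + F *\<^sub>v v)"
      using fadd[of "s \<cdot>\<^sub>v 0\<^sub>v d" v "s * 1" 0] fsm[of "0\<^sub>v d" s 1] f0v[OF sv(1)] cz sv(1) by (simp add: z0)
    then show ?thesis using sv(2) by auto
  qed
  have "det F \<noteq> 0"
  proof
    assume "det F = 0"
    then obtain v where v: "v \<in> carrier_vec d" "v \<noteq> 0\<^sub>v d" "F *\<^sub>v v = 0\<^sub>v d"
      using det_0_iff_vec_prod_zero[OF F] by blast
    then have "f (0, v) = f (0, 0\<^sub>v d)" using f0v f0 by simp
    then have "(0, v) = (0 :: real, 0\<^sub>v d)"
      using inj_onD[OF bij_betw_imp_inj_on[OF f(2)], of "(0, v)" "(0, 0\<^sub>v d)"] v(1) by (simp add: cL)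
    then show False using v(2) by simp
  qed
  \<comment> \<open>The image of the bracket of \<open>e0\<close> with \<open>v\<close> is computed
    in both algebras. The component \<open>z\<close> of the image of \<open>e0\<close> lies in the
    abelian ideal and drops out.\<close>
  moreover have "c \<cdot>\<^sub>m B * F = F * A"
  proof (rule mat_eq_mult_vecI)
    show "c \<cdot>\<^sub>m B * F \<in> carrier_mat d d" by (rule mult_carrier_mat[OF smult_carrier_mat[OF B] F])
    show "F * A \<in> carrier_mat d d" by (rule mult_carrier_mat[OF F A])
    fix v :: "real vec" assume v: "v \<in> carrier_vec d"
    have Av: "A *\<^sub>v v \<in> carrier_vec d" "F *\<^sub>v v \<in> carrier_vec d" "B *\<^sub>v (F *\<^sub>v v) \<in> carrier_vec d"
      "B *\<^sub>v z \<in> carrier_vec d" using A B F v z by auto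
    have "lie_bracket ?L (1, 0\<^sub>v d) (0, v) = (0, A *\<^sub>v v)"
      using A Av v by (simp add: almost_abelian_simps) (intro eq_vecI, auto)
    moreover have "lie_bracket ?L' (c, z) (0, F *\<^sub>v v) = (0, c \<cdot>\<^sub>v (B *\<^sub>v (F *\<^sub>v v)))"
      using Av by (simp add: almost_abelian_simps) (intro eq_vecI, auto)
    ultimately have "F *\<^sub>v (A *\<^sub>v v) = c \<cdot>\<^sub>v (B *\<^sub>v (F *\<^sub>v v))"
      using f(3)[of "(1, 0\<^sub>v d)" "(0, v)"] f0v[OF v] f0v[OF Av(1)] cz v by (simp add: cL)
    moreover have "c \<cdot>\<^sub>m B * F *\<^sub>v v = c \<cdot>\<^sub>v (B *\<^sub>v (F *\<^sub>v v))"
    proof -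
      have "c \<cdot>\<^sub>m B * F *\<^sub>v v = c \<cdot>\<^sub>m B *\<^sub>v (F *\<^sub>v v)" using B F v by (simp add: assoc_mult_mat_vec[of _ d d])
      then show ?thesis using B F by (simp add: smult_mat_mult_vec)
    qed
    ultimately show "c \<cdot>\<^sub>m B * F *\<^sub>v v = F * A *\<^sub>v v" using F A v by simp
  qed
  ultimately have "similar_mat (c \<cdot>\<^sub>m B) A"
    using A B F by (intro similar_mat_intertwine[of _ d _ F]) auto
  then show thesis using that \<open>c \<noteq> 0\<close> similar_mat_sym by blast
qed

section \<open>A complex structure from a bordered matrix\<close>

lemma bordered_dim [simp]:
  "dim_row (bordered B v a) = Suc (dim_row B)" "dim_col (bordered B v a) = Suc (dim_col B)"
  by (simp_all add: bordered_def)

lemma bordered_mult_vec: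
  assumes B: "B \<in> carrier_mat n n" and u: "u \<in> carrier_mat n 1" and v: "v \<in> carrier_vec (Suc n)"
  shows "(bordered B u a *\<^sub>v v) $ n = a * v $ n"
    "i < n \<Longrightarrow> (bordered B u a *\<^sub>v v) $ i = row B i \<bullet> vec_first v n + u $$ (i, 0) * v $ n"
proof -
  let ?x = "vec_first v n" and ?y = "vec 1 (\<lambda>_. v $ n)"
  have v_eq: "v = ?x @\<^sub>v ?y" using v by (intro eq_vecI) (auto simp: vec_first_def less_Suc_eq)
  have eq: "bordered B u a *\<^sub>v v = (B *\<^sub>v ?x + u *\<^sub>v ?y) @\<^sub>v (0\<^sub>m 1 n *\<^sub>v ?x + jordan_block 1 a *\<^sub>v ?y)"
    unfolding bordered_def using B
    by (subst v_eq) (simp, rule four_block_mat_mult_vec[OF B u], auto)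
  show "(bordered B u a *\<^sub>v v) $ n = a * v $ n"
    unfolding eq using B u by (simp add: scalar_prod_def)
  show "(bordered B u a *\<^sub>v v) $ i = row B i \<bullet> vec_first v n + u $$ (i, 0) * v $ n" if "i < n"
    unfolding eq using B u that by (simp add: scalar_prod_def[of "row u i"])
qed

text \<open>On the hyperplane of vanishing last coordinate \<open>J\<close> commutes with the
  matrix. Off it, the failure to commute is the last coordinate times one fixed vector; in the
  integrability condition it enters with the products \<open>v $ n * w $ n\<close> in both orders
  and cancels.\<close>

lemma complex_structure_bordered:
  fixes B J v :: "real mat"
  assumes B: "B \<in> carrier_mat n n" and J: "J \<in> carrier_mat n n" and u: "u \<in> carrier_mat n 1"
    and JJ: "J * J = - 1\<^sub>m n" and com: "B * J = J * B"
  shows "\<exists>j. complex_structure (almost_abelian (bordered B u a)) j"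
proof -
  let ?M = "bordered B u a"
  let ?L = "almost_abelian ?M"
  let ?d = "Suc n"
  \<comment> \<open>\<open>J\<close> on the hyperplane, extended by 0 on the last basis vector
    \<open>e\<close>; so \<open>K\<close> squares to -1 only on the hyperplane.\<close>
  let ?K = "bordered J (0\<^sub>m n (Suc 0)) 0"
  let ?e = "unit_vec ?d n :: real vec"
  let ?m = "(*\<^sub>v) ?M" and ?k = "(*\<^sub>v) ?K"
  have M: "?M \<in> carrier_mat ?d ?d" and K: "?K \<in> carrier_mat ?d ?d" using B J by auto
  have Mc: "?m v \<in> carrier_vec ?d" and Kc: "?k v \<in> carrier_vec ?d" for v
    using carrier_matD[OF M] carrier_matD[OF K] by (auto simp: carrier_dim_vec)
  note dims = carrier_matD[OF B] carrier_matD[OF J]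
  have first: "vec_first (?k v) n = J *\<^sub>v vec_first v n" if "v \<in> carrier_vec ?d" for v
    using bordered_mult_vec(2)[OF J _ that, of "0\<^sub>m n (Suc 0)"] J by (intro eq_vecI) (auto simp: vec_first_def)
  have Kn: "(?k v) $ n = 0" if "v \<in> carrier_vec ?d" for v
    using bordered_mult_vec(1)[OF J _ that, of "0\<^sub>m n (Suc 0)" 0] by simp
  have Ki: "(?k v) $ i = (J *\<^sub>v vec_first v n) $ i" if "v \<in> carrier_vec ?d" "i < n" for v i
    using bordered_mult_vec(2)[OF J _ that, of "0\<^sub>m n (Suc 0)"] that J by simp
  have Mn: "(?m v) $ n = a * v $ n" if "v \<in> carrier_vec ?d" for v
    by (rule bordered_mult_vec(1)[OF B u that])
  have fc: "vec_first v n \<in> carrier_vec n" for v :: "real vec" by (simp add: vec_first_def)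
  have Ke: "?k ?e = 0\<^sub>v ?d"
  proof (rule eq_vecI)
    fix i assume i: "i < dim_vec (0\<^sub>v ?d :: real vec)"
    have "vec_first ?e n = 0\<^sub>v n" by (intro eq_vecI) (auto simp: vec_first_def)
    moreover have "J *\<^sub>v 0\<^sub>v n = 0\<^sub>v n" using J by (intro eq_vecI) auto
    ultimately show "(?k ?e) $ i = 0\<^sub>v ?d $ i"
      using i Ki[of ?e i] Kn[of ?e] by (cases "i = n") auto
  qed (simp add: dims)
  have KK: "?k (?k v) = (v $ n) \<cdot>\<^sub>v ?e - v" if v: "v \<in> carrier_vec ?d" for v
  proof (rule eq_vecI)
    fix i assume i: "i < dim_vec ((v $ n) \<cdot>\<^sub>v ?e - v)"
    then have i': "i < ?d" using v by simp
    have "J *\<^sub>v (J *\<^sub>v vec_first v n) = - vec_first v n"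
    proof -
      have "J *\<^sub>v (J *\<^sub>v vec_first v n) = - 1\<^sub>m n *\<^sub>v vec_first v n"
        using J fc[of v] by (simp flip: JJ)
      also have "\<dots> = - (1\<^sub>m n *\<^sub>v vec_first v n)" by (rule uminus_mult_mat_vec) (simp add: vec_first_def)
      finally show ?thesis using fc[of v] by simp
    qed
    note JJv = this
    show "(?k (?k v)) $ i = ((v $ n) \<cdot>\<^sub>v ?e - v) $ i"
    proof (cases "i = n")
      case True
      then show ?thesis using v Kn[OF Kc, of v] by simp
    next
      case False
      then have i: "i < n" using i' by simp
      have "(?k (?k v)) $ i = (- vec_first v n) $ i"
        unfolding Ki[OF Kc i] first[OF v] JJv ..
      then show ?thesis using i v by (simp add: vec_first_def)
    qed
  qed (use v in \<open>simp add: dims\<close>)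
  have Madd: "?m (v + w) = ?m v + ?m w" and Kadd: "?k (v + w) = ?k v + ?k w"
    and Msub: "?m (v - w) = ?m v - ?m w" and Ksub: "?k (v - w) = ?k v - ?k w"
    if "v \<in> carrier_vec ?d" "w \<in> carrier_vec ?d" for v w
    using that M K by (simp_all add: mult_add_distrib_mat_vec[of _ ?d ?d] mult_minus_distrib_mat_vec[of _ ?d ?d])
  have Msm: "?m (c \<cdot>\<^sub>v v) = c \<cdot>\<^sub>v (?m v)" and Ksm: "?k (c \<cdot>\<^sub>v v) = c \<cdot>\<^sub>v (?k v)"
    if "v \<in> carrier_vec ?d" for v c
    using that M K by (simp_all add: mult_mat_vec[of _ ?d ?d])
  have KM0: "?k (?m v) = ?m (?k v)" if v: "v \<in> carrier_vec ?d" and v0: "v $ n = 0" for v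
  proof (rule eq_vecI)
    fix i assume "i < dim_vec (?m (?k v))"
    then have i: "i < ?d" by (simp add: dims)
    have fM: "vec_first (?m v) n = B *\<^sub>v vec_first v n"
      using bordered_mult_vec(2)[OF B u v] v0 B by (intro eq_vecI) (auto simp: vec_first_def)
    have BJ: "J *\<^sub>v (B *\<^sub>v vec_first v n) = B *\<^sub>v (J *\<^sub>v vec_first v n)"
      using B J fc[of v] by (simp add: com flip: assoc_mult_mat_vec)
    show "(?k (?m v)) $ i = (?m (?k v)) $ i"
    proof (cases "i = n")
      case True
      then show ?thesis using Kn[OF Mc] Mn[OF Kc] Kn[OF v] by simp
    next
      case False
      then have i: "i < n" using i by simp
      show ?thesis
        using Ki[OF Mc i, of v] bordered_mult_vec(2)[OF B u Kc i, of a v] B i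
        by (simp add: fM BJ first[OF v] Kn[OF v])
    qed
  qed (simp add: dims)
  \<comment> \<open>Split off the multiple of \<open>e\<close>: the rest commutes by
    \<open>KM0\<close>, and since \<open>K\<close> kills \<open>e\<close>, the correction is a
    multiple of \<open>K (M e)\<close>.\<close>
  have KM: "?k (?m v) = ?m (?k v) + (v $ n) \<cdot>\<^sub>v (?k (?m ?e))"
    if v: "v \<in> carrier_vec ?d" for v
  proof -
    define w where "w = v - (v $ n) \<cdot>\<^sub>v ?e"
    have w: "w \<in> carrier_vec ?d" "w $ n = 0" using v by (auto simp: w_def)
    have v_eq: "v = w + (v $ n) \<cdot>\<^sub>v ?e" using v by (intro eq_vecI) (auto simp: w_def)
    have "?m v = ?m w + (v $ n) \<cdot>\<^sub>v (?m ?e)"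
      using v_eq Madd[OF w(1), of "(v $ n) \<cdot>\<^sub>v ?e"] Msm[of ?e "v $ n"] by simp
    then have "?k (?m v) = ?k (?m w) + (v $ n) \<cdot>\<^sub>v (?k (?m ?e))"
      using Kadd[OF Mc, of "(v $ n) \<cdot>\<^sub>v (?m ?e)" w] Ksm[OF Mc] Mc by simp
    moreover have "?k v = ?k w"
    proof -
      have "?k v = ?k w + (v $ n) \<cdot>\<^sub>v (?k ?e)"
        using v_eq Kadd[OF w(1), of "(v $ n) \<cdot>\<^sub>v ?e"] Ksm[of ?e "v $ n"] by simp
      moreover have "(v $ n) \<cdot>\<^sub>v 0\<^sub>v ?d = 0\<^sub>v ?d" by (intro eq_vecI) auto
      ultimately show ?thesis unfolding Ke using Kc[of w] by simp
    qed
    ultimately show ?thesis using KM0[OF w] by simp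
  qed
  \<comment> \<open>\<open>J\<close> on the hyperplane, and a quarter turn in the plane of
    \<open>e0\<close> and \<open>e\<close>: \<open>e\<close> goes to \<open>e0\<close>, and
    \<open>e0\<close> goes to minus \<open>e\<close>.\<close>
  define j where "j = (\<lambda>(s :: real, v). (v $ n, ?k v - s \<cdot>\<^sub>v ?e))"
  note L = almost_abelian_lie_algebra[OF M]
  note drow = bordered_dim(1) carrier_matD(1)[OF B]
  have jc: "?k v - s \<cdot>\<^sub>v ?e \<in> carrier_vec ?d" for v s using Kc by simp
  have lin: "linear_map class_ring ?L ?L j"
    unfolding linear_map_iff[OF L L]
  proof (intro conjI ballI allI)
    show "j \<in> carrier ?L \<rightarrow> carrier ?L" using jc by (auto simp: almost_abelian_simps drow j_def)
    fix x y assume "x \<in> carrier ?L" "y \<in> carrier ?L"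
    then obtain s v t w where x: "x = (s, v)" "y = (t, w)" "v \<in> carrier_vec ?d" "w \<in> carrier_vec ?d"
      by (auto simp: almost_abelian_simps drow)
    show "j (x \<oplus>\<^bsub>?L\<^esub> y) = j x \<oplus>\<^bsub>?L\<^esub> j y"
      using x Kadd[OF x(3,4)] carrier_vecD[OF Kc]
      by (auto simp: almost_abelian_simps j_def algebra_simps intro!: eq_vecI)
  next
    fix c x assume "x \<in> carrier ?L"
    then obtain s v where x: "x = (s, v)" "v \<in> carrier_vec ?d"
      by (auto simp: almost_abelian_simps drow)
    show "j (c \<odot>\<^bsub>?L\<^esub> x) = c \<odot>\<^bsub>?L\<^esub> j x"
      using x Ksm[OF x(2)] carrier_vecD[OF Kc]
      by (auto simp: almost_abelian_simps j_def algebra_simps intro!: eq_vecI)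
  qed
  have jj': "j (j (s, v)) = (- s, - v)" if v: "v \<in> carrier_vec ?d" for s v
  proof -
    have "?k (?k v - s \<cdot>\<^sub>v ?e) = (v $ n) \<cdot>\<^sub>v ?e - v"
    proof -
      have "?k (?k v - s \<cdot>\<^sub>v ?e) = ?k (?k v) - s \<cdot>\<^sub>v (?k ?e)"
        using Ksub[OF Kc, of "s \<cdot>\<^sub>v ?e" v] Ksm[of ?e s] by simp
      then show ?thesis unfolding Ke KK[OF v] using v by (intro eq_vecI) auto
    qed
    then show ?thesis using v Kn[OF v] Kc[of v] by (auto simp: j_def intro!: eq_vecI)
  qed
  have jj: "j (j x) = \<ominus>\<^bsub>?L\<^esub> x" if "x \<in> carrier ?L" for x
    using that jj' almost_abelian_uminus[OF M] by (cases x) (simp add: almost_abelian_simps drow)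
  have bij: "bij_betw j (carrier ?L) (carrier ?L)"
  proof (rule bij_betw_byWitness[where f' = "\<lambda>x. j (- fst x, - snd x)"])
    have neg: "- (- v) = v" for v :: "real vec" by (intro eq_vecI) auto
    have jneg: "j (- s, - v) = (- fst (j (s, v)), - snd (j (s, v)))" if v: "v \<in> carrier_vec ?d" for s v
    proof -
      have "- v = (- 1) \<cdot>\<^sub>v v" using v by (intro eq_vecI) auto
      then show ?thesis using v Ksm[OF v, of "- 1"] by (auto simp: j_def dims intro!: eq_vecI)
    qed
    have "j (- fst (j (s, v)), - snd (j (s, v))) = (s, v)" if v: "v \<in> carrier_vec ?d" for s v
    proof -
      have "snd (j (s, v)) \<in> carrier_vec ?d" using jc by (simp add: j_def)
      from jneg[OF this, of "fst (j (s, v))"] show ?thesis using jj'[OF v] neg by simp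
    qed
    then show "\<forall>x\<in>carrier ?L. j (- fst (j x), - snd (j x)) = x"
      by (simp add: almost_abelian_simps drow)
    show "\<forall>x\<in>carrier ?L. j (j (- fst x, - snd x)) = x"
      using jj' neg by (simp add: almost_abelian_simps drow)
    show "j ` carrier ?L \<subseteq> carrier ?L" using jc by (auto simp: almost_abelian_simps drow j_def)
    show "(\<lambda>x. j (- fst x, - snd x)) ` carrier ?L \<subseteq> carrier ?L"
      using jc by (auto simp: almost_abelian_simps drow j_def)
  qed
  have nij: "lie_bracket ?L x y
        \<oplus>\<^bsub>?L\<^esub> j (lie_bracket ?L (j x) y \<oplus>\<^bsub>?L\<^esub> lie_bracket ?L x (j y))
        \<ominus>\<^bsub>?L\<^esub> lie_bracket ?L (j x) (j y) = \<zero>\<^bsub>?L\<^esub>"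
    if xy: "x \<in> carrier ?L" "y \<in> carrier ?L" for x y
  proof -
    obtain s v t w where x: "x = (s, v)" "y = (t, w)" and v: "v \<in> carrier_vec ?d" and w: "w \<in> carrier_vec ?d"
      using xy by (auto simp: almost_abelian_simps drow)
    define Mv where "Mv = ?m v" define Mw where "Mw = ?m w" define Me where "Me = ?m ?e"
    define MKv where "MKv = ?m (?k v)" define MKw where "MKw = ?m (?k w)"
    define KMe where "KMe = ?k Me"
    have car: "Mv \<in> carrier_vec ?d" "Mw \<in> carrier_vec ?d" "Me \<in> carrier_vec ?d" "MKv \<in> carrier_vec ?d"
      "MKw \<in> carrier_vec ?d" "KMe \<in> carrier_vec ?d"
      unfolding Mv_def Mw_def Me_def MKv_def MKw_def KMe_def by (rule Mc Kc)+
    note dv = carrier_vecD[OF car(1)] carrier_vecD[OF car(2)] carrier_vecD[OF car(3)]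
      carrier_vecD[OF car(4)] carrier_vecD[OF car(5)] carrier_vecD[OF car(6)]
    have MJ: "?m (?k v - s \<cdot>\<^sub>v ?e) = MKv - s \<cdot>\<^sub>v Me" "?m (?k w - t \<cdot>\<^sub>v ?e) = MKw - t \<cdot>\<^sub>v Me"
      unfolding MKv_def MKw_def Me_def
      using Msub[OF Kc, of "s \<cdot>\<^sub>v ?e" v] Msub[OF Kc, of "t \<cdot>\<^sub>v ?e" w] Msm[of ?e] by auto
    have KMv: "?k Mv = MKv + (v $ n) \<cdot>\<^sub>v KMe" and KMw: "?k Mw = MKw + (w $ n) \<cdot>\<^sub>v KMe"
      unfolding Mv_def Mw_def MKv_def MKw_def KMe_def Me_def by (rule KM[OF v] KM[OF w])+
    have KMK: "?k (?m (?k z)) = (z $ n) \<cdot>\<^sub>v Me - ?m z" if z: "z \<in> carrier_vec ?d" for z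
    proof -
      have "?k (?m (?k z)) = ?m (?k (?k z))" by (rule KM0[OF Kc Kn[OF z]])
      then show ?thesis unfolding KK[OF z] Me_def using Msub[of "(z $ n) \<cdot>\<^sub>v ?e" z] Msm[of ?e] z by simp
    qed
    have KMKv: "?k MKv = (v $ n) \<cdot>\<^sub>v Me - Mv" and KMKw: "?k MKw = (w $ n) \<cdot>\<^sub>v Me - Mw"
      unfolding MKv_def MKw_def Mv_def Mw_def by (rule KMK[OF v] KMK[OF w])+
    have n: "Mv $ n = a * v $ n" "Mw $ n = a * w $ n" "MKv $ n = 0" "MKw $ n = 0"
      unfolding Mv_def Mw_def MKv_def MKw_def using Mn[OF v] Mn[OF w] Mn[OF Kc] Kn[OF v] Kn[OF w] by auto
    \<comment> \<open>The vector part of the sum of the two mixed brackets. The multiples of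
      \<open>M e\<close> cancel in it, and its last coordinate is 0, so its image under
      \<open>j\<close> has no \<open>e0\<close>-component.\<close>
    define z where "z = (v $ n) \<cdot>\<^sub>v Mw - (w $ n) \<cdot>\<^sub>v Mv + (s \<cdot>\<^sub>v MKw - t \<cdot>\<^sub>v MKv)"
    have z: "z \<in> carrier_vec ?d" unfolding z_def using car by simp
    have br: "lie_bracket ?L x y = (0, s \<cdot>\<^sub>v Mw - t \<cdot>\<^sub>v Mv)"
      by (simp add: x almost_abelian_simps Mv_def Mw_def)
    have brj: "lie_bracket ?L (j x) (j y) = (0, (v $ n) \<cdot>\<^sub>v (MKw - t \<cdot>\<^sub>v Me) - (w $ n) \<cdot>\<^sub>v (MKv - s \<cdot>\<^sub>v Me))"
      by (simp add: x j_def almost_abelian_simps MJ)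
    have sum: "lie_bracket ?L (j x) y \<oplus>\<^bsub>?L\<^esub> lie_bracket ?L x (j y) = (0, z)"
    proof -
      have "(v $ n) \<cdot>\<^sub>v Mw - t \<cdot>\<^sub>v (MKv - s \<cdot>\<^sub>v Me) + (s \<cdot>\<^sub>v (MKw - t \<cdot>\<^sub>v Me) - (w $ n) \<cdot>\<^sub>v Mv) = z"
        unfolding z_def using dv by (intro eq_vecI) (auto simp: algebra_simps)
      then show ?thesis by (simp add: x j_def almost_abelian_simps MJ flip: Mv_def Mw_def)
    qed
    have "z $ n = 0" unfolding z_def using dv n by simp
    moreover have "?k z = (v $ n) \<cdot>\<^sub>v (MKw + (w $ n) \<cdot>\<^sub>v KMe) - (w $ n) \<cdot>\<^sub>v (MKv + (v $ n) \<cdot>\<^sub>v KMe)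
        + (s \<cdot>\<^sub>v ((w $ n) \<cdot>\<^sub>v Me - Mw) - t \<cdot>\<^sub>v ((v $ n) \<cdot>\<^sub>v Me - Mv))"
      unfolding z_def using car by (simp add: Kadd Ksub Ksm KMv KMw KMKv KMKw)
    ultimately have jz: "j (0, z) = (0, (v $ n) \<cdot>\<^sub>v MKw - (w $ n) \<cdot>\<^sub>v MKv
        + (s \<cdot>\<^sub>v ((w $ n) \<cdot>\<^sub>v Me - Mw) - t \<cdot>\<^sub>v ((v $ n) \<cdot>\<^sub>v Me - Mv)))"
      unfolding j_def using dv by (auto simp: algebra_simps intro!: eq_vecI)
    have c: "(v $ n) \<cdot>\<^sub>v (MKw - t \<cdot>\<^sub>v Me) - (w $ n) \<cdot>\<^sub>v (MKv - s \<cdot>\<^sub>v Me) \<in> carrier_vec ?d"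
      using car by simp
    show ?thesis
      unfolding sum jz br brj a_minus_def almost_abelian_uminus[OF M c] almost_abelian_simps drow
      using dv by (auto simp: algebra_simps intro!: eq_vecI)
  qed
  show ?thesis using lin bij jj nij unfolding complex_structure_def by blast
qed

lemma complex_structure_of_complex_bordered:
  assumes A: "A \<in> carrier_mat d d" and "complex_bordered A"
  shows "\<exists>j. complex_structure (almost_abelian A) j"
proof -
  obtain n B J v a where B: "B \<in> carrier_mat n n" and J: "J \<in> carrier_mat n n" and v: "v \<in> carrier_mat n 1"
    and JJ: "J * J = - 1\<^sub>m n" "B * J = J * B" and sim: "similar_mat A (bordered B v a)"
    using assms(2) unfolding complex_bordered_def by blast
  let ?M = "bordered B v a"
  have M: "?M \<in> carrier_mat d d"
    using sim similar_mat_witD2(5)[OF A] unfolding similar_mat_def by blast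
  obtain j where j: "complex_structure (almost_abelian ?M) j"
    using complex_structure_bordered[OF B J v JJ] by blast
  have "1 \<cdot>\<^sub>m A = A" by (intro eq_matI) auto
  then have "lie_isomorphic (almost_abelian ?M) (almost_abelian A)"
    using lie_isomorphic_of_similar[OF M A, of 1] similar_mat_sym[OF sim] by simp
  then show ?thesis
    using complex_structure_transport[OF almost_abelian_lie_algebra[OF M] almost_abelian_lie_algebra[OF A] _ j] by blast
qed

section \<open>A bordered matrix from a complex structure\<close>

lemma bordered_of_last_row:
  fixes M :: "real mat"
  assumes M: "M \<in> carrier_mat (Suc m) (Suc m)"
    and last: "\<And>x. x \<in> carrier_vec m \<Longrightarrow> (M *\<^sub>v (x @\<^sub>v 0\<^sub>v 1)) $ m = 0"
  obtains B u c where "B \<in> carrier_mat m m" "u \<in> carrier_mat m 1" "M = bordered B u c"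
    "\<And>x. x \<in> carrier_vec m \<Longrightarrow> M *\<^sub>v (x @\<^sub>v 0\<^sub>v 1) = (B *\<^sub>v x) @\<^sub>v 0\<^sub>v 1"
proof
  let ?B = "mat m m (\<lambda>(i, j). M $$ (i, j))" and ?u = "mat m 1 (\<lambda>(i, j). M $$ (i, m))"
  show B: "?B \<in> carrier_mat m m" and u: "?u \<in> carrier_mat m 1" by auto
  have zero: "M $$ (m, j) = 0" if j: "j < m" for j
  proof -
    have "unit_vec m j @\<^sub>v 0\<^sub>v 1 = (unit_vec (Suc m) j :: real vec)" using j by (intro eq_vecI) auto
    moreover have "(M *\<^sub>v (unit_vec m j @\<^sub>v 0\<^sub>v 1)) $ m = 0" by (rule last) simp
    ultimately have "(M *\<^sub>v unit_vec (Suc m) j) $ m = 0" by (simp only:)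
    then show ?thesis using M j by (simp add: scalar_prod_right_unit[of _ "Suc m"])
  qed
  show M_eq: "M = bordered ?B ?u (M $$ (m, m))"
    using M zero unfolding bordered_def by (intro eq_matI) (auto simp: less_Suc_eq)
  fix x :: "real vec" assume x: "x \<in> carrier_vec m"
  let ?v = "x @\<^sub>v 0\<^sub>v 1"
  have v: "?v \<in> carrier_vec (Suc m)" using append_carrier_vec[OF x zero_carrier_vec[of 1]] by simp
  have fv: "vec_first ?v m = x" and vm: "?v $ m = 0"
    using x by (auto simp: vec_first_def intro!: eq_vecI)
  show "M *\<^sub>v ?v = (?B *\<^sub>v x) @\<^sub>v 0\<^sub>v 1"
  proof (rule eq_vecI)
    fix i assume "i < dim_vec ((?B *\<^sub>v x) @\<^sub>v 0\<^sub>v 1 :: real vec)"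
    then consider "i < m" | "i = m" by fastforce
    then show "(M *\<^sub>v ?v) $ i = ((?B *\<^sub>v x) @\<^sub>v 0\<^sub>v 1) $ i"
    proof cases
      case 1
      have "(M *\<^sub>v ?v) $ i = row ?B i \<bullet> vec_first ?v m + ?u $$ (i, 0) * ?v $ m"
        by (subst M_eq) (rule bordered_mult_vec(2)[OF B u v 1])
      also have "\<dots> = row ?B i \<bullet> x" unfolding fv vm by simp
      finally show ?thesis using 1 by simp
    next
      case 2
      then show ?thesis using last[OF x] by simp
    qed
  qed (use M in simp)
qed

text \<open>The covector \<open>a\<close> is completed to a basis of the dual space by coordinate
  functionals, leaving out one coordinate \<open>p\<close> on which \<open>a\<close> does not
  vanish. This allows any hyperplane to be moved to that of vanishing last coordinate.\<close>

lemma ex_invertible_last_row: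
  fixes a :: "real vec"
  assumes a: "a \<in> carrier_vec (Suc m)" and ne: "a \<noteq> 0\<^sub>v (Suc m)"
  obtains G H where "G \<in> carrier_mat (Suc m) (Suc m)" "H \<in> carrier_mat (Suc m) (Suc m)"
    "G * H = 1\<^sub>m (Suc m)" "H * G = 1\<^sub>m (Suc m)"
    "\<And>v. v \<in> carrier_vec (Suc m) \<Longrightarrow> (G *\<^sub>v v) $ m = a \<bullet> v"
proof -
  let ?d = "Suc m"
  obtain p where p: "p < ?d" "a $ p \<noteq> 0" using a ne by (metis carrier_vecD eq_vecI index_zero_vec)
  \<comment> \<open>On the indices below \<open>m\<close> this runs through all coordinates other
    than \<open>p\<close>: the last one takes the place of \<open>p\<close>.\<close>
  define \<sigma> where "\<sigma> i = (if i = p then m else i)" for i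
  define G where "G = mat ?d ?d (\<lambda>(i, j). if i = m then a $ j else if j = \<sigma> i then 1 else 0)"
  have G: "G \<in> carrier_mat ?d ?d" unfolding G_def by simp
  have row_m: "row G m = a" using a by (intro eq_vecI) (auto simp: G_def)
  have row_i: "row G i = unit_vec ?d (\<sigma> i)" if "i < m" for i
    using that by (intro eq_vecI) (auto simp: G_def unit_vec_def)
  have last: "(G *\<^sub>v v) $ m = a \<bullet> v" for v using G by (simp add: row_m)
  have "det G \<noteq> 0"
  proof
    assume "det G = 0"
    then obtain v where v: "v \<in> carrier_vec ?d" "v \<noteq> 0\<^sub>v ?d" "G *\<^sub>v v = 0\<^sub>v ?d"
      using det_0_iff_vec_prod_zero[OF G] by blast
    have zero: "v $ \<sigma> i = 0" if i: "i < m" for i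
    proof -
      have "\<sigma> i < ?d" using i p by (simp add: \<sigma>_def)
      moreover have "(G *\<^sub>v v) $ i = 0" unfolding v(3) using i by simp
      ultimately show ?thesis using i G v(1) by (simp add: row_i scalar_prod_left_unit[of _ ?d])
    qed
    have other: "v $ j = 0" if j: "j < ?d" "j \<noteq> p" for j
    proof (cases "j = m")
      case True
      then have "p < m" using p(1) j by simp
      then show ?thesis using zero[of p] True by (simp add: \<sigma>_def)
    next
      case False
      then show ?thesis using zero[of j] j by (simp add: \<sigma>_def)
    qed
    have "a \<bullet> v = (\<Sum>j = 0..<?d. a $ j * v $ j)" using v(1) by (simp add: scalar_prod_def)
    also have "\<dots> = (\<Sum>j = 0..<?d. if j = p then a $ p * v $ p else 0)"
      by (rule sum.cong) (auto simp: other)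
    also have "\<dots> = a $ p * v $ p" using p(1) by simp
    finally have "a $ p * v $ p = 0" using last[of v] v(3) by simp
    then have "v $ p = 0" using p(2) by simp
    then have "v $ j = 0" if "j < ?d" for j using other[OF that] by (cases "j = p") auto
    then have "v = 0\<^sub>v ?d" using v(1) by (intro eq_vecI) auto
    then show False using v(2) by simp
  qed
  from det_non_zero_imp_unit[OF G this, of "()"] obtain H where "H \<in> carrier_mat ?d ?d"
    "G * H = 1\<^sub>m ?d" "H * G = 1\<^sub>m ?d"
    by (auto simp: Units_def ring_mat_def)
  then show thesis using that G last by blast
qed

text \<open>In the coordinates given by \<open>G\<close> the hyperplane
  \<open>a \<bullet> v = 0\<close> becomes that of vanishing last coordinate, so invariance means
  that the last row is 0 off the corner. The relations are assumed on the hyperplane only, hence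
  they concern just the upper left blocks \<open>B\<close> and \<open>J\<close>.\<close>

lemma complex_bordered_of_hyperplane:
  fixes A K :: "real mat"
  assumes A: "A \<in> carrier_mat (Suc m) (Suc m)" and K: "K \<in> carrier_mat (Suc m) (Suc m)"
    and a: "a \<in> carrier_vec (Suc m)" "a \<noteq> 0\<^sub>v (Suc m)"
    and aK: "\<And>v. v \<in> carrier_vec (Suc m) \<Longrightarrow> a \<bullet> v = 0 \<Longrightarrow> a \<bullet> (K *\<^sub>v v) = 0"
    and aA: "\<And>v. v \<in> carrier_vec (Suc m) \<Longrightarrow> a \<bullet> v = 0 \<Longrightarrow> a \<bullet> (A *\<^sub>v v) = 0"
    and KK: "\<And>v. v \<in> carrier_vec (Suc m) \<Longrightarrow> a \<bullet> v = 0 \<Longrightarrow> K *\<^sub>v (K *\<^sub>v v) = - v"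
    and KA: "\<And>v. v \<in> carrier_vec (Suc m) \<Longrightarrow> a \<bullet> v = 0 \<Longrightarrow> K *\<^sub>v (A *\<^sub>v v) = A *\<^sub>v (K *\<^sub>v v)"
  shows "complex_bordered A"
proof -
  let ?d = "Suc m"
  obtain G H where G: "G \<in> carrier_mat ?d ?d" and H: "H \<in> carrier_mat ?d ?d"
    and GH: "G * H = 1\<^sub>m ?d" and HG: "H * G = 1\<^sub>m ?d"
    and last: "\<And>v. v \<in> carrier_vec ?d \<Longrightarrow> (G *\<^sub>v v) $ m = a \<bullet> v"
    using ex_invertible_last_row[OF a] by blast
  define A' where "A' = G * A * H"
  define K' where "K' = G * K * H"
  have A': "A' \<in> carrier_mat ?d ?d" and K': "K' \<in> carrier_mat ?d ?d"
    unfolding A'_def K'_def by (rule mult_carrier_mat[OF mult_carrier_mat[OF G A] H]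
        mult_carrier_mat[OF mult_carrier_mat[OF G K] H])+
  have mv: "X *\<^sub>v v \<in> carrier_vec ?d" if "X \<in> carrier_mat ?d ?d" for X :: "real mat" and v
    using carrier_matD(1)[OF that] by (simp add: carrier_dim_vec)
  have A'v: "A' *\<^sub>v (G *\<^sub>v v) = G *\<^sub>v (A *\<^sub>v v)" and K'v: "K' *\<^sub>v (G *\<^sub>v v) = G *\<^sub>v (K *\<^sub>v v)"
    if v: "v \<in> carrier_vec ?d" for v
  proof -
    have HGv: "H *\<^sub>v (G *\<^sub>v v) = v"
      using assoc_mult_mat_vec[OF H G v] HG v by simp
    have "X * H *\<^sub>v (G *\<^sub>v v) = X *\<^sub>v v" if "X \<in> carrier_mat ?d ?d" for X
      using assoc_mult_mat_vec[OF that H mv[OF G]] HGv by simp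
    then show "A' *\<^sub>v (G *\<^sub>v v) = G *\<^sub>v (A *\<^sub>v v)" "K' *\<^sub>v (G *\<^sub>v v) = G *\<^sub>v (K *\<^sub>v v)"
      unfolding A'_def K'_def using mult_carrier_mat[OF G A] mult_carrier_mat[OF G K]
        assoc_mult_mat_vec[OF G A v] assoc_mult_mat_vec[OF G K v] by simp_all
  qed
  have lift: "\<exists>v\<in>carrier_vec ?d. a \<bullet> v = 0 \<and> G *\<^sub>v v = x @\<^sub>v 0\<^sub>v 1" if x: "x \<in> carrier_vec m" for x
  proof -
    let ?w = "x @\<^sub>v 0\<^sub>v 1"
    have w: "?w \<in> carrier_vec ?d" using append_carrier_vec[OF x zero_carrier_vec[of 1]] by simp
    have Gw: "G *\<^sub>v (H *\<^sub>v ?w) = ?w" using assoc_mult_mat_vec[OF G H w] GH w by simp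
    have "a \<bullet> (H *\<^sub>v ?w) = ?w $ m" using last[OF mv[OF H], of ?w] Gw by simp
    also have "\<dots> = 0" using x by simp
    finally show ?thesis using mv[OF H] Gw by blast
  qed
  have lastA: "(A' *\<^sub>v (x @\<^sub>v 0\<^sub>v 1)) $ m = 0" and lastK: "(K' *\<^sub>v (x @\<^sub>v 0\<^sub>v 1)) $ m = 0"
    if x: "x \<in> carrier_vec m" for x
  proof -
    obtain v where v: "v \<in> carrier_vec ?d" "a \<bullet> v = 0" "G *\<^sub>v v = x @\<^sub>v 0\<^sub>v 1" using lift[OF x] by blast
    show "(A' *\<^sub>v (x @\<^sub>v 0\<^sub>v 1)) $ m = 0" "(K' *\<^sub>v (x @\<^sub>v 0\<^sub>v 1)) $ m = 0"
      unfolding v(3)[symmetric] A'v[OF v(1)] K'v[OF v(1)] last[OF mv[OF A]] last[OF mv[OF K]]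
      by (rule aA[OF v(1,2)] aK[OF v(1,2)])+
  qed
  obtain B u c where B: "B \<in> carrier_mat m m" and u: "u \<in> carrier_mat m 1" and A'_eq: "A' = bordered B u c"
    and Bx: "\<And>x. x \<in> carrier_vec m \<Longrightarrow> A' *\<^sub>v (x @\<^sub>v 0\<^sub>v 1) = (B *\<^sub>v x) @\<^sub>v 0\<^sub>v 1"
    using bordered_of_last_row[OF A' lastA] by blast
  obtain J u' c' where J: "J \<in> carrier_mat m m" and u': "u' \<in> carrier_mat m 1" and K'_eq: "K' = bordered J u' c'"
    and Jx: "\<And>x. x \<in> carrier_vec m \<Longrightarrow> K' *\<^sub>v (x @\<^sub>v 0\<^sub>v 1) = (J *\<^sub>v x) @\<^sub>v 0\<^sub>v 1"
    using bordered_of_last_row[OF K' lastK] by blast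
  have mv': "X *\<^sub>v v \<in> carrier_vec m" if "X \<in> carrier_mat m m" for X :: "real mat" and v
    using carrier_matD(1)[OF that] by (simp add: carrier_dim_vec)
  have JJ: "J * J = - 1\<^sub>m m"
  proof (rule mat_eq_mult_vecI)
    show "J * J \<in> carrier_mat m m" by (rule mult_carrier_mat[OF J J])
    show "- 1\<^sub>m m \<in> carrier_mat m m" by simp
    fix x :: "real vec" assume x: "x \<in> carrier_vec m"
    obtain v where v: "v \<in> carrier_vec ?d" "a \<bullet> v = 0" "G *\<^sub>v v = x @\<^sub>v 0\<^sub>v 1" using lift[OF x] by blast
    have "(J *\<^sub>v (J *\<^sub>v x)) @\<^sub>v 0\<^sub>v 1 = K' *\<^sub>v (K' *\<^sub>v (x @\<^sub>v 0\<^sub>v 1))"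
      using Jx[OF x] Jx[OF mv'[OF J]] by simp
    also have "\<dots> = G *\<^sub>v (K *\<^sub>v (K *\<^sub>v v))"
      unfolding v(3)[symmetric] K'v[OF v(1)] K'v[OF mv[OF K]] ..
    also have "\<dots> = G *\<^sub>v (- v)" using KK[OF v(1,2)] by simp
    also have "\<dots> = - (x @\<^sub>v 0\<^sub>v 1)" 
    proof -
      have neg: "- z = (- 1) \<cdot>\<^sub>v z" for z :: "real vec" by (intro eq_vecI) auto
      show ?thesis unfolding neg v(3)[symmetric] by (rule mult_mat_vec[OF G v(1)])
    qed
    also have "\<dots> = (- x) @\<^sub>v 0\<^sub>v 1" using x by (intro eq_vecI) auto
    finally have "J *\<^sub>v (J *\<^sub>v x) = - x" using mv'[OF J] x by (metis append_vec_eq uminus_carrier_vec)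
    moreover have "- 1\<^sub>m m *\<^sub>v x = - x" using uminus_mult_mat_vec[of x "1\<^sub>m m"] x by simp
    ultimately show "J * J *\<^sub>v x = - 1\<^sub>m m *\<^sub>v x" using assoc_mult_mat_vec[OF J J x] by simp
  qed
  have BJ: "B * J = J * B"
  proof (rule mat_eq_mult_vecI)
    show "B * J \<in> carrier_mat m m" by (rule mult_carrier_mat[OF B J])
    show "J * B \<in> carrier_mat m m" by (rule mult_carrier_mat[OF J B])
    fix x :: "real vec" assume x: "x \<in> carrier_vec m"
    obtain v where v: "v \<in> carrier_vec ?d" "a \<bullet> v = 0" "G *\<^sub>v v = x @\<^sub>v 0\<^sub>v 1" using lift[OF x] by blast
    have "(B *\<^sub>v (J *\<^sub>v x)) @\<^sub>v 0\<^sub>v 1 = A' *\<^sub>v (K' *\<^sub>v (x @\<^sub>v 0\<^sub>v 1))"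
      using Jx[OF x] Bx[OF mv'[OF J]] by simp
    also have "\<dots> = G *\<^sub>v (A *\<^sub>v (K *\<^sub>v v))"
      unfolding v(3)[symmetric] K'v[OF v(1)] A'v[OF mv[OF K]] ..
    also have "\<dots> = G *\<^sub>v (K *\<^sub>v (A *\<^sub>v v))" using KA[OF v(1,2)] by simp
    also have "\<dots> = K' *\<^sub>v (A' *\<^sub>v (x @\<^sub>v 0\<^sub>v 1))"
      unfolding v(3)[symmetric] A'v[OF v(1)] K'v[OF mv[OF A]] ..
    also have "\<dots> = (J *\<^sub>v (B *\<^sub>v x)) @\<^sub>v 0\<^sub>v 1"
      using Bx[OF x] Jx[OF mv'[OF B]] by simp
    finally have "B *\<^sub>v (J *\<^sub>v x) = J *\<^sub>v (B *\<^sub>v x)" using mv'[OF B] mv'[OF J] by (metis append_vec_eq)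
    then show "B * J *\<^sub>v x = J * B *\<^sub>v x"
      using assoc_mult_mat_vec[OF B J x] assoc_mult_mat_vec[OF J B x] by simp
  qed
  have "similar_mat_wit A' A G H" by (rule similar_mat_witI[OF GH HG A'_def A' A G H])
  then have "similar_mat A (bordered B u c)"
    using similar_mat_sym unfolding A'_eq[symmetric] similar_mat_def by metis
  then show ?thesis unfolding complex_bordered_def using B J u JJ BJ by blast
qed

text \<open>On the ideal, \<open>j\<close> sends \<open>v\<close> to the pair of
  \<open>a \<bullet> v\<close> and \<open>K v\<close>, and the kernel of \<open>a\<close> is the
  part of the ideal that \<open>j\<close> keeps in it. Take \<open>w\<close> in the ideal with
  \<open>a \<bullet> w = t\<close> nonzero and \<open>v\<close> in that kernel: in the integrability
  condition only the two brackets with \<open>j w\<close> survive, so \<open>j\<close> sends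
  \<open>t A v\<close> to \<open>t A K v\<close>. Comparing components gives invariance and
  commutation.\<close>

lemma complex_bordered_of_complex_structure:
  assumes A: "A \<in> carrier_mat d d" and d: "odd d" and j: "complex_structure (almost_abelian A) j"
  shows "complex_bordered A"
proof -
  let ?L = "almost_abelian A"
  note L = almost_abelian_lie_algebra[OF A]
  have [simp]: "dim_row A = d" using A by simp
  have cL: "x \<in> carrier ?L \<longleftrightarrow> snd x \<in> carrier_vec d" for x
    by (auto simp: almost_abelian_simps mem_Times_iff)
  have jl: "linear_map class_ring ?L ?L j"
    and jj: "\<And>x. x \<in> carrier ?L \<Longrightarrow> j (j x) = \<ominus>\<^bsub>?L\<^esub> x"
    and jn: "\<And>x y. x \<in> carrier ?L \<Longrightarrow> y \<in> carrier ?L \<Longrightarrow> lie_bracket ?L x y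
        \<oplus>\<^bsub>?L\<^esub> j (lie_bracket ?L (j x) y \<oplus>\<^bsub>?L\<^esub> lie_bracket ?L x (j y))
        \<ominus>\<^bsub>?L\<^esub> lie_bracket ?L (j x) (j y) = \<zero>\<^bsub>?L\<^esub>"
    using j unfolding complex_structure_def by auto
  note lin = almost_abelian_linear_map[OF A A jl]
  have jc: "snd (j (0, v)) \<in> carrier_vec d" if "v \<in> carrier_vec d" for v
    using lin(1)[OF that] .
  have jadd: "j (0, v + w) = (fst (j (0, v)) + fst (j (0, w)), snd (j (0, v)) + snd (j (0, w)))"
    if "v \<in> carrier_vec d" "w \<in> carrier_vec d" for v w
    using lin(2)[OF that, of 0 0] by simp
  have jsm: "j (0, c \<cdot>\<^sub>v v) = (c * fst (j (0, v)), c \<cdot>\<^sub>v snd (j (0, v)))"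
    if "v \<in> carrier_vec d" for c v
    using lin(3)[OF that, of c 0] by simp
  obtain K where K: "K \<in> carrier_mat d d" and Kv: "\<And>v. v \<in> carrier_vec d \<Longrightarrow> snd (j (0, v)) = K *\<^sub>v v"
    by (rule linear_map_vec_matrix[of d "\<lambda>v. snd (j (0, v))" d]) (use jc jadd jsm in auto)
  define a where "a = vec d (\<lambda>i. fst (j (0, unit_vec d i)))"
  have a: "a \<in> carrier_vec d" by (simp add: a_def)
  have av: "fst (j (0, v)) = a \<bullet> v" if "v \<in> carrier_vec d" for v
    unfolding a_def by (rule linear_functional_vec[of d "\<lambda>v. fst (j (0, v))", OF _ _ that]) (use jadd jsm in auto)
  have jv: "j (0, v) = (a \<bullet> v, K *\<^sub>v v)" if "v \<in> carrier_vec d" for v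
    using av[OF that] Kv[OF that] by (simp add: prod_eq_iff)
  have Kc: "K *\<^sub>v v \<in> carrier_vec d" and Ac: "A *\<^sub>v v \<in> carrier_vec d" for v
    using carrier_matD(1)[OF K] by (simp_all add: carrier_dim_vec)
  have K0: "a \<bullet> (K *\<^sub>v v) = 0" "K *\<^sub>v (K *\<^sub>v v) = - v" if v: "v \<in> carrier_vec d" and v0: "a \<bullet> v = 0" for v
  proof -
    have "j (j (0, v)) = (0, - v)" using jj[of "(0, v)"] almost_abelian_uminus[OF A v, of 0] v by (simp add: cL)
    moreover have "j (j (0, v)) = (a \<bullet> (K *\<^sub>v v), K *\<^sub>v (K *\<^sub>v v))" using jv[OF v] jv[OF Kc] v0 by simp
    ultimately show "a \<bullet> (K *\<^sub>v v) = 0" "K *\<^sub>v (K *\<^sub>v v) = - v" by auto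
  qed
  have ne: "a \<noteq> 0\<^sub>v d"
  proof
    assume "a = 0\<^sub>v d"
    then have KKv: "K *\<^sub>v (K *\<^sub>v v) = - v" if "v \<in> carrier_vec d" for v using K0(2)[OF that] that by simp
    have "K * K = - 1\<^sub>m d"
    proof (rule mat_eq_mult_vecI)
      show "K * K \<in> carrier_mat d d" by (rule mult_carrier_mat[OF K K])
      show "- 1\<^sub>m d \<in> carrier_mat d d" by simp
      fix v :: "real vec" assume v: "v \<in> carrier_vec d"
      have "- 1\<^sub>m d *\<^sub>v v = - v" using uminus_mult_mat_vec[of v "1\<^sub>m d"] v by simp
      then show "K * K *\<^sub>v v = - 1\<^sub>m d *\<^sub>v v" using assoc_mult_mat_vec[OF K K v] KKv[OF v] by simp
    qed
    then obtain r where "d = 2 * r" using real_blocks_complex_structure[OF K] by blast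
    then show False using d by simp
  qed
  then obtain p where p: "p < d" "a $ p \<noteq> 0" using a by (metis carrier_vecD eq_vecI index_zero_vec)
  define w where "w = (unit_vec d p :: real vec)"
  define t where "t = a $ p"
  have w: "w \<in> carrier_vec d" and aw: "a \<bullet> w = t" and t: "t \<noteq> 0"
    using p a by (simp_all add: w_def t_def scalar_prod_right_unit[of _ d])
  have A0: "a \<bullet> (A *\<^sub>v v) = 0 \<and> K *\<^sub>v (A *\<^sub>v v) = A *\<^sub>v (K *\<^sub>v v)"
    if v: "v \<in> carrier_vec d" and v0: "a \<bullet> v = 0" for v
  proof -
    have jw: "j (0, w) = (t, K *\<^sub>v w)" using jv[OF w] aw by simp
    have jv0: "j (0, v) = (0, K *\<^sub>v v)" using jv[OF v] v0 by simp
    note dv = carrier_vecD[OF Ac[of v]] carrier_vecD[OF Ac[of w]] carrier_vecD[OF Ac[of "K *\<^sub>v v"]]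
      carrier_vecD[OF Ac[of "K *\<^sub>v w"]]
    have b1: "lie_bracket ?L (0, w) (0, v) = (0, 0\<^sub>v d)"
      by (simp add: almost_abelian_simps) (intro eq_vecI, auto)
    have b2: "lie_bracket ?L (j (0, w)) (0, v) = (0, t \<cdot>\<^sub>v (A *\<^sub>v v))"
      unfolding jw by (simp add: almost_abelian_simps) (intro eq_vecI, auto)
    have b3: "lie_bracket ?L (0, w) (j (0, v)) = (0, 0\<^sub>v d)"
      unfolding jv0 by (simp add: almost_abelian_simps) (intro eq_vecI, auto)
    have b4: "lie_bracket ?L (j (0, w)) (j (0, v)) = (0, t \<cdot>\<^sub>v (A *\<^sub>v (K *\<^sub>v v)))"
      unfolding jw jv0 by (simp add: almost_abelian_simps) (intro eq_vecI, auto)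
    have tc: "t \<cdot>\<^sub>v (A *\<^sub>v v) \<in> carrier_vec d" "t \<cdot>\<^sub>v (A *\<^sub>v (K *\<^sub>v v)) \<in> carrier_vec d" using Ac by auto
    have s1: "(0, t \<cdot>\<^sub>v (A *\<^sub>v v)) \<oplus>\<^bsub>?L\<^esub> (0, 0\<^sub>v d) = (0, t \<cdot>\<^sub>v (A *\<^sub>v v))"
      using tc by (simp add: almost_abelian_simps)
    have s2: "j (0, t \<cdot>\<^sub>v (A *\<^sub>v v)) = (t * (a \<bullet> (A *\<^sub>v v)), t \<cdot>\<^sub>v (K *\<^sub>v (A *\<^sub>v v)))"
      using jsm[OF Ac[of v], of t] jv[OF Ac[of v]] by simp
    have "(0, 0\<^sub>v d) \<oplus>\<^bsub>?L\<^esub> (t * (a \<bullet> (A *\<^sub>v v)), t \<cdot>\<^sub>v (K *\<^sub>v (A *\<^sub>v v)))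
        \<oplus>\<^bsub>?L\<^esub> (\<ominus>\<^bsub>?L\<^esub> (0, t \<cdot>\<^sub>v (A *\<^sub>v (K *\<^sub>v v)))) = \<zero>\<^bsub>?L\<^esub>"
      using jn[of "(0, w)" "(0, v)"] w v unfolding b1 b2 b3 b4 s1 s2 a_minus_def by (simp add: cL)
    then have e: "t * (a \<bullet> (A *\<^sub>v v)) = 0"
      "0\<^sub>v d + t \<cdot>\<^sub>v (K *\<^sub>v (A *\<^sub>v v)) + - (t \<cdot>\<^sub>v (A *\<^sub>v (K *\<^sub>v v))) = 0\<^sub>v d"
      unfolding almost_abelian_uminus[OF A tc(2)] almost_abelian_simps by auto
    have "K *\<^sub>v (A *\<^sub>v v) = A *\<^sub>v (K *\<^sub>v v)"
    proof (rule eq_vecI)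
      fix i assume "i < dim_vec (A *\<^sub>v (K *\<^sub>v v))"
      then have i: "i < d" by simp
      have "(0\<^sub>v d + t \<cdot>\<^sub>v (K *\<^sub>v (A *\<^sub>v v)) + - (t \<cdot>\<^sub>v (A *\<^sub>v (K *\<^sub>v v)))) $ i = 0"
        unfolding e(2) using i by simp
      moreover have "dim_vec (K *\<^sub>v (A *\<^sub>v v)) = d" by (rule carrier_vecD[OF Kc])
      ultimately have "t * (K *\<^sub>v (A *\<^sub>v v)) $ i = t * (A *\<^sub>v (K *\<^sub>v v)) $ i"
        using i dv(3) by (simp del: index_mult_mat_vec)
      then show "(K *\<^sub>v (A *\<^sub>v v)) $ i = (A *\<^sub>v (K *\<^sub>v v)) $ i" using t by simp
    qed (use carrier_matD[OF K] in simp)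
    then show ?thesis using e(1) t by simp
  qed
  obtain m where "d = Suc m" using p(1) by (cases d) auto
  then show ?thesis
    using complex_bordered_of_hyperplane[of A m K a] A K a ne K0 A0 by simp
qed

section \<open>Normal forms\<close>

lemma diag_block_mat_zero:
  "(\<And>A. A \<in> set As \<Longrightarrow> \<exists>n. A = 0\<^sub>m n n) \<Longrightarrow> \<exists>n. diag_block_mat As = 0\<^sub>m n n"
proof (induction As)
  case Nil
  show ?case by auto
next
  case (Cons A As)
  then obtain n m where "A = 0\<^sub>m n n" "diag_block_mat As = 0\<^sub>m m m" by force
  then have "diag_block_mat (A # As) = 0\<^sub>m (n + m) (n + m)" by simp
  then show ?case by blast
qed

text \<open>The total size is a crude exponent, but at least as large as each single block.\<close>

lemma jordan_matrix_nilpotent: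
  assumes "\<And>k a. (k, a) \<in> set xs \<Longrightarrow> a = (0 :: complex)"
  shows "jordan_matrix xs ^\<^sub>m sum_list (map fst xs) = 0\<^sub>m (sum_list (map fst xs)) (sum_list (map fst xs))"
proof -
  let ?s = "sum_list (map fst xs)"
  have "\<exists>n. B = 0\<^sub>m n n" if "B \<in> set (map (\<lambda>(n, a). jordan_block n a ^\<^sub>m ?s) xs)" for B
  proof -
    from that obtain k a where ka: "(k, a) \<in> set xs" "B = jordan_block k a ^\<^sub>m ?s" by auto
    have "k \<in> set (map fst xs)" using ka(1) by force
    then have "k \<le> ?s" by (rule member_le_sum_list) simp
    then have "jordan_block k (0 :: complex) ^\<^sub>m ?s = 0\<^sub>m k k"
      unfolding jordan_block_zero_pow by (intro eq_matI) auto
    then show ?thesis using ka assms[OF ka(1)] by blast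
  qed
  then obtain n where "jordan_matrix xs ^\<^sub>m ?s = 0\<^sub>m n n"
    unfolding jordan_matrix_pow using diag_block_mat_zero by blast
  moreover have "dim_row (jordan_matrix xs ^\<^sub>m ?s) = ?s" by (simp add: pow_mat_dim_square[OF jordan_matrix_carrier])
  ultimately show ?thesis by simp
qed

lemma nilpotent_mat_iff:
  assumes A: "A \<in> carrier_mat d d"
  shows "nilpotent_mat A \<longleftrightarrow> (\<forall>x\<in>#real_blocks A. snd x = 0)"
proof
  have cA: "cmat A \<in> carrier_mat d d" using A by simp
  have dA: "dim_row A = d" using A by simp
  {
    assume "nilpotent_mat A"
    then obtain k where k: "A ^\<^sub>m k = 0\<^sub>m d d" unfolding nilpotent_mat_def dA by blast
    show "\<forall>x\<in>#real_blocks A. snd x = 0"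
    proof
      fix x assume "x \<in># real_blocks A"
      then have "snd x \<in> spectrum (cmat A)"
        using spectrum_jordan_blocks[OF cA] by (simp add: real_blocks_def)
      then obtain v where v: "eigenvector (cmat A) v (snd x)"
        unfolding spectrum_def eigenvalue_def by auto
      then have vc: "v \<in> carrier_vec d" "v \<noteq> 0\<^sub>v d" using cA unfolding eigenvector_def by auto
      have "(cmat A ^\<^sub>m k) *\<^sub>v v = snd x ^ k \<cdot>\<^sub>v v" by (rule eigenvector_pow[OF cA v])
      moreover have "cmat A ^\<^sub>m k = cmat (A ^\<^sub>m k)" by (rule of_real_hom.mat_hom_pow[OF A, symmetric])
      moreover have "cmat (A ^\<^sub>m k) = 0\<^sub>m d d" unfolding k by (intro eq_matI) auto
      moreover have "0\<^sub>m d d *\<^sub>v v = 0\<^sub>v d" using vc by (intro eq_vecI) auto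
      ultimately have e: "snd x ^ k \<cdot>\<^sub>v v = 0\<^sub>v d" by simp
      obtain i where i: "i < d" "v $ i \<noteq> 0" using vc by (metis carrier_vecD eq_vecI index_zero_vec)
      have "(snd x ^ k \<cdot>\<^sub>v v) $ i = 0" unfolding e using i by simp
      then show "snd x = 0" using i vc by simp
    qed
  }
  assume zero: "\<forall>x\<in>#real_blocks A. snd x = 0"
  obtain xs where xs: "jordan_nf (cmat A) xs" "jordan_blocks (cmat A) = mset xs" using jordan_blocks_exE[OF cA] .
  let ?s = "sum_list (map fst xs)"
  have J0: "jordan_matrix xs ^\<^sub>m ?s = 0\<^sub>m ?s ?s"
    by (rule jordan_matrix_nilpotent) (use zero xs in \<open>force simp: real_blocks_def\<close>)
  obtain P Q where w: "similar_mat_wit (cmat A) (jordan_matrix xs) P Q"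
    using xs(1) unfolding jordan_nf_def similar_mat_def by blast
  note w' = similar_mat_witD2[OF cA w]
  have s: "?s = d" using carrier_matD(1)[OF w'(5)] by simp
  have "cmat A ^\<^sub>m ?s = P * (jordan_matrix xs ^\<^sub>m ?s) * Q" by (rule similar_mat_wit_pow_id[OF w])
  also have "jordan_matrix xs ^\<^sub>m ?s = 0\<^sub>m d d" using J0 s by simp
  also have "P * 0\<^sub>m d d * Q = 0\<^sub>m d d" using w'(6,7) by simp
  finally have "cmat A ^\<^sub>m d = 0\<^sub>m d d" unfolding s .
  moreover have "cmat (A ^\<^sub>m d) = cmat A ^\<^sub>m d" by (rule of_real_hom.mat_hom_pow[OF A])
  ultimately have z: "cmat (A ^\<^sub>m d) = 0\<^sub>m d d" by (simp only:)
  have "A ^\<^sub>m d = 0\<^sub>m d d"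
  proof (rule eq_matI)
    fix i j assume "i < dim_row (0\<^sub>m d d :: real mat)" "j < dim_col (0\<^sub>m d d :: real mat)"
    then have ij: "i < d" "j < d" by auto
    have "cmat (A ^\<^sub>m d) $$ (i, j) = 0" unfolding z using ij by simp
    then show "(A ^\<^sub>m d) $$ (i, j) = 0\<^sub>m d d $$ (i, j)" using ij carrier_matD[OF pow_carrier_mat[OF A, of d]] by simp
  qed (use carrier_matD[OF pow_carrier_mat[OF A, of d]] in auto)
  then show "nilpotent_mat A" unfolding nilpotent_mat_def dA by blast
qed

section \<open>Matrices with a prescribed block type\<close>

definition with_eigenvalue :: "complex \<Rightarrow> nat multiset \<Rightarrow> (nat \<times> complex) multiset" where
  "with_eigenvalue a S = image_mset (\<lambda>k. (k, a)) S"

lemma count_with_eigenvalue: "count (with_eigenvalue a S) (k, l) = (if l = a then count S k else 0)"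
  unfolding with_eigenvalue_def by (induction S) auto

lemma with_eigenvalue_inj: "with_eigenvalue a S = with_eigenvalue a T \<Longrightarrow> S = T"
  by (intro multiset_eqI) (metis count_with_eigenvalue)

text \<open>Here the scalar part is cut into blocks of size 1, which gives literally the shape
  demanded by \<open>jordan_part\<close>. By \<open>type_mat_Block\<close> and
  \<open>type_mat_Scalar\<close> the matrix is still the one used in
  \<open>has_block_type\<close>.\<close>

definition type_mat :: "real \<Rightarrow> block_type \<Rightarrow> real mat" where
  "type_mat b \<tau> = diag_block_mat (map (\<lambda>k. sub_jordan_block k b) (block_size_list \<tau>))"

lemma type_mat_carrier:
  assumes "\<tau> \<in> block_types m" shows "type_mat b \<tau> \<in> carrier_mat m m"
  using diag_sub_jordan_carrier[of b "block_size_list \<tau>"] sum_size_list[OF assms] by (simp add: type_mat_def)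

lemma real_blocks_type_mat:
  assumes "\<tau> \<in> block_types m"
  shows "real_blocks (type_mat b \<tau>) = with_eigenvalue (complex_of_real b) (block_sizes \<tau>)"
  unfolding type_mat_def with_eigenvalue_def block_sizes_def
  by (rule real_blocks_diag_sub_jordan) (use size_list_pos[OF assms] in blast)

lemma type_mat_Scalar: "type_mat b (Scalar_type m) = b \<cdot>\<^sub>m 1\<^sub>m m"
proof (induction m)
  case 0
  show ?case by (auto simp: type_mat_def)
next
  case (Suc m)
  have "type_mat b (Scalar_type (Suc m)) = diag_block_mat [sub_jordan_block 1 b, type_mat b (Scalar_type m)]"
    unfolding type_mat_def block_size_list.simps replicate_Suc list.map by (rule diag_block_mat_Cons)
  also have "\<dots> = four_block_mat (sub_jordan_block 1 b) (0\<^sub>m 1 m) (0\<^sub>m m 1) (b \<cdot>\<^sub>m 1\<^sub>m m)"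
    unfolding Suc by (rule diag_block_mat_two) auto
  also have "\<dots> = b \<cdot>\<^sub>m 1\<^sub>m (Suc m)"
    by (intro eq_matI) (auto simp: sub_jordan_block_def)
  finally show ?case .
qed

lemma type_mat_Block: "type_mat b (Block_type ns ps t) = block_type_mat b ns ps t"
proof -
  let ?f = "\<lambda>k. sub_jordan_block k b"
  let ?L = "concat (map2 (\<lambda>n p. replicate p n) ns ps)"
  have L: "map ?f ?L = concat (map2 (\<lambda>n p. replicate p (?f n)) ns ps)"
    by (simp add: map_concat o_def split_def)
  have R: "diag_block_mat (map ?f (replicate t 1)) = b \<cdot>\<^sub>m 1\<^sub>m t"
    using type_mat_Scalar[of b t] unfolding type_mat_def block_size_list.simps .
  have S: "diag_block_mat [b \<cdot>\<^sub>m 1\<^sub>m t] = b \<cdot>\<^sub>m 1\<^sub>m t" by (rule diag_block_mat_singleton)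
  have "type_mat b (Block_type ns ps t) = diag_block_mat [diag_block_mat (map ?f ?L), b \<cdot>\<^sub>m 1\<^sub>m t]"
    unfolding type_mat_def block_size_list.simps map_append
    by (subst diag_block_mat_append_two) (simp only: R)
  also have "\<dots> = block_type_mat b ns ps t"
    unfolding block_type_mat_def by (subst diag_block_mat_append_two) (simp only: L S)
  finally show ?thesis .
qed

text \<open>A scalar matrix commutes with every change of basis. Thus the equality that
  \<open>has_block_type\<close> asks for in the scalar case is the same as similarity.\<close>

lemma similar_scalar:
  fixes A :: "real mat"
  assumes A: "A \<in> carrier_mat m m" and sim: "similar_mat A (b \<cdot>\<^sub>m 1\<^sub>m m)"
  shows "A = b \<cdot>\<^sub>m 1\<^sub>m m"
proof -
  obtain P Q where "similar_mat_wit A (b \<cdot>\<^sub>m 1\<^sub>m m) P Q" using sim unfolding similar_mat_def by blast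
  note w = similar_mat_witD2[OF A this]
  have "P * (b \<cdot>\<^sub>m 1\<^sub>m m) = b \<cdot>\<^sub>m P" using w(6) mult_smult_distrib[of P m m "1\<^sub>m m" m b] by simp
  then have "A = b \<cdot>\<^sub>m (P * Q)" using w(3) mult_smult_assoc_mat[OF w(6,7), of b] by simp
  then show ?thesis using w(1) by simp
qed

lemma has_block_type_iff:
  assumes N: "N \<in> carrier_mat m m" and spec: "spec N = {complex_of_real b}"
  shows "has_block_type N \<tau> \<longleftrightarrow>
    \<tau> \<in> block_types m \<and> real_blocks N = with_eigenvalue (complex_of_real b) (block_sizes \<tau>)"
proof -
  have sim: "(case \<tau> of Scalar_type _ \<Rightarrow> N = b \<cdot>\<^sub>m 1\<^sub>m m | Block_type ns ps t \<Rightarrow> similar_mat N (block_type_mat b ns ps t))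
    \<longleftrightarrow> real_blocks N = with_eigenvalue (complex_of_real b) (block_sizes \<tau>)" if t: "\<tau> \<in> block_types m"
  proof -
    have "real_blocks N = with_eigenvalue (complex_of_real b) (block_sizes \<tau>) \<longleftrightarrow> similar_mat N (type_mat b \<tau>)"
      unfolding similar_iff_real_blocks[OF N type_mat_carrier[OF t]] real_blocks_type_mat[OF t] ..
    moreover have "similar_mat N (type_mat b (Scalar_type m)) \<longleftrightarrow> N = b \<cdot>\<^sub>m 1\<^sub>m m"
      unfolding type_mat_Scalar using similar_scalar[OF N] similar_mat_refl[OF N] by auto
    moreover have "\<tau> = Scalar_type m" if "\<tau> = Scalar_type k" for k
      using that t by (auto simp: block_types_def)
    ultimately show ?thesis by (cases \<tau>) (auto simp: type_mat_Block)
  qed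
  show ?thesis
  proof
    assume "has_block_type N \<tau>"
    then obtain m' b' where h: "N \<in> carrier_mat m' m'" "spec N = {complex_of_real b'}" "\<tau> \<in> block_types m'"
      "case \<tau> of Scalar_type _ \<Rightarrow> N = b' \<cdot>\<^sub>m 1\<^sub>m m' | Block_type ns ps t \<Rightarrow> similar_mat N (block_type_mat b' ns ps t)"
      unfolding has_block_type_def by blast
    have "m' = m" using h(1) N by auto
    moreover have "b' = b" using h(2) spec by simp
    ultimately show "\<tau> \<in> block_types m \<and> real_blocks N = with_eigenvalue (complex_of_real b) (block_sizes \<tau>)"
      using h sim by blast
  next
    assume "\<tau> \<in> block_types m \<and> real_blocks N = with_eigenvalue (complex_of_real b) (block_sizes \<tau>)"
    then show "has_block_type N \<tau>" unfolding has_block_type_def using N spec sim by blast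
  qed
qed

text \<open>Since \<open>m \<ge> 1\<close> the spectrum is not empty and pins down \<open>b\<close>;
  injectivity of \<open>block_sizes\<close> then makes the description in
  \<open>block_type_of\<close> unique.\<close>

lemma block_type_of_unique:
  assumes N: "N \<in> carrier_mat m m" and m: "m \<ge> 1" and t: "\<tau> \<in> block_types m"
    and rb: "real_blocks N = with_eigenvalue (complex_of_real b) (block_sizes \<tau>)"
  shows "\<Lambda> N = \<tau>"
proof -
  have "block_sizes \<tau> \<noteq> {#}" using real_blocks_size[OF N] m unfolding rb with_eigenvalue_def by auto
  then have "spec N = {complex_of_real b}"
    unfolding spec_real_blocks[OF N] rb with_eigenvalue_def by (simp add: image_image image_constant_conv)
  note iff = has_block_type_iff[OF N this]
  show ?thesis unfolding block_type_of_def
  proof (rule the_equality)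
    show "has_block_type N \<tau>" using iff t rb by blast
    fix \<upsilon> assume "has_block_type N \<upsilon>"
    then have "\<upsilon> \<in> block_types m" "with_eigenvalue (complex_of_real b) (block_sizes \<upsilon>) = with_eigenvalue (complex_of_real b) (block_sizes \<tau>)"
      using iff rb by auto
    then show "\<upsilon> = \<tau>" using block_sizes_inj t with_eigenvalue_inj by blast
  qed
qed

lemma block_type_of_jordan_part:
  assumes N: "N \<in> carrier_mat m m" and m: "m \<ge> 1" and jp: "jordan_part N b N"
  shows "\<Lambda> N \<in> block_types m \<and> real_blocks N = with_eigenvalue (complex_of_real b) (block_sizes (\<Lambda> N))"
proof -
  obtain ns where ns: "\<forall>k\<in>set ns. k \<ge> 1" "N = diag_block_mat (map (\<lambda>k. sub_jordan_block k b) ns)"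
    using jp unfolding jordan_part_def by blast
  then have rb: "real_blocks N = with_eigenvalue (complex_of_real b) (mset ns)"
    using real_blocks_diag_sub_jordan[OF ns(1)] by (simp add: with_eigenvalue_def)
  have "sum_mset (mset ns) = m"
    using real_blocks_size[OF N] unfolding rb with_eigenvalue_def by (simp add: multiset.map_comp o_def)
  then obtain \<tau> where t: "\<tau> \<in> block_types m" "block_sizes \<tau> = mset ns"
    using block_sizes_surj[of "mset ns" m] ns(1) by auto
  then show ?thesis using block_type_of_unique[OF N m t(1)] rb by simp
qed

lemma type_mat_jordan_part:
  assumes t: "\<tau> \<in> block_types m" and m: "m \<ge> 1"
  shows "jordan_part (type_mat b \<tau>) b (type_mat b \<tau>)" "\<Lambda> (type_mat b \<tau>) = \<tau>"
proof -
  note N = type_mat_carrier[OF t, of b]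
  have z: "(0\<^sub>m 0 0 :: real mat) \<in> carrier_mat 0 0" by simp
  \<comment> \<open>The complementary summand is taken to be the empty matrix.\<close>
  have "diag_block_mat [type_mat b \<tau>, 0\<^sub>m 0 0] = type_mat b \<tau>"
    unfolding diag_block_mat_two[OF N z] using N by (intro eq_matI) auto
  then have "similar_mat (type_mat b \<tau>) (diag_block_mat [type_mat b \<tau>, 0\<^sub>m 0 0])"
    using similar_mat_refl[OF N] by simp
  moreover have "complex_of_real b \<notin> spec (0\<^sub>m 0 0)" unfolding spec_real_blocks[OF z] real_blocks_empty by simp
  ultimately show "jordan_part (type_mat b \<tau>) b (type_mat b \<tau>)"
    unfolding jordan_part_def using z size_list_pos[OF t] type_mat_def by blast
  show "\<Lambda> (type_mat b \<tau>) = \<tau>" by (rule block_type_of_unique[OF N m t real_blocks_type_mat[OF t]])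
qed

section \<open>Rescaling of eigenvalues\<close>

definition scale_eigenvalues :: "real \<Rightarrow> (nat \<times> complex) multiset \<Rightarrow> (nat \<times> complex) multiset" where
  "scale_eigenvalues c S = image_mset (\<lambda>(k, a). (k, complex_of_real c * a)) S"

lemma count_scale_eigenvalues:
  assumes "c \<noteq> 0"
  shows "count (scale_eigenvalues c S) (k, l) = count S (k, l / complex_of_real c)"
  unfolding scale_eigenvalues_def by (induction S) (use assms in \<open>auto simp: field_simps\<close>)

lemma scale_eigenvalues_one: "scale_eigenvalues 1 S = S"
  unfolding scale_eigenvalues_def by (simp add: case_prod_unfold)

text \<open>The assumption means \<open>c = 1\<close> or \<open>b = 0\<close>. Stating it this way
  lets the cases \<open>b = 1\<close> and \<open>b = 0\<close> of the classification share their
  proofs.\<close>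

lemma scale_with_eigenvalue:
  assumes "c * b = b"
  shows "scale_eigenvalues c (with_eigenvalue (complex_of_real b) S) = with_eigenvalue (complex_of_real b) S"
proof -
  have cb: "complex_of_real c * complex_of_real b = complex_of_real b" using assms by (metis of_real_mult)
  show ?thesis
    unfolding scale_eigenvalues_def with_eigenvalue_def by (simp add: multiset.map_comp o_def cb)
qed

lemma odd_at_scale:
  assumes c: "c \<noteq> 0" and "odd_at S a q"
  shows "odd_at (scale_eigenvalues c S) (c * a) q"
proof -
  have "count (scale_eigenvalues c S) (k, complex_of_real l) = count S (k, complex_of_real (l / c))" for k l
    using count_scale_eigenvalues[OF c, of S k "complex_of_real l"] by simp
  moreover have "l / c = a \<longleftrightarrow> l = c * a" for l using c by (auto simp: field_simps)
  moreover have "odd (count S (k, complex_of_real (l / c))) \<longleftrightarrow> l / c = a \<and> (k = q \<or> Suc k = q)"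
    if "k \<ge> 1" for k l
    using assms(2) that unfolding odd_at_def by blast
  ultimately show ?thesis using assms(2) unfolding odd_at_def by metis
qed

lemma odd_at_unique: "odd_at S a q \<Longrightarrow> odd_at S b p \<Longrightarrow> a = b"
  unfolding odd_at_def by metis

lemma lie_iso_class_almost_abelian_eq_iff:
  assumes A: "A \<in> carrier_mat d d" and B: "B \<in> carrier_mat d d" and nil: "\<not> nilpotent_mat B"
  shows "lie_iso_class (almost_abelian A) = lie_iso_class (almost_abelian B) \<longleftrightarrow>
    (\<exists>c. c \<noteq> 0 \<and> real_blocks A = scale_eigenvalues c (real_blocks B))"
proof -
  have "similar_mat A (c \<cdot>\<^sub>m B) \<longleftrightarrow> real_blocks A = scale_eigenvalues c (real_blocks B)" if "c \<noteq> 0" for c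
    unfolding similar_iff_real_blocks[OF A smult_carrier_mat[OF B]] real_blocks_smult[OF B that]
      scale_eigenvalues_def ..
  moreover have "lie_isomorphic (almost_abelian A) (almost_abelian B) \<longleftrightarrow> (\<exists>c. c \<noteq> 0 \<and> similar_mat A (c \<cdot>\<^sub>m B))"
    using lie_isomorphic_of_similar[OF A B] similar_of_lie_isomorphic[OF A B nil] by metis
  ultimately show ?thesis
    unfolding lie_iso_class_eq_iff[OF almost_abelian_lie_algebra[OF A] almost_abelian_lie_algebra[OF B]] by blast
qed

lemma complex_structure_iff_odd_at:
  assumes A: "A \<in> carrier_mat d d" and d: "odd d"
  shows "(\<exists>j. complex_structure (almost_abelian A) j) \<longleftrightarrow> (\<exists>a q. odd_at (real_blocks A) a q)"
  using complex_bordered_of_complex_structure[OF A d] complex_structure_of_complex_bordered[OF A]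
    complex_bordered_iff_odd_at[OF A] by blast

text \<open>The common shape of all three forms: \<open>b = 1\<close> with \<open>r = 0\<close> and
  empty \<open>Q\<close> is the first, \<open>b = 1\<close> with \<open>r \<ge> 1\<close> the
  second, and \<open>b = 0\<close> with a further normalisation of \<open>Q\<close> the third. The
  Jordan part is taken of \<open>N\<close> itself, equivalent by
  \<open>jordan_part_dsum_iff\<close>.\<close>

definition normal_form :: "real \<Rightarrow> nat \<Rightarrow> nat \<Rightarrow> real mat \<Rightarrow> real mat \<Rightarrow> bool" where
  "normal_form b m r N Q \<longleftrightarrow> odd m \<and> N \<in> carrier_mat m m \<and> jordan_part N b N \<and>
    \<Lambda> N \<in> c_block_types m \<and> Q \<in> M_J r \<and> complex_of_real b \<notin> spec Q"

lemma M_J_carrier: "Q \<in> M_J r \<Longrightarrow> Q \<in> carrier_mat (2 * r) (2 * r)"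
  unfolding M_J_def by simp

lemma normal_form_carrier:
  "normal_form b m r N Q \<Longrightarrow> diag_block_mat [N, Q] \<in> carrier_mat (m + 2 * r) (m + 2 * r)"
  unfolding normal_form_def by (intro dsum_carrier M_J_carrier) auto

lemma normal_form_real_blocks:
  assumes "normal_form b m r N Q"
  shows "\<Lambda> N \<in> block_types m" "real_blocks N = with_eigenvalue (complex_of_real b) (block_sizes (\<Lambda> N))"
    "real_blocks (diag_block_mat [N, Q]) =
      with_eigenvalue (complex_of_real b) (block_sizes (\<Lambda> N)) + real_blocks Q"
    "\<And>x. x \<in># real_blocks Q \<Longrightarrow> snd x \<noteq> complex_of_real b"
proof -
  have N: "N \<in> carrier_mat m m" and m: "odd m" and jp: "jordan_part N b N" and Q: "Q \<in> carrier_mat (2 * r) (2 * r)"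
    and b: "complex_of_real b \<notin> spec Q"
    using assms M_J_carrier unfolding normal_form_def by auto
  have "m \<ge> 1" using m by presburger
  from block_type_of_jordan_part[OF N this jp]
  show "\<Lambda> N \<in> block_types m" "real_blocks N = with_eigenvalue (complex_of_real b) (block_sizes (\<Lambda> N))" by auto
  then show "real_blocks (diag_block_mat [N, Q]) =
      with_eigenvalue (complex_of_real b) (block_sizes (\<Lambda> N)) + real_blocks Q"
    using real_blocks_dsum[OF N Q] by simp
  show "\<And>x. x \<in># real_blocks Q \<Longrightarrow> snd x \<noteq> complex_of_real b"
    using b unfolding spec_real_blocks[OF Q] by force
qed

text \<open>\<open>Q\<close> contributes even multiplicities at real eigenvalues, so the parities
  are those of the block type of \<open>N\<close>.\<close>

lemma normal_form_odd_at:
  assumes nf: "normal_form b m r N Q"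
  shows "\<exists>q. odd_at (real_blocks (diag_block_mat [N, Q])) b q"
proof -
  have m: "odd m" and c: "\<Lambda> N \<in> c_block_types m" and Q: "Q \<in> M_J r"
    using nf unfolding normal_form_def by auto
  obtain q where q: "odd_sizes_at (block_sizes (\<Lambda> N)) q" using c c_block_types_iff[OF m] by blast
  have "odd (count (real_blocks (diag_block_mat [N, Q])) (k, complex_of_real l)) \<longleftrightarrow> l = b \<and> (k = q \<or> Suc k = q)"
    if "k \<ge> 1" for k l
    using q that even_count_M_J[OF Q, of k l]
    unfolding normal_form_real_blocks(3)[OF nf] odd_sizes_at_def by (auto simp: count_with_eigenvalue)
  then show ?thesis using q unfolding odd_at_def odd_sizes_at_def by blast
qed

text \<open>Filtering by the eigenvalue \<open>b\<close> separates the two summands on both sides: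
  scaling by \<open>c\<close> fixes \<open>b\<close>, and being injective it brings no other
  eigenvalue to \<open>b\<close>. The sizes with eigenvalue \<open>b\<close> then determine
  \<open>m\<close>.\<close>

lemma normal_form_scaled_eq:
  assumes nf: "normal_form b m r N Q" and nf': "normal_form b m' r' N' Q'"
    and dim: "m + 2 * r = m' + 2 * r'" and c: "c \<noteq> 0" "c * b = b"
    and eq: "real_blocks (diag_block_mat [N, Q]) = scale_eigenvalues c (real_blocks (diag_block_mat [N', Q']))"
  shows "m = m' \<and> r = r' \<and> \<Lambda> N = \<Lambda> N' \<and> real_blocks Q = scale_eigenvalues c (real_blocks Q')"
proof -
  let ?P = "\<lambda>x. snd x = complex_of_real b"
  let ?S = "block_sizes (\<Lambda> N)" and ?S' = "block_sizes (\<Lambda> N')"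
  note R = normal_form_real_blocks[OF nf] and R' = normal_form_real_blocks[OF nf']
  have cb: "complex_of_real c * complex_of_real b = complex_of_real b" using c(2) by (metis of_real_mult)
  have e: "with_eigenvalue (complex_of_real b) ?S + real_blocks Q =
      with_eigenvalue (complex_of_real b) ?S' + scale_eigenvalues c (real_blocks Q')"
    using eq scale_with_eigenvalue[OF c(2), of ?S'] unfolding R(3) R'(3) by (simp add: scale_eigenvalues_def)
  have sQ: "snd x \<noteq> complex_of_real b" if x: "x \<in># scale_eigenvalues c (real_blocks Q')" for x
  proof -
    obtain y where y: "y \<in># real_blocks Q'" "snd x = complex_of_real c * snd y"
      using x unfolding scale_eigenvalues_def by auto
    show ?thesis
    proof
      assume "snd x = complex_of_real b"
      then have "complex_of_real c * snd y = complex_of_real c * complex_of_real b" using y(2) cb by simp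
      then have "snd y = complex_of_real b" using c(1) by simp
      then show False using R'(4)[OF y(1)] by simp
    qed
  qed
  have F: "filter_mset ?P (with_eigenvalue (complex_of_real b) T + U) = with_eigenvalue (complex_of_real b) T \<and>
      filter_mset (\<lambda>x. \<not> ?P x) (with_eigenvalue (complex_of_real b) T + U) = U"
    if "\<And>x. x \<in># U \<Longrightarrow> \<not> ?P x" for T U
  proof -
    let ?W = "with_eigenvalue (complex_of_real b) T"
    have W: "count ?W x = 0" if "\<not> ?P x" for x using that by (cases x) (simp add: count_with_eigenvalue)
    have U: "count U x = 0" if "?P x" for x using that \<open>\<And>x. x \<in># U \<Longrightarrow> \<not> ?P x\<close> by (metis not_in_iff)
    show ?thesis
    proof
      show "filter_mset ?P (?W + U) = ?W"
      proof (rule multiset_eqI)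
        show "count (filter_mset ?P (?W + U)) x = count ?W x" for x
          using W[of x] U[of x] by (cases "?P x") simp_all
      qed
      show "filter_mset (\<lambda>x. \<not> ?P x) (?W + U) = U"
      proof (rule multiset_eqI)
        show "count (filter_mset (\<lambda>x. \<not> ?P x) (?W + U)) x = count U x" for x
          using W[of x] U[of x] by (cases "?P x") simp_all
      qed
    qed
  qed
  have "with_eigenvalue (complex_of_real b) ?S = with_eigenvalue (complex_of_real b) ?S'"
    using F[of "real_blocks Q" ?S] F[of "scale_eigenvalues c (real_blocks Q')" ?S'] R(4) sQ e by metis
  then have S: "?S = ?S'" by (rule with_eigenvalue_inj)
  have Qeq: "real_blocks Q = scale_eigenvalues c (real_blocks Q')" using e S by simp
  have "sum_mset ?S = m" "sum_mset ?S' = m'"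
    using sum_size_list R(1) R'(1) unfolding block_sizes_def by (metis sum_mset_sum_list)+
  then have m: "m = m'" using S by simp
  then have "\<Lambda> N = \<Lambda> N'" using block_sizes_inj S R(1) R'(1) by blast
  then show ?thesis using m dim Qeq by simp
qed

text \<open>The blocks of the rescaled matrix are split by eigenvalue. Those with \<open>b\<close>
  carry the odd multiplicities and give a block type in \<open>c_block_types\<close>; the others are
  stable under conjugation with even real multiplicities and come from some \<open>Q\<close> by
  \<open>M_J_exists\<close>. As \<open>Q\<close> has even size and \<open>d\<close> is odd,
  \<open>m\<close> is odd.\<close>

lemma normal_form_exists:
  assumes A: "A \<in> carrier_mat d d" and d: "odd d" and odd: "odd_at (real_blocks A) a q" and c: "c \<noteq> 0"
  obtains m r N Q where "normal_form (c * a) m r N Q" "m + 2 * r = d"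
    "real_blocks (diag_block_mat [N, Q]) = scale_eigenvalues c (real_blocks A)"
proof -
  define b where "b = c * a"
  define S where "S = scale_eigenvalues c (real_blocks A)"
  let ?b = "complex_of_real b"
  let ?P = "\<lambda>x. snd x = ?b"
  have cA: "c \<cdot>\<^sub>m A \<in> carrier_mat d d" using A by simp
  have S: "real_blocks (c \<cdot>\<^sub>m A) = S" unfolding S_def scale_eigenvalues_def by (rule real_blocks_smult[OF A c])
  have odd_S: "odd_at S b q" unfolding S_def b_def by (rule odd_at_scale[OF c odd])
  define U where "U = image_mset fst (filter_mset ?P S)"
  define T where "T = filter_mset (\<lambda>x. \<not> ?P x) S"
  have "with_eigenvalue ?b U = image_mset id (filter_mset ?P S)"
    unfolding with_eigenvalue_def U_def multiset.map_comp by (rule image_mset_cong) auto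
  then have U: "with_eigenvalue ?b U = filter_mset ?P S" by simp
  have ST: "S = with_eigenvalue ?b U + T" unfolding U T_def by (rule multiset_partition)
  have posS: "k \<ge> 1" if "(k, l) \<in># S" for k l using real_blocks_pos[OF cA, of k l] that S by simp
  have posT: "k \<ge> 1" if "(k, l) \<in># T" for k l using posS[of k l] that unfolding T_def by simp
  have posU: "k \<ge> 1" if "k \<in># U" for k using posS that unfolding U_def by auto
  have zeroT: "count T (0, l) = 0" for l using posT[of 0 l] by (metis not_in_iff not_one_le_zero)
  have symS: "image_mset (map_prod id cnj) S = S" using real_blocks_cnj[OF cA] S by simp
  have symT: "image_mset (map_prod id cnj) T = T"
  proof -
    have "filter_mset (\<lambda>x. \<not> ?P x) (image_mset (map_prod id cnj) S) =
        image_mset (map_prod id cnj) (filter_mset (\<lambda>x. \<not> ?P (map_prod id cnj x)) S)"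
      by (simp add: filter_mset_image_mset o_def)
    moreover have "?P (map_prod id cnj x) \<longleftrightarrow> ?P x" for x :: "nat \<times> complex" by (auto simp: complex_eq_iff)
    ultimately show ?thesis unfolding symS T_def by simp
  qed
  have cnt: "count S (k, complex_of_real l) = (if l = b then count U k else 0) + count T (k, complex_of_real l)" for k l
    unfolding ST by (simp add: count_with_eigenvalue)
  have T_b: "count T (k, ?b) = 0" for k unfolding T_def by simp
  have evenT: "even (count T (k, complex_of_real l))" for k l
  proof (cases "l = b \<or> k = 0")
    case True
    then show ?thesis using T_b zeroT by auto
  next
    case False
    then have "k \<ge> 1" by simp
    then have "odd (count S (k, complex_of_real l)) \<longleftrightarrow> l = b \<and> (k = q \<or> Suc k = q)"
      using odd_S unfolding odd_at_def by blast
    then show ?thesis using False cnt[of k l] by simp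
  qed
  obtain r Q where QM: "Q \<in> M_J r" and rQ: "real_blocks Q = T"
    by (rule M_J_exists[OF _ symT evenT]) (use posT in blast)+
  note Q = M_J_carrier[OF QM]
  have bQ: "?b \<notin> spec Q" unfolding spec_real_blocks[OF Q] rQ T_def by auto
  have oddU: "odd_sizes_at U q"
  proof -
    have "odd (count U k) \<longleftrightarrow> k = q \<or> Suc k = q" if "k \<ge> 1" for k
    proof -
      have "odd (count S (k, ?b)) \<longleftrightarrow> b = b \<and> (k = q \<or> Suc k = q)"
        using odd_S that unfolding odd_at_def by blast
      then show ?thesis using cnt[of k b] T_b[of k] by simp
    qed
    then show ?thesis using odd_S unfolding odd_at_def odd_sizes_at_def by blast
  qed
  define m where "m = sum_mset U"
  obtain \<tau> where t: "\<tau> \<in> block_types m" "block_sizes \<tau> = U"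
    by (rule block_sizes_surj[of U m]) (use posU m_def in auto)
  have "sum_mset (image_mset fst (with_eigenvalue ?b U)) = m"
    unfolding with_eigenvalue_def m_def by (simp add: multiset.map_comp o_def)
  moreover have "sum_mset (image_mset fst S) = d" using real_blocks_size[OF cA] S by simp
  moreover have "sum_mset (image_mset fst T) = 2 * r" using real_blocks_size[OF Q] rQ by simp
  ultimately have md: "m + 2 * r = d" unfolding ST by simp
  then have m: "odd m" using d by presburger
  then have m1: "m \<ge> 1" by presburger
  have tc: "\<tau> \<in> c_block_types m" using c_block_types_iff[OF m] t oddU by blast
  let ?N = "type_mat b \<tau>"
  have nf: "normal_form b m r ?N Q"
    unfolding normal_form_def using m tc QM bQ type_mat_carrier[OF t(1)] type_mat_jordan_part[OF t(1) m1] by simp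
  have "real_blocks (diag_block_mat [?N, Q]) = S"
    unfolding normal_form_real_blocks(3)[OF nf] type_mat_jordan_part(2)[OF t(1) m1] t(2) rQ ST ..
  then show thesis using that nf md unfolding b_def S_def by blast
qed

text \<open>A finite spectrum can be enumerated by decreasing modulus, so the ordered list only
  expresses that the spectral radius is 1.\<close>

lemma Q0_set_iff:
  "Q \<in> Q0_set r \<longleftrightarrow> Q \<in> M_J r \<and> 0 \<notin> spec Q \<and> (\<exists>\<mu>\<in>spec Q. cmod \<mu> = 1) \<and> (\<forall>\<mu>\<in>spec Q. cmod \<mu> \<le> 1)"
proof (cases "Q \<in> M_J r \<and> 0 \<notin> spec Q")
  case True
  then have Q: "Q \<in> carrier_mat (2 * r) (2 * r)" using M_J_carrier by blast
  have "(\<exists>\<mu>s. spec Q = set \<mu>s \<and> distinct \<mu>s \<and> \<mu>s \<noteq> [] \<and> cmod (hd \<mu>s) = 1 \<and>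
      sorted_wrt (\<lambda>\<mu> \<nu>. cmod \<mu> \<ge> cmod \<nu>) \<mu>s \<and> cmod (last \<mu>s) > 0) \<longleftrightarrow>
    (\<exists>\<mu>\<in>spec Q. cmod \<mu> = 1) \<and> (\<forall>\<mu>\<in>spec Q. cmod \<mu> \<le> 1)" (is "?L \<longleftrightarrow> ?R")
  proof
    assume ?L
    then obtain \<mu>s where \<mu>s: "spec Q = set \<mu>s" "\<mu>s \<noteq> []" "cmod (hd \<mu>s) = 1"
      "sorted_wrt (\<lambda>\<mu> \<nu>. cmod \<mu> \<ge> cmod \<nu>) \<mu>s" by blast
    then show ?R by (cases \<mu>s) auto
  next
    assume R: ?R
    have "finite (spec Q)" unfolding spec_real_blocks[OF Q] by simp
    then obtain ys where ys: "set ys = spec Q" "distinct ys" using finite_distinct_list by blast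
    define \<mu>s where "\<mu>s = rev (sort_key cmod ys)"
    have set: "set \<mu>s = spec Q" and dist: "distinct \<mu>s" unfolding \<mu>s_def using ys by auto
    have ne: "\<mu>s \<noteq> []" using R set by auto
    have sorted: "sorted_wrt (\<lambda>\<mu> \<nu>. cmod \<mu> \<ge> cmod \<nu>) \<mu>s"
    proof -
      have "sorted_wrt (\<le>) (map cmod (sort_key cmod ys))" by simp
      then show ?thesis unfolding \<mu>s_def sorted_wrt_rev sorted_wrt_map .
    qed
    obtain \<mu> where \<mu>: "\<mu> \<in> set \<mu>s" "cmod \<mu> = 1" using R set by auto
    have "cmod \<mu> \<le> cmod (hd \<mu>s)" using sorted \<mu>(1) by (cases \<mu>s) auto
    moreover have "cmod (hd \<mu>s) \<le> 1" using R set hd_in_set[OF ne] by blast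
    ultimately have "cmod (hd \<mu>s) = 1" using \<mu>(2) by simp
    moreover have "last \<mu>s \<noteq> 0" using True set last_in_set[OF ne] by metis
    ultimately show ?L using set dist ne sorted by (intro exI[of _ \<mu>s]) auto
  qed
  then show ?thesis using True unfolding Q0_set_def by simp
next
  case False
  then show ?thesis unfolding Q0_set_def by blast
qed

text \<open>Two maps with the same fibres on \<open>P\<close> have images in bijection. The value at
  a class is computed on an arbitrary representative.\<close>

lemma bij_betw_classes:
  assumes iff: "\<And>x y. P x \<Longrightarrow> P y \<Longrightarrow> cl x = cl y \<longleftrightarrow> iv x = iv y" and img: "iv ` Collect P = T"
  shows "\<exists>\<phi>. bij_betw \<phi> (cl ` Collect P) T \<and> (\<forall>x. P x \<longrightarrow> \<phi> (cl x) = iv x)"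
proof -
  define \<phi> where "\<phi> c = iv (SOME x. P x \<and> cl x = c)" for c
  have val: "\<phi> (cl x) = iv x" if "P x" for x
  proof -
    have "P (SOME y. P y \<and> cl y = cl x) \<and> cl (SOME y. P y \<and> cl y = cl x) = cl x"
      by (rule someI[of _ x]) (use that in simp)
    then show ?thesis unfolding \<phi>_def using iff that by blast
  qed
  have "inj_on \<phi> (cl ` Collect P)" by (rule inj_onI) (use val iff in auto)
  moreover have "\<phi> ` (cl ` Collect P) = T" using val img by (force simp: image_image)
  ultimately show ?thesis using val unfolding bij_betw_def by blast
qed

declare diag_block_mat.simps [simp del]

lemma dsum_empty:
  assumes M: "M \<in> carrier_mat d d" shows "diag_block_mat [M, 0\<^sub>m 0 0] = (M :: real mat)"
proof -
  have z: "(0\<^sub>m 0 0 :: real mat) \<in> carrier_mat 0 0" by simp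
  show ?thesis unfolding diag_block_mat_two[OF M z] using M by (intro eq_matI) auto
qed

text \<open>Both sides say only that \<open>N\<close> is a direct sum of Jordan blocks for
  \<open>b\<close>: the complement is \<open>Q\<close> on the left and empty on the right.\<close>

lemma jordan_part_dsum_iff:
  assumes N: "N \<in> carrier_mat m m" and Q: "Q \<in> carrier_mat k k" and b: "complex_of_real b \<notin> spec Q"
  shows "jordan_part (diag_block_mat [N, Q]) b N \<longleftrightarrow> jordan_part N b N"
proof -
  let ?shape = "\<exists>ns. (\<forall>k\<in>set ns. k \<ge> 1) \<and> N = diag_block_mat (map (\<lambda>k. sub_jordan_block k b) ns)"
  have z: "(0\<^sub>m 0 0 :: real mat) \<in> carrier_mat 0 0" by simp
  have zb: "complex_of_real b \<notin> spec (0\<^sub>m 0 0)" unfolding spec_real_blocks[OF z] real_blocks_empty by simp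
  have "similar_mat N (diag_block_mat [N, 0\<^sub>m 0 0])" unfolding dsum_empty[OF N] by (rule similar_mat_refl[OF N])
  then have "jordan_part N b N \<longleftrightarrow> ?shape" unfolding jordan_part_def using z zb by blast
  moreover have "similar_mat (diag_block_mat [N, Q]) (diag_block_mat [N, Q])"
    by (rule similar_mat_refl[OF dsum_carrier[OF N Q]])
  then have "jordan_part (diag_block_mat [N, Q]) b N \<longleftrightarrow> ?shape" unfolding jordan_part_def using Q b by blast
  ultimately show ?thesis by blast
qed

lemma form2_iff:
  "form2 n r M N Q \<longleftrightarrow> r \<ge> 1 \<and> (\<exists>m. m + 2 * r = 2 * n - 1 \<and> M = diag_block_mat [N, Q] \<and> normal_form 1 m r N Q)"
proof -
  have "jordan_part M 1 N \<longleftrightarrow> jordan_part N 1 N"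
    if "M = diag_block_mat [N, Q]" "N \<in> carrier_mat m m" "Q \<in> M_J r" "1 \<notin> spec Q" for m
    using jordan_part_dsum_iff[OF that(2) M_J_carrier[OF that(3)], of 1] that(1,4) by simp
  then show ?thesis unfolding form2_def normal_form_def of_real_1 by blast
qed

lemma form3_iff:
  "form3 n r M N Q \<longleftrightarrow> r \<ge> 1 \<and> Q \<in> Q0_set r \<and>
    (\<exists>m. m + 2 * r = 2 * n - 1 \<and> M = diag_block_mat [N, Q] \<and> normal_form 0 m r N Q)"
proof -
  have "Q \<in> M_J r \<and> 0 \<notin> spec Q" if "Q \<in> Q0_set r" using that unfolding Q0_set_def by blast
  moreover have "jordan_part M 0 N \<longleftrightarrow> jordan_part N 0 N"
    if "M = diag_block_mat [N, Q]" "N \<in> carrier_mat m m" "Q \<in> M_J r" "0 \<notin> spec Q" for m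
    using jordan_part_dsum_iff[OF that(2) M_J_carrier[OF that(3)], of 0] that(1,4) by simp
  ultimately show ?thesis unfolding form3_def normal_form_def of_real_0 by blast
qed

lemma form1_iff:
  assumes "n \<ge> 1"
  shows "form1 n M \<longleftrightarrow> normal_form 1 (2 * n - 1) 0 M (0\<^sub>m 0 0)"
proof -
  have z: "(0\<^sub>m 0 0 :: real mat) \<in> carrier_mat 0 0" by simp
  have "(0\<^sub>m 0 0 :: real mat) \<in> M_J 0"
    using z J_std_carrier[of 0] unfolding M_J_def by (auto intro!: eq_matI)
  moreover have "odd (2 * n - 1)" using assms by presburger
  moreover have "complex_of_real 1 \<notin> spec (0\<^sub>m 0 0)" unfolding spec_real_blocks[OF z] real_blocks_empty by simp
  ultimately show ?thesis unfolding form1_def normal_form_def by auto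
qed

section \<open>Isomorphism classes of the three forms\<close>

definition admissible :: "nat \<Rightarrow> real \<Rightarrow> nat \<Rightarrow> real mat \<Rightarrow> bool" where
  "admissible n b q M \<longleftrightarrow> M \<in> carrier_mat (2 * n - 1) (2 * n - 1) \<and> odd_at (real_blocks M) b q \<and> \<not> nilpotent_mat M"

text \<open>For nonzero \<open>b\<close> an odd, hence positive, multiplicity yields a block with
  eigenvalue \<open>b\<close>; otherwise \<open>Q\<close> is not empty and supplies a nonzero
  eigenvalue.\<close>

lemma normal_form_not_nilpotent:
  assumes nf: "normal_form b m r N Q" and b: "b \<noteq> 0 \<or> (r \<ge> 1 \<and> 0 \<notin> spec Q)"
  shows "\<not> nilpotent_mat (diag_block_mat [N, Q])"
proof
  note M = normal_form_carrier[OF nf]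
  assume "nilpotent_mat (diag_block_mat [N, Q])"
  then have zero: "snd x = 0" if "x \<in># real_blocks (diag_block_mat [N, Q])" for x
    using that nilpotent_mat_iff[OF M] by blast
  have Q: "Q \<in> carrier_mat (2 * r) (2 * r)" using nf M_J_carrier unfolding normal_form_def by blast
  from b show False
  proof
    assume "b \<noteq> 0"
    obtain q where q: "odd_at (real_blocks (diag_block_mat [N, Q])) b q" using normal_form_odd_at[OF nf] by blast
    then have "odd (count (real_blocks (diag_block_mat [N, Q])) (q, complex_of_real b))"
      unfolding odd_at_def by blast
    then have "(q, complex_of_real b) \<in># real_blocks (diag_block_mat [N, Q])"
      by (metis even_zero not_in_iff)
    then show False using zero \<open>b \<noteq> 0\<close> by fastforce
  next
    assume r: "r \<ge> 1 \<and> 0 \<notin> spec Q"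
    have "real_blocks Q \<noteq> {#}" using real_blocks_size[OF Q] r by auto
    then obtain x where x: "x \<in># real_blocks Q" by blast
    then have "snd x = 0" using zero normal_form_real_blocks(3)[OF nf] by simp
    moreover have "snd x \<in> spec Q" using x unfolding spec_real_blocks[OF Q] by simp
    ultimately show False using r by simp
  qed
qed

lemma form_admissible:
  assumes n: "n \<ge> 1"
  shows "form1 n M \<Longrightarrow> \<exists>q. admissible n 1 q M" "form2 n r M N Q \<Longrightarrow> \<exists>q. admissible n 1 q M"
    "form3 n r M N Q \<Longrightarrow> \<exists>q. admissible n 0 q M"
proof -
  have key: "\<exists>q. admissible n b q (diag_block_mat [N, Q])"
    if nf: "normal_form b m r N Q" and "m + 2 * r = 2 * n - 1" "b \<noteq> 0 \<or> (r \<ge> 1 \<and> 0 \<notin> spec Q)" for b m r N Q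
    using normal_form_carrier[OF nf] normal_form_odd_at[OF nf] normal_form_not_nilpotent[OF nf] that
    unfolding admissible_def by simp
  show "\<exists>q. admissible n 1 q M" if "form1 n M"
  proof -
    have "M \<in> carrier_mat (2 * n - 1) (2 * n - 1)" using that unfolding form1_def by blast
    from dsum_empty[OF this] show ?thesis
      using key[OF that[unfolded form1_iff[OF n]]] by simp
  qed
  show "\<exists>q. admissible n 1 q M" if "form2 n r M N Q"
    using that key[of 1 _ r N Q] unfolding form2_iff by auto
  show "\<exists>q. admissible n 0 q M" if "form3 n r M N Q"
    using that key[of 0 _ r N Q] unfolding form3_iff Q0_set_iff by auto
qed

text \<open>The real eigenvalue with odd multiplicities is unique, so a rescaling of one block
  multiset into the other must carry \<open>b'\<close> to \<open>b\<close>.\<close>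

lemma admissible_scale:
  assumes M: "admissible n b q M" and M': "admissible n b' q' M'"
    and eq: "lie_iso_class (almost_abelian M) = lie_iso_class (almost_abelian M')"
  obtains c where "c \<noteq> 0" "real_blocks M = scale_eigenvalues c (real_blocks M')" "c * b' = b"
proof -
  have "M \<in> carrier_mat (2 * n - 1) (2 * n - 1)" "M' \<in> carrier_mat (2 * n - 1) (2 * n - 1)" "\<not> nilpotent_mat M'"
    using M M' unfolding admissible_def by auto
  from iffD1[OF lie_iso_class_almost_abelian_eq_iff[OF this] eq] obtain c where
    c: "c \<noteq> 0" "real_blocks M = scale_eigenvalues c (real_blocks M')" by blast
  have "odd_at (real_blocks M) (c * b') q'"
    unfolding c(2) using M' by (intro odd_at_scale[OF c(1)]) (simp add: admissible_def)
  then have "c * b' = b" using M odd_at_unique unfolding admissible_def by blast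
  then show thesis using that c by blast
qed

lemma admissible_class_eqI:
  assumes M: "admissible n b q M" and M': "admissible n b' q' M'"
    and "c \<noteq> 0" "real_blocks M = scale_eigenvalues c (real_blocks M')"
  shows "lie_iso_class (almost_abelian M) = lie_iso_class (almost_abelian M')"
  using lie_iso_class_almost_abelian_eq_iff[of M "2 * n - 1" M'] assms unfolding admissible_def by blast

lemma classes_of_forms:
  assumes n: "n \<ge> 1"
  shows "{lie_iso_class (almost_abelian A) | A. A \<in> carrier_mat (2 * n - 1) (2 * n - 1) \<and>
        \<not> nilpotent_mat A \<and> (\<exists>j. complex_structure (almost_abelian A) j)}
     = {lie_iso_class (almost_abelian M) | M.
        form1 n M \<or> (\<exists>r N Q. form2 n r M N Q) \<or> (\<exists>r N Q. form3 n r M N Q)}" (is "?L = ?R")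
proof -
  have d: "odd (2 * n - 1)" using n by presburger
  have forward: "\<exists>M. (form1 n M \<or> (\<exists>r N Q. form2 n r M N Q) \<or> (\<exists>r N Q. form3 n r M N Q)) \<and>
      lie_iso_class (almost_abelian A) = lie_iso_class (almost_abelian M)"
    if A: "A \<in> carrier_mat (2 * n - 1) (2 * n - 1)" and nil: "\<not> nilpotent_mat A"
      and cs: "\<exists>j. complex_structure (almost_abelian A) j" for A
  proof -
    obtain a q where odd: "odd_at (real_blocks A) a q"
      using complex_structure_iff_odd_at[OF A d] cs by blast
    have cls: "lie_iso_class (almost_abelian A) = lie_iso_class (almost_abelian M)"
      if M: "M \<in> carrier_mat (2 * n - 1) (2 * n - 1)" and c: "c \<noteq> 0"
        and eq: "real_blocks M = scale_eigenvalues c (real_blocks A)" for M c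
      using iffD2[OF lie_iso_class_almost_abelian_eq_iff[OF M A nil]] c eq by blast
    show ?thesis
    proof (cases "a = 0")
      case False
      then have c: "1 / a \<noteq> 0" by simp
      obtain m r N Q where nf: "normal_form (1 / a * a) m r N Q" and md: "m + 2 * r = 2 * n - 1"
        and rb: "real_blocks (diag_block_mat [N, Q]) = scale_eigenvalues (1 / a) (real_blocks A)"
        using normal_form_exists[OF A d odd c] by blast
      have nf: "normal_form 1 m r N Q" using nf False by simp
      note cl = cls[OF _ c rb, folded md, OF normal_form_carrier[OF nf]]
      show ?thesis
      \<comment> \<open>An empty \<open>Q\<close> gives the first form, any other the
        second.\<close>
      proof (cases "r = 0")
        case True
        then have "Q \<in> carrier_mat 0 0" using nf M_J_carrier[of Q 0] unfolding normal_form_def by simp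
        then have Q: "Q = 0\<^sub>m 0 0" by (intro eq_matI) auto
        have "N \<in> carrier_mat m m" using nf unfolding normal_form_def by blast
        then have "diag_block_mat [N, Q] = N" unfolding Q by (rule dsum_empty)
        moreover have "form1 n N" using nf md True unfolding form1_iff[OF n] Q by simp
        ultimately show ?thesis using cl by auto
      next
        case False
        then have "form2 n r (diag_block_mat [N, Q]) N Q" unfolding form2_iff using nf md by auto
        then show ?thesis using cl by blast
      qed
    next
      case True
      have fin: "finite (cmod ` spec A)" unfolding spec_real_blocks[OF A] by simp
      obtain x where x: "x \<in># real_blocks A" "snd x \<noteq> 0" using nil nilpotent_mat_iff[OF A] by blast
      have xs: "cmod (snd x) \<in> cmod ` spec A" unfolding spec_real_blocks[OF A] using x by simp
      \<comment> \<open>The spectral radius, positive because a non-nilpotent matrix has a nonzero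
        eigenvalue.\<close>
      define \<rho> where "\<rho> = Max (cmod ` spec A)"
      have \<rho>_ge: "cmod \<mu> \<le> \<rho>" if "\<mu> \<in> spec A" for \<mu> unfolding \<rho>_def using fin that by simp
      have "\<rho> \<in> cmod ` spec A" unfolding \<rho>_def by (rule Max_in[OF fin]) (use xs in blast)
      then obtain \<nu> where \<nu>: "\<nu> \<in> spec A" "cmod \<nu> = \<rho>" by blast
      have "0 < cmod (snd x)" using x(2) by simp
      also have "\<dots> \<le> \<rho>" unfolding \<rho>_def using fin xs by simp
      finally have \<rho>: "\<rho> > 0" .
      then have c: "1 / \<rho> \<noteq> 0" by simp
      obtain m r N Q where nf: "normal_form (1 / \<rho> * a) m r N Q" and md: "m + 2 * r = 2 * n - 1"
        and rb: "real_blocks (diag_block_mat [N, Q]) = scale_eigenvalues (1 / \<rho>) (real_blocks A)"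
        using normal_form_exists[OF A d odd c] by blast
      have nf: "normal_form 0 m r N Q" using nf True by simp
      note cl = cls[OF _ c rb, folded md, OF normal_form_carrier[OF nf]]
      note R = normal_form_real_blocks[OF nf]
      have QM: "Q \<in> M_J r" and Q0: "0 \<notin> spec Q" using nf unfolding normal_form_def by auto
      note Q = M_J_carrier[OF QM]
      have le: "cmod \<mu> \<le> 1" if "\<mu> \<in> spec Q" for \<mu>
      proof -
        obtain y where y: "y \<in># real_blocks Q" "snd y = \<mu>" using \<open>\<mu> \<in> spec Q\<close> unfolding spec_real_blocks[OF Q] by blast
        then have "y \<in># scale_eigenvalues (1 / \<rho>) (real_blocks A)" unfolding rb[symmetric] R(3) by simp
        then obtain z where z: "z \<in># real_blocks A" "\<mu> = complex_of_real (1 / \<rho>) * snd z"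
          using y(2) unfolding scale_eigenvalues_def by auto
        have "cmod (snd z) \<le> \<rho>" by (rule \<rho>_ge) (use z(1) in \<open>simp add: spec_real_blocks[OF A]\<close>)
        then show ?thesis using \<rho> unfolding z(2) by (simp add: norm_mult norm_divide)
      qed
      \<comment> \<open>An eigenvalue of maximal modulus is rescaled to modulus 1. It differs from
        0, so its block belongs to \<open>Q\<close> and not to \<open>N\<close>.\<close>
      have "\<exists>\<mu>\<in>spec Q. cmod \<mu> = 1"
      proof -
        obtain z where z: "z \<in># real_blocks A" "snd z = \<nu>" using \<nu>(1) unfolding spec_real_blocks[OF A] by blast
        let ?y = "(fst z, complex_of_real (1 / \<rho>) * \<nu>)"
        have "?y \<in># scale_eigenvalues (1 / \<rho>) (real_blocks A)"
          unfolding scale_eigenvalues_def using z by (force simp: case_prod_unfold)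
        moreover have n1: "cmod (snd ?y) = 1" using \<nu>(2) \<rho> by (simp add: norm_mult norm_divide)
        then have "?y \<notin># with_eigenvalue (complex_of_real 0) (block_sizes (\<Lambda> N))"
          unfolding with_eigenvalue_def by auto
        ultimately have "?y \<in># real_blocks Q" unfolding rb[symmetric] R(3) by simp
        then show ?thesis using n1 unfolding spec_real_blocks[OF Q] by (metis image_eqI)
      qed
      then have QS: "Q \<in> Q0_set r" unfolding Q0_set_iff using QM Q0 le by blast
      have "r \<ge> 1"
      proof (rule ccontr)
        assume "\<not> r \<ge> 1"
        then have "real_blocks Q = {#}"
          using real_blocks_size[OF Q] real_blocks_pos[OF Q] by (cases "real_blocks Q") force+
        then have "spec Q = {}" unfolding spec_real_blocks[OF Q] by simp
        with \<open>\<exists>\<mu>\<in>spec Q. cmod \<mu> = 1\<close> show False by simp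
      qed
      then have "form3 n r (diag_block_mat [N, Q]) N Q" unfolding form3_iff using nf md QS by auto
      then show ?thesis using cl by blast
    qed
  qed
  have backward: "M \<in> carrier_mat (2 * n - 1) (2 * n - 1) \<and> \<not> nilpotent_mat M \<and>
      (\<exists>j. complex_structure (almost_abelian M) j)"
    if "form1 n M \<or> (\<exists>r N Q. form2 n r M N Q) \<or> (\<exists>r N Q. form3 n r M N Q)" for M
  proof -
    have "\<exists>b q. admissible n b q M" using \<open>form1 n M \<or> _\<close> form_admissible[OF n] by meson
    then obtain b q where "admissible n b q M" by blast
    then show ?thesis using complex_structure_iff_odd_at[OF _ d, of M] unfolding admissible_def by blast
  qed
  show ?thesis
  proof
    show "?L \<subseteq> ?R"
    proof
      fix X assume "X \<in> ?L"
      then obtain A where "X = lie_iso_class (almost_abelian A)" "A \<in> carrier_mat (2 * n - 1) (2 * n - 1)"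
        "\<not> nilpotent_mat A" "\<exists>j. complex_structure (almost_abelian A) j" by blast
      with forward[of A] obtain M where "form1 n M \<or> (\<exists>r N Q. form2 n r M N Q) \<or> (\<exists>r N Q. form3 n r M N Q)"
        "X = lie_iso_class (almost_abelian M)" by metis
      then show "X \<in> ?R" by (intro CollectI exI[of _ M] conjI)
    qed
    show "?R \<subseteq> ?L"
    proof
      fix X assume "X \<in> ?R"
      then obtain M where "X = lie_iso_class (almost_abelian M)"
        "form1 n M \<or> (\<exists>r N Q. form2 n r M N Q) \<or> (\<exists>r N Q. form3 n r M N Q)" by (elim CollectE exE conjE)
      with backward[of M] show "X \<in> ?L" by (intro CollectI exI[of _ M] conjI) simp_all
    qed
  qed
qed

lemma normal_form_type_mat:
  assumes "\<tau> \<in> c_block_types m" "odd m" "Q \<in> M_J r" "complex_of_real b \<notin> spec Q"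
  shows "normal_form b m r (type_mat b \<tau>) Q" "\<Lambda> (type_mat b \<tau>) = \<tau>"
proof -
  have t: "\<tau> \<in> block_types m" using c_block_types_iff[OF assms(2)] assms(1) by blast
  have m: "m \<ge> 1" using assms(2) by presburger
  show "normal_form b m r (type_mat b \<tau>) Q" "\<Lambda> (type_mat b \<tau>) = \<tau>"
    unfolding normal_form_def using assms type_mat_carrier[OF t] type_mat_jordan_part[OF t m] by auto
qed

text \<open>Kept apart from the other two forms, because here the invariant has no component for
  \<open>Q\<close>. The odd eigenvalue 1 on both sides forces the scaling factor 1.\<close>

lemma form1_classes:
  assumes n: "n \<ge> 1"
  shows "\<exists>\<phi>. bij_betw \<phi> {lie_iso_class (almost_abelian M) | M. form1 n M} (c_block_types (2 * n - 1)) \<and>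
        (\<forall>M. form1 n M \<longrightarrow> \<phi> (lie_iso_class (almost_abelian M)) = \<Lambda> M)"
proof -
  have d: "odd (2 * n - 1)" using n by presburger
  have "lie_iso_class (almost_abelian M) = lie_iso_class (almost_abelian M') \<longleftrightarrow> \<Lambda> M = \<Lambda> M'"
    if F: "form1 n M" and F': "form1 n M'" for M M'
  proof -
    note nf = F[unfolded form1_iff[OF n]] and nf' = F'[unfolded form1_iff[OF n]]
    obtain q q' where q: "admissible n 1 q M" "admissible n 1 q' M'" using form_admissible(1)[OF n] F F' by blast
    have e: "diag_block_mat [M, 0\<^sub>m 0 0] = M" "diag_block_mat [M', 0\<^sub>m 0 0] = M'"
      using F F' dsum_empty unfolding form1_def by blast+
    show ?thesis
    proof
      assume "lie_iso_class (almost_abelian M) = lie_iso_class (almost_abelian M')"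
      from admissible_scale[OF q this] obtain c where c: "c \<noteq> 0" "real_blocks M = scale_eigenvalues c (real_blocks M')" "c * 1 = 1"
        by blast
      show "\<Lambda> M = \<Lambda> M'"
        using normal_form_scaled_eq[OF nf nf' refl c(1) c(3)] c(2) unfolding e by blast
    next
      assume "\<Lambda> M = \<Lambda> M'"
      then have "real_blocks M = scale_eigenvalues 1 (real_blocks M')"
        using normal_form_real_blocks(2)[OF nf] normal_form_real_blocks(2)[OF nf'] by (simp add: scale_eigenvalues_one)
      then show "lie_iso_class (almost_abelian M) = lie_iso_class (almost_abelian M')"
        using admissible_class_eqI[OF q, of 1] by simp
    qed
  qed
  moreover have "\<Lambda> ` Collect (form1 n) = c_block_types (2 * n - 1)"
  proof
    show "\<Lambda> ` Collect (form1 n) \<subseteq> c_block_types (2 * n - 1)" unfolding form1_def by blast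
    show "c_block_types (2 * n - 1) \<subseteq> \<Lambda> ` Collect (form1 n)"
    proof
      fix \<tau> assume t: "\<tau> \<in> c_block_types (2 * n - 1)"
      then have "\<tau> \<in> block_types (2 * n - 1)" using c_block_types_iff[OF d] by blast
      from type_mat_carrier[OF this] type_mat_jordan_part[OF this] t d
      have "form1 n (type_mat 1 \<tau>)" "\<Lambda> (type_mat 1 \<tau>) = \<tau>" using n unfolding form1_def by auto
      then show "\<tau> \<in> \<Lambda> ` Collect (form1 n)" by (metis image_eqI mem_Collect_eq)
    qed
  qed
  ultimately have "\<exists>\<phi>. bij_betw \<phi> ((\<lambda>M. lie_iso_class (almost_abelian M)) ` Collect (form1 n)) (c_block_types (2 * n - 1)) \<and>
      (\<forall>M. form1 n M \<longrightarrow> \<phi> (lie_iso_class (almost_abelian M)) = \<Lambda> M)"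
    by (intro bij_betw_classes) auto
  then show ?thesis by (simp add: image_Collect)
qed

section \<open>The moduli of \<open>Q\<close> and the parametrization of the second and third
  form\<close>

lemma scale_eigenvalues_scale: "scale_eigenvalues c (scale_eigenvalues d S) = scale_eigenvalues (c * d) S"
  unfolding scale_eigenvalues_def by (simp add: multiset.map_comp o_def case_prod_unfold mult.assoc)

lemma similar_uminus_iff:
  assumes X: "X \<in> carrier_mat d d" and Y: "Y \<in> carrier_mat d d"
  shows "similar_mat X (- Y) \<longleftrightarrow> real_blocks X = scale_eigenvalues (- 1) (real_blocks Y)"
proof -
  have "- Y = (- 1) \<cdot>\<^sub>m Y" by (intro eq_matI) auto
  moreover have "real_blocks ((- 1) \<cdot>\<^sub>m Y) = scale_eigenvalues (- 1) (real_blocks Y)"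
    unfolding scale_eigenvalues_def by (rule real_blocks_smult[OF Y]) simp
  ultimately show ?thesis using similar_iff_real_blocks[OF X, of "- Y"] Y by simp
qed

text \<open>A class contains its representative, whose size is \<open>2 * r\<close>; hence the class
  also determines \<open>r\<close>. This keeps the members of the union over \<open>k\<close>
  apart.\<close>

lemma Q1_rel_classes:
  assumes Q: "Q \<in> Q1_set r" and Q': "Q' \<in> Q1_set r'"
  shows "Q1_rel r `` {Q} = Q1_rel r' `` {Q'} \<longleftrightarrow> r = r' \<and> real_blocks Q = real_blocks Q'"
proof -
  have sim: "similar_mat X Y \<longleftrightarrow> real_blocks X = real_blocks Y" if "X \<in> Q1_set k" "Y \<in> Q1_set k" for X Y k
    using that similar_iff_real_blocks M_J_carrier unfolding Q1_set_def by blast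
  show ?thesis
  proof
    assume eq: "Q1_rel r `` {Q} = Q1_rel r' `` {Q'}"
    have "Q \<in> Q1_rel r `` {Q}" using Q sim[OF Q Q] unfolding Q1_rel_def by auto
    then have 1: "Q \<in> Q1_set r'" "similar_mat Q' Q" unfolding eq unfolding Q1_rel_def by auto
    have "Q \<in> carrier_mat (2 * r) (2 * r)" "Q \<in> carrier_mat (2 * r') (2 * r')"
      using Q 1(1) M_J_carrier unfolding Q1_set_def by auto
    then have "r = r'" by auto
    then show "r = r' \<and> real_blocks Q = real_blocks Q'" using 1 sim[OF Q' 1(1)] by simp
  next
    assume "r = r' \<and> real_blocks Q = real_blocks Q'"
    then show "Q1_rel r `` {Q} = Q1_rel r' `` {Q'}"
      unfolding Q1_rel_def using Q Q' sim by auto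
  qed
qed

lemma Q0_rel_classes:
  assumes Q: "Q \<in> Q0_set r" and Q': "Q' \<in> Q0_set r'"
  shows "Q0_rel r `` {Q} = Q0_rel r' `` {Q'} \<longleftrightarrow> r = r' \<and>
    (real_blocks Q = real_blocks Q' \<or> real_blocks Q = scale_eigenvalues (- 1) (real_blocks Q'))"
proof -
  have car: "X \<in> carrier_mat (2 * k) (2 * k)" if "X \<in> Q0_set k" for X k
    using that M_J_carrier unfolding Q0_set_def by blast
  have rel: "(X, Y) \<in> Q0_rel k \<longleftrightarrow> X \<in> Q0_set k \<and> Y \<in> Q0_set k \<and>
      (real_blocks X = real_blocks Y \<or> real_blocks X = scale_eigenvalues (- 1) (real_blocks Y))" for X Y k
    unfolding Q0_rel_def using similar_iff_real_blocks[OF car car] similar_uminus_iff[OF car car] by blast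
  \<comment> \<open>Negating twice changes nothing, so the relation is symmetric.\<close>
  have neg: "scale_eigenvalues (- 1) (scale_eigenvalues (- 1) S) = S" for S
    by (simp add: scale_eigenvalues_scale scale_eigenvalues_one)
  show ?thesis
  proof
    assume eq: "Q0_rel r `` {Q} = Q0_rel r' `` {Q'}"
    have "Q \<in> Q0_rel r `` {Q}" using rel Q by blast
    then have "(Q', Q) \<in> Q0_rel r'" unfolding eq by blast
    then have 1: "Q \<in> Q0_set r'" "real_blocks Q' = real_blocks Q \<or> real_blocks Q' = scale_eigenvalues (- 1) (real_blocks Q)"
      using rel by blast+
    have "r = r'" using car[OF Q] car[OF 1(1)] by auto
    moreover have "real_blocks Q = real_blocks Q' \<or> real_blocks Q = scale_eigenvalues (- 1) (real_blocks Q')"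
      using 1(2) neg by metis
    ultimately show "r = r' \<and>
      (real_blocks Q = real_blocks Q' \<or> real_blocks Q = scale_eigenvalues (- 1) (real_blocks Q'))" by blast
  next
    assume a: "r = r' \<and>
      (real_blocks Q = real_blocks Q' \<or> real_blocks Q = scale_eigenvalues (- 1) (real_blocks Q'))"
    have "(Q, Y) \<in> Q0_rel r \<longleftrightarrow> (Q', Y) \<in> Q0_rel r" for Y
      unfolding rel using Q Q' a neg by metis
    then show "Q0_rel r `` {Q} = Q0_rel r' `` {Q'}" using a by blast
  qed
qed

text \<open>Scaling by \<open>c\<close> multiplies the spectral radius by the absolute value of
  \<open>c\<close>, and both spectral radii are 1. As \<open>c\<close> is real, only the sign is
  left.\<close>

lemma Q0_set_scale:
  assumes Q: "Q \<in> Q0_set r" and Q': "Q' \<in> Q0_set r'"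
    and eq: "real_blocks Q = scale_eigenvalues c (real_blocks Q')"
  shows "c = 1 \<or> c = - 1"
proof -
  have car: "X \<in> carrier_mat (2 * k) (2 * k)" if "X \<in> Q0_set k" for X k
    using that M_J_carrier unfolding Q0_set_def by blast
  have "spec Q = (\<lambda>x. complex_of_real c * x) ` spec Q'"
    unfolding spec_real_blocks[OF car[OF Q]] spec_real_blocks[OF car[OF Q']] eq scale_eigenvalues_def
    by (simp add: image_image case_prod_unfold)
  moreover obtain \<mu> where \<mu>: "\<mu> \<in> spec Q" "cmod \<mu> = 1" "\<And>x. x \<in> spec Q \<Longrightarrow> cmod x \<le> 1"
    using Q unfolding Q0_set_iff by blast
  moreover obtain \<nu> where \<nu>: "\<nu> \<in> spec Q'" "cmod \<nu> = 1" "\<And>x. x \<in> spec Q' \<Longrightarrow> cmod x \<le> 1"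
    using Q' unfolding Q0_set_iff by blast
  ultimately obtain \<kappa> where \<kappa>: "\<kappa> \<in> spec Q'" "\<mu> = complex_of_real c * \<kappa>" and "complex_of_real c * \<nu> \<in> spec Q" by blast
  have "\<bar>c\<bar> \<le> 1" using \<mu>(3)[OF \<open>complex_of_real c * \<nu> \<in> spec Q\<close>] \<nu>(2) by (simp add: norm_mult)
  moreover have "1 = \<bar>c\<bar> * cmod \<kappa>" using \<mu>(2) unfolding \<kappa>(2) by (simp add: norm_mult)
  then have "1 \<le> \<bar>c\<bar>" using mult_left_mono[OF \<nu>(3)[OF \<kappa>(1)], of "\<bar>c\<bar>"] by simp
  ultimately show ?thesis by linarith
qed

lemma image_quadruples:
  "(\<lambda>(r, M, N, Q). f M) ` {(r, M, N, Q). F r M N Q} = {f M | M. \<exists>r N Q. F r M N Q}"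
proof (intro equalityI subsetI)
  fix X assume "X \<in> (\<lambda>(r, M, N, Q). f M) ` {(r, M, N, Q). F r M N Q}"
  then obtain x where x: "case x of (r, M, N, Q) \<Rightarrow> F r M N Q" "X = (case x of (r, M, N, Q) \<Rightarrow> f M)" by blast
  obtain r M N Q where "x = (r, M, N, Q)" by (cases x)
  with x show "X \<in> {f M | M. \<exists>r N Q. F r M N Q}" by auto
next
  fix X assume "X \<in> {f M | M. \<exists>r N Q. F r M N Q}"
  then obtain r M N Q where "F r M N Q" "X = f M" by blast
  then show "X \<in> (\<lambda>(r, M, N, Q). f M) ` {(r, M, N, Q). F r M N Q}"
    by (intro image_eqI[of _ _ "(r, M, N, Q)"]) simp_all
qed

text \<open>Two normal forms give isomorphic Lie algebras iff they agree up to a factor \<open>c\<close> fixing \<open>b\<close>: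
  for \<open>b = 1\<close> this forces \<open>c = 1\<close>, for \<open>b = 0\<close> the normalisation of the spectral radius forces
  \<open>c = 1\<close> or \<open>c = -1\<close>.\<close>

lemma form_classes:
  assumes n: "n \<ge> 1"
    and form: "\<And>r M N Q. F r M N Q \<longleftrightarrow> r \<ge> 1 \<and> Q \<in> X r \<and>
      (\<exists>m. m + 2 * r = 2 * n - 1 \<and> M = diag_block_mat [N, Q] \<and> normal_form b m r N Q)"
    and X: "\<And>r Q. Q \<in> X r \<Longrightarrow> Q \<in> M_J r \<and> complex_of_real b \<notin> spec Q"
    and any: "\<And>r M N Q. F r M N Q \<Longrightarrow> \<exists>q. admissible n b q M"
    and rel: "\<And>r r' Q Q'. Q \<in> X r \<Longrightarrow> Q' \<in> X r' \<Longrightarrow> R r `` {Q} = R r' `` {Q'} \<longleftrightarrow>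
      r = r' \<and> (\<exists>c. c \<noteq> 0 \<and> c * b = b \<and> real_blocks Q = scale_eigenvalues c (real_blocks Q'))"
  shows "\<exists>\<phi>. bij_betw \<phi> {lie_iso_class (almost_abelian M) | M. \<exists>r N Q. F r M N Q}
          (\<Union>k\<in>{1..n - 1}. c_block_types (2 * k - 1) \<times> X (n - k) // R (n - k)) \<and>
        (\<forall>r M N Q. F r M N Q \<longrightarrow> \<phi> (lie_iso_class (almost_abelian M)) = (\<Lambda> N, R r `` {Q}))"
proof -
  let ?P = "\<lambda>(r, M, N, Q). F r M N Q"
  let ?cl = "\<lambda>(r :: nat, M, N :: real mat, Q :: real mat). lie_iso_class (almost_abelian M)"
  let ?iv = "\<lambda>(r, M :: real mat, N, Q). (\<Lambda> N, R r `` {Q})"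
  let ?T = "\<Union>k\<in>{1..n - 1}. c_block_types (2 * k - 1) \<times> X (n - k) // R (n - k)"
  have iff: "?cl x = ?cl y \<longleftrightarrow> ?iv x = ?iv y" if "?P x" "?P y" for x y
  proof -
    obtain r M N Q r' M' N' Q' where xy: "x = (r, M, N, Q)" "y = (r', M', N', Q')" by (cases x; cases y) blast
    have F: "F r M N Q" and F': "F r' M' N' Q'" using that unfolding xy by auto
    obtain m m' where Q: "Q \<in> X r" "Q' \<in> X r'"
      and m: "m + 2 * r = 2 * n - 1" "M = diag_block_mat [N, Q]" and nf: "normal_form b m r N Q"
      and m': "m' + 2 * r' = 2 * n - 1" "M' = diag_block_mat [N', Q']" and nf': "normal_form b m' r' N' Q'"
      using F F' unfolding form by blast
    obtain q q' where q: "admissible n b q M" "admissible n b q' M'" using any[OF F] any[OF F'] by blast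
    show ?thesis
    proof
      assume "?cl x = ?cl y"
      then have "lie_iso_class (almost_abelian M) = lie_iso_class (almost_abelian M')" by (simp add: xy)
      from admissible_scale[OF q this] obtain c where c: "c \<noteq> 0" "real_blocks M = scale_eigenvalues c (real_blocks M')" "c * b = b"
        by blast
      from normal_form_scaled_eq[OF nf nf' _ c(1) c(3)] c(2) m m'
      have "r = r'" "\<Lambda> N = \<Lambda> N'" and sc: "real_blocks Q = scale_eigenvalues c (real_blocks Q')" by simp_all
      then show "?iv x = ?iv y" using rel[OF Q] c by (auto simp: xy)
    next
      assume "?iv x = ?iv y"
      then have L: "\<Lambda> N = \<Lambda> N'" and "R r `` {Q} = R r' `` {Q'}" by (auto simp: xy)
      then obtain c where c: "c \<noteq> 0" "c * b = b" "real_blocks Q = scale_eigenvalues c (real_blocks Q')"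
        using rel[OF Q] by blast
      \<comment> \<open>Because \<open>c * b = b\<close>, the factor relating \<open>Q\<close> and
        \<open>Q'\<close> leaves the blocks of \<open>N'\<close> alone, so it scales the whole of
        \<open>M'\<close>.\<close>
      have "real_blocks M = scale_eigenvalues c (with_eigenvalue (complex_of_real b) (block_sizes (\<Lambda> N'))) + scale_eigenvalues c (real_blocks Q')"
        unfolding m normal_form_real_blocks(3)[OF nf] scale_with_eigenvalue[OF c(2)] c(3) L by simp
      also have "\<dots> = scale_eigenvalues c (real_blocks M')"
        unfolding m' normal_form_real_blocks(3)[OF nf'] by (simp add: scale_eigenvalues_def)
      finally show "?cl x = ?cl y" using admissible_class_eqI[OF q c(1)] by (simp add: xy)
    qed
  qed
  have img: "?iv ` Collect ?P = ?T"
  proof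
    show "?iv ` Collect ?P \<subseteq> ?T"
    proof
      fix z assume "z \<in> ?iv ` Collect ?P"
      then obtain r M N Q where F: "F r M N Q" and z: "z = (\<Lambda> N, R r `` {Q})" by auto
      obtain m where r: "r \<ge> 1" and Q: "Q \<in> X r" and m: "m + 2 * r = 2 * n - 1" and nf: "normal_form b m r N Q"
        using F unfolding form by blast
      have "odd m" "\<Lambda> N \<in> c_block_types m" using nf unfolding normal_form_def by auto
      \<comment> \<open>The index is \<open>k = n - r\<close>, so that \<open>m = 2 * k - 1\<close>:
        \<open>r \<ge> 1\<close> bounds \<open>k\<close> above by \<open>n - 1\<close>, and oddness
        of \<open>m\<close> keeps it positive.\<close>
      moreover have "n - r \<in> {1..n - 1}" "2 * (n - r) - 1 = m" "n - (n - r) = r"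
        using m r \<open>odd m\<close> by (auto elim!: oddE)
      moreover have "R r `` {Q} \<in> X r // R r" using Q by (rule quotientI)
      ultimately show "z \<in> ?T" unfolding z by (intro UN_I[of "n - r"]) auto
    qed
    show "?T \<subseteq> ?iv ` Collect ?P"
    proof
      fix z assume "z \<in> ?T"
      then obtain k \<tau> Y where k: "k \<in> {1..n - 1}" and t: "\<tau> \<in> c_block_types (2 * k - 1)" and Y: "Y \<in> X (n - k) // R (n - k)"
        and z: "z = (\<tau>, Y)" by auto
      obtain Q where Q: "Q \<in> X (n - k)" "Y = R (n - k) `` {Q}" using Y by (rule quotientE)
      have odd: "odd (2 * k - 1)"
      proof -
        have "k \<ge> 1" using k by simp
        then show ?thesis by presburger
      qed
      note nf = normal_form_type_mat[OF t odd conjunct1[OF X[OF Q(1)]] conjunct2[OF X[OF Q(1)]]]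
      have "F (n - k) (diag_block_mat [type_mat b \<tau>, Q]) (type_mat b \<tau>) Q"
        unfolding form using nf(1) Q(1) k by (auto intro!: exI[of _ "2 * k - 1"])
      then show "z \<in> ?iv ` Collect ?P"
        by (intro image_eqI[of _ _ "(n - k, diag_block_mat [type_mat b \<tau>, Q], type_mat b \<tau>, Q)"])
          (simp_all add: z Q(2) nf(2))
    qed
  qed
  obtain \<phi> where \<phi>: "bij_betw \<phi> (?cl ` Collect ?P) ?T" "\<And>x. ?P x \<Longrightarrow> \<phi> (?cl x) = ?iv x"
    using bij_betw_classes[of ?P ?cl ?iv ?T, OF iff img] by blast
  have cl: "?cl ` Collect ?P = {lie_iso_class (almost_abelian M) | M. \<exists>r N Q. F r M N Q}"
    by (rule image_quadruples)
  show ?thesis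
  proof (intro exI[of _ \<phi>] conjI allI impI)
    show "bij_betw \<phi> {lie_iso_class (almost_abelian M) | M. \<exists>r N Q. F r M N Q} ?T"
      using \<phi>(1) unfolding cl .
    show "\<phi> (lie_iso_class (almost_abelian M)) = (\<Lambda> N, R r `` {Q})" if "F r M N Q" for r M N Q
      using \<phi>(2)[of "(r, M, N, Q)"] that by simp
  qed
qed

lemma form2_classes:
  assumes n: "n \<ge> 1"
  shows "\<exists>\<phi>. bij_betw \<phi> {lie_iso_class (almost_abelian M) | M. \<exists>r N Q. form2 n r M N Q}
          (\<Union>k\<in>{1..n - 1}. c_block_types (2 * k - 1) \<times> C1 (n - k)) \<and>
        (\<forall>r M N Q. form2 n r M N Q \<longrightarrow>
          \<phi> (lie_iso_class (almost_abelian M)) = (\<Lambda> N, Q1_rel r `` {Q}))"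
  unfolding C1_def
proof (rule form_classes[OF n, of _ _ 1])
  show "form2 n r M N Q \<longleftrightarrow> r \<ge> 1 \<and> Q \<in> Q1_set r \<and>
      (\<exists>m. m + 2 * r = 2 * n - 1 \<and> M = diag_block_mat [N, Q] \<and> normal_form 1 m r N Q)" for r M N Q
    unfolding form2_iff Q1_set_def normal_form_def by auto
  show "Q1_rel r `` {Q} = Q1_rel r' `` {Q'} \<longleftrightarrow>
      r = r' \<and> (\<exists>c. c \<noteq> 0 \<and> c * 1 = 1 \<and> real_blocks Q = scale_eigenvalues c (real_blocks Q'))"
    if "Q \<in> Q1_set r" "Q' \<in> Q1_set r'" for r r' Q Q'
    unfolding Q1_rel_classes[OF that] by (simp add: scale_eigenvalues_one)
qed (use form_admissible(2)[OF n] in \<open>auto simp: Q1_set_def\<close>)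

lemma form3_classes:
  assumes n: "n \<ge> 1"
  shows "\<exists>\<phi>. bij_betw \<phi> {lie_iso_class (almost_abelian M) | M. \<exists>r N Q. form3 n r M N Q}
          (\<Union>k\<in>{1..n - 1}. c_block_types (2 * k - 1) \<times> C0 (n - k)) \<and>
        (\<forall>r M N Q. form3 n r M N Q \<longrightarrow>
          \<phi> (lie_iso_class (almost_abelian M)) = (\<Lambda> N, Q0_rel r `` {Q}))"
  unfolding C0_def
proof (rule form_classes[OF n, of _ _ 0])
  show "form3 n r M N Q \<longleftrightarrow> r \<ge> 1 \<and> Q \<in> Q0_set r \<and>
      (\<exists>m. m + 2 * r = 2 * n - 1 \<and> M = diag_block_mat [N, Q] \<and> normal_form 0 m r N Q)" for r M N Q
    by (rule form3_iff)
  show "Q0_rel r `` {Q} = Q0_rel r' `` {Q'} \<longleftrightarrow>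
      r = r' \<and> (\<exists>c. c \<noteq> 0 \<and> c * 0 = 0 \<and> real_blocks Q = scale_eigenvalues c (real_blocks Q'))"
    if "Q \<in> Q0_set r" "Q' \<in> Q0_set r'" for r r' Q Q'
  proof -
    \<comment> \<open>For \<open>b = 0\<close> the condition \<open>c * 0 = 0\<close> is empty, and
      \<open>c\<close> is restricted to 1 and -1 only by the normalised spectral radius.\<close>
    have "(real_blocks Q = real_blocks Q' \<or> real_blocks Q = scale_eigenvalues (- 1) (real_blocks Q')) \<longleftrightarrow>
        (\<exists>c. c \<noteq> 0 \<and> real_blocks Q = scale_eigenvalues c (real_blocks Q'))"
    proof
      assume "real_blocks Q = real_blocks Q' \<or> real_blocks Q = scale_eigenvalues (- 1) (real_blocks Q')"
      then show "\<exists>c. c \<noteq> 0 \<and> real_blocks Q = scale_eigenvalues c (real_blocks Q')"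
      proof
        assume "real_blocks Q = real_blocks Q'"
        then show ?thesis by (intro exI[of _ 1]) (simp add: scale_eigenvalues_one)
      next
        assume "real_blocks Q = scale_eigenvalues (- 1) (real_blocks Q')"
        then show ?thesis by (intro exI[of _ "- 1"]) simp
      qed
    next
      assume "\<exists>c. c \<noteq> 0 \<and> real_blocks Q = scale_eigenvalues c (real_blocks Q')"
      then obtain c where c: "real_blocks Q = scale_eigenvalues c (real_blocks Q')" by blast
      then show "real_blocks Q = real_blocks Q' \<or> real_blocks Q = scale_eigenvalues (- 1) (real_blocks Q')"
        using Q0_set_scale[OF that c] by (auto simp: scale_eigenvalues_one)
    qed
    then show ?thesis unfolding Q0_rel_classes[OF that] by simp
  qed
qed (use form_admissible(3)[OF n] in \<open>auto simp: Q0_set_def\<close>)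

theorem corollary4p18:
  fixes n :: nat
  assumes "n \<ge> 1"
  shows
    "({lie_iso_class (almost_abelian A) | A. A \<in> carrier_mat (2 * n - 1) (2 * n - 1) \<and>
        \<not> nilpotent_mat A \<and> (\<exists>j. complex_structure (almost_abelian A) j)}
     = {lie_iso_class (almost_abelian M) | M.
        form1 n M \<or> (\<exists>r N Q. form2 n r M N Q) \<or> (\<exists>r N Q. form3 n r M N Q)}) \<and>
     (\<exists>\<phi>. bij_betw \<phi> {lie_iso_class (almost_abelian M) | M. form1 n M}
          (c_block_types (2 * n - 1)) \<and>
        (\<forall>M. form1 n M \<longrightarrow> \<phi> (lie_iso_class (almost_abelian M)) = \<Lambda> M)) \<and>
     (\<exists>\<phi>. bij_betw \<phi> {lie_iso_class (almost_abelian M) | M. \<exists>r N Q. form2 n r M N Q}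
          (\<Union>k\<in>{1..n - 1}. c_block_types (2 * k - 1) \<times> C1 (n - k)) \<and>
        (\<forall>r M N Q. form2 n r M N Q \<longrightarrow>
          \<phi> (lie_iso_class (almost_abelian M)) = (\<Lambda> N, Q1_rel r `` {Q}))) \<and>
     (\<exists>\<phi>. bij_betw \<phi> {lie_iso_class (almost_abelian M) | M. \<exists>r N Q. form3 n r M N Q}
          (\<Union>k\<in>{1..n - 1}. c_block_types (2 * k - 1) \<times> C0 (n - k)) \<and>
        (\<forall>r M N Q. form3 n r M N Q \<longrightarrow>
          \<phi> (lie_iso_class (almost_abelian M)) = (\<Lambda> N, Q0_rel r `` {Q})))"
  by (rule conjI[OF classes_of_forms[OF assms] conjI[OF form1_classes[OF assms]
        conjI[OF form2_classes[OF assms] form3_classes[OF assms]]]])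

end
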